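(* There is a computable (in the sense of primitive recursive) function $$F:\{\text{codes for } \Pi^0_1\text{-sentences}\}\to\{\text{codes for computable diffeomorphisms of } \mathbb T^2\}$$ such that, writing $T_N$ for the diffeomorphism of $\mathbb T^2$ coded by $F(N)$: (1) for every code $N$ of a $\Pi^0_1$-sentence, $N$ is the code of a true sentence if and only if $T_N$ is measure theoretically isomorphic to $T_N^{-1}$; (2) for all codes $M\neq N$ of $\Pi^0_1$-sentences, $T_M$ is not measure theoretically isomorphic to $T_N$. Moreover every $T_N$ is a $C^\infty$ diffeomorphism that preserves Lebesgue measure and is ergodic with respect to it.
   Context: $\mathbb T^2=[0,1]^2/\!\sim$ is the two-torus (opposite edges identified) with Lebesgue measure $\lambda$. All diffeomorphisms are $C^\infty$ and Lebesgue measure preserving. "Computable" means primitive recursive throughout. $\Pi^0_1$-sentences. A sentence $\phi$ in the language $\{+,*,0,1,<\}$ is $\Pi^0_1$ if it has the form $(\forall x_0)\cdots(\forall x_n)\psi$ where $\psi$ is a Boolean combination of equalities and inequalities of polynomials in $x_0,\dots,x_n$ and the constants $0,1$ (no free variables in $\phi$). It is true if it holds in $(\mathbb N,+,*,0,1,<)$. A standard (computable) Gödel numbering of formulas is fixed; the code of $\phi$ is its Gödel number. A Gödel numbering of computer programs is also fixed. Computable diffeomorphisms. A map $T:\mathbb T^2\to\mathbb T^2$ is effectively uniformly continuous if there are computable functions $d:\mathbb N\to\mathbb N$ (modulus of continuity) and $f:(\{0,1\}\times\{0,1\})^{<\mathbb N}\to(\{0,1\}\times\{0,1\})^{<\mathbb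 N}$ (approximation) such that, for every $n$, knowing $(x,y)$ to within $2^{-d(n)}$ determines $T(x,y)$ to within $2^{-n}$, and, given the first $d(n)$ binary digits of $x$ and $y$ (equivalently, dyadic rationals with denominator $2^{d(n)}$ approximating $x,y$), $f$ outputs $n$-digit binary approximations of the coordinates of $T(x,y)$. A diffeomorphism $T$ of $\mathbb T^2$ is computable if it is effectively $C^\infty$: there are functions $d(k,\cdot)$ and $f(k,\cdot)$, computable uniformly in $k$ (a single algorithm for all $k\in\mathbb N$), which in the same way give moduli of continuity and approximations for all partial derivatives $\partial^k/\partial^i x\,\partial^{k-i}y$ ($0\le i\le k$) of the coordinates of $T$, in the standard coordinates of $\mathbb R^2$. A code for $T$ is a Gödel number of a procedure computing such $d$ and $f$; it determines $T$ uniquely. Measure preserving transformations $S:X\to X$ and $T:Y\to Y$ are measure theoretically isomorphic ($S\cong T$) if there is an invertible measure preserving map between the two spaces that intertwines $S$ and $T$ up to sets of measure zero (it need not be smooth or continuous). *)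

theory Defs
  imports "HOL-Analysis.Analysis" "HOL-Library.Nat_Bijection"
begin

section \<open>Primitive recursive programs\<close>

datatype prog = Zero | Succ | Proj nat | Comp prog "prog list" | Rec prog prog

text \<open>Ill-formed applications (wrong number of arguments) get a junk value; only programs that
  satisfy \<open>has_arity\<close> are ever used.\<close>

fun has_arity :: "nat \<Rightarrow> prog \<Rightarrow> bool" where
  "has_arity n Zero \<longleftrightarrow> True"
| "has_arity n Succ \<longleftrightarrow> n = 1"
| "has_arity n (Proj i) \<longleftrightarrow> i < n"
| "has_arity n (Comp g hs) \<longleftrightarrow> has_arity (length hs) g \<and> (\<forall>h\<in>set hs. has_arity n h)"
| "has_arity n (Rec g h) \<longleftrightarrow> 0 < n \<and> has_arity (n - 1) g \<and> has_arity (n + 1) h"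

fun run :: "prog \<Rightarrow> nat list \<Rightarrow> nat" where
  "run Zero xs = 0"
| "run Succ xs = Suc (hd xs)"
| "run (Proj i) xs = xs ! i"
| "run (Comp g hs) xs = run g (map (\<lambda>h. run h xs) hs)"
| "run (Rec g h) xs = rec_nat (run g (tl xs)) (\<lambda>m r. run h (m # r # tl xs)) (hd xs)"

definition primitive_recursive :: "(nat \<Rightarrow> nat) \<Rightarrow> bool" where
  "primitive_recursive F \<longleftrightarrow> (\<exists>p. has_arity 1 p \<and> (\<forall>n. run p [n] = F n))"

fun prog_code :: "prog \<Rightarrow> nat" where
  "prog_code Zero = prod_encode (0, 0)"
| "prog_code Succ = prod_encode (1, 0)"
| "prog_code (Proj i) = prod_encode (2, i)"
| "prog_code (Comp g hs) =
     prod_encode (3, prod_encode (prog_code g, list_encode (map prog_code hs)))"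
| "prog_code (Rec g h) = prod_encode (4, prod_encode (prog_code g, prog_code h))"

lemma inj_prog_code: "inj prog_code"
proof (rule injI)
  fix p q show "prog_code p = prog_code q \<Longrightarrow> p = q"
  proof (induction p arbitrary: q)
    case Zero then show ?case by (cases q) auto
  next
    case Succ then show ?case by (cases q) auto
  next
    case (Proj i) then show ?case by (cases q) auto
  next
    case (Comp g hs)
    from Comp.prems obtain g' hs' where q: "q = Comp g' hs'"
      and g: "prog_code g = prog_code g'" and hs: "map prog_code hs = map prog_code hs'"
      by (cases q) (auto dest: injD[OF inj_list_encode])
    have "hs = hs'"
    proof (rule nth_equalityI)
      show len: "length hs = length hs'" using hs by (metis length_map)
      fix i assume i: "i < length hs"
      have "prog_code (hs ! i) = prog_code (hs' ! i)" using hs i len by (metis nth_map)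
      with Comp.IH(2)[of "hs ! i"] i show "hs ! i = hs' ! i" by auto
    qed
    with q g Comp.IH(1) show ?case by auto
  next
    case (Rec g h) then show ?case by (cases q) auto
  qed
qed


section \<open>Arithmetical sentences\<close>

datatype trm = Var nat | C0 | C1 | Add trm trm | Mult trm trm

datatype fm = Eq trm trm | Less trm trm | Neg fm | Conj fm fm | Disj fm fm | Imp fm fm
  | All nat fm | Ex nat fm

primrec trm_value :: "(nat \<Rightarrow> nat) \<Rightarrow> trm \<Rightarrow> nat" where
  "trm_value e (Var i) = e i"
| "trm_value e C0 = 0"
| "trm_value e C1 = 1"
| "trm_value e (Add s t) = trm_value e s + trm_value e t"
| "trm_value e (Mult s t) = trm_value e s * trm_value e t"

primrec satisfies :: "(nat \<Rightarrow> nat) \<Rightarrow> fm \<Rightarrow> bool" where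
  "satisfies e (Eq s t) \<longleftrightarrow> trm_value e s = trm_value e t"
| "satisfies e (Less s t) \<longleftrightarrow> trm_value e s < trm_value e t"
| "satisfies e (Neg a) \<longleftrightarrow> \<not> satisfies e a"
| "satisfies e (Conj a b) \<longleftrightarrow> satisfies e a \<and> satisfies e b"
| "satisfies e (Disj a b) \<longleftrightarrow> satisfies e a \<or> satisfies e b"
| "satisfies e (Imp a b) \<longleftrightarrow> (satisfies e a \<longrightarrow> satisfies e b)"
| "satisfies e (All i a) \<longleftrightarrow> (\<forall>m. satisfies (e(i := m)) a)"
| "satisfies e (Ex i a) \<longleftrightarrow> (\<exists>m. satisfies (e(i := m)) a)"

definition true_in_nat :: "fm \<Rightarrow> bool" where
  "true_in_nat a \<longleftrightarrow> (\<forall>e. satisfies e a)"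

primrec trm_vars :: "trm \<Rightarrow> nat set" where
  "trm_vars (Var i) = {i}"
| "trm_vars C0 = {}"
| "trm_vars C1 = {}"
| "trm_vars (Add s t) = trm_vars s \<union> trm_vars t"
| "trm_vars (Mult s t) = trm_vars s \<union> trm_vars t"

primrec free_vars :: "fm \<Rightarrow> nat set" where
  "free_vars (Eq s t) = trm_vars s \<union> trm_vars t"
| "free_vars (Less s t) = trm_vars s \<union> trm_vars t"
| "free_vars (Neg a) = free_vars a"
| "free_vars (Conj a b) = free_vars a \<union> free_vars b"
| "free_vars (Disj a b) = free_vars a \<union> free_vars b"
| "free_vars (Imp a b) = free_vars a \<union> free_vars b"
| "free_vars (All i a) = free_vars a - {i}"
| "free_vars (Ex i a) = free_vars a - {i}"

primrec quantifier_free :: "fm \<Rightarrow> bool" where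
  "quantifier_free (Eq s t) \<longleftrightarrow> True"
| "quantifier_free (Less s t) \<longleftrightarrow> True"
| "quantifier_free (Neg a) \<longleftrightarrow> quantifier_free a"
| "quantifier_free (Conj a b) \<longleftrightarrow> quantifier_free a \<and> quantifier_free b"
| "quantifier_free (Disj a b) \<longleftrightarrow> quantifier_free a \<and> quantifier_free b"
| "quantifier_free (Imp a b) \<longleftrightarrow> quantifier_free a \<and> quantifier_free b"
| "quantifier_free (All i a) \<longleftrightarrow> False"
| "quantifier_free (Ex i a) \<longleftrightarrow> False"

definition Pi01_sentence :: "fm \<Rightarrow> bool" where
  "Pi01_sentence a \<longleftrightarrow>
     (\<exists>n b. quantifier_free b \<and> a = foldr All [0..<Suc n] b) \<and> free_vars a = {}"

primrec trm_code :: "trm \<Rightarrow> nat" where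
  "trm_code (Var i) = prod_encode (0, i)"
| "trm_code C0 = prod_encode (1, 0)"
| "trm_code C1 = prod_encode (2, 0)"
| "trm_code (Add s t) = prod_encode (3, prod_encode (trm_code s, trm_code t))"
| "trm_code (Mult s t) = prod_encode (4, prod_encode (trm_code s, trm_code t))"

primrec fm_code :: "fm \<Rightarrow> nat" where
  "fm_code (Eq s t) = prod_encode (0, prod_encode (trm_code s, trm_code t))"
| "fm_code (Less s t) = prod_encode (1, prod_encode (trm_code s, trm_code t))"
| "fm_code (Neg a) = prod_encode (2, fm_code a)"
| "fm_code (Conj a b) = prod_encode (3, prod_encode (fm_code a, fm_code b))"
| "fm_code (Disj a b) = prod_encode (4, prod_encode (fm_code a, fm_code b))"
| "fm_code (Imp a b) = prod_encode (5, prod_encode (fm_code a, fm_code b))"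
| "fm_code (All i a) = prod_encode (6, prod_encode (i, fm_code a))"
| "fm_code (Ex i a) = prod_encode (7, prod_encode (i, fm_code a))"

lemma inj_trm_code: "inj trm_code"
proof (rule injI)
  fix s t show "trm_code s = trm_code t \<Longrightarrow> s = t"
  proof (induction s arbitrary: t)
    case (Var i) then show ?case by (cases t) auto
  next
    case C0 then show ?case by (cases t) auto
  next
    case C1 then show ?case by (cases t) auto
  next
    case (Add s1 s2) then show ?case by (cases t) auto
  next
    case (Mult s1 s2) then show ?case by (cases t) auto
  qed
qed

lemma inj_fm_code: "inj fm_code"
proof (rule injI)
  fix a b show "fm_code a = fm_code b \<Longrightarrow> a = b"
  proof (induction a arbitrary: b)
    case (Eq s t) then show ?case by (cases b) (auto simp: inj_eq[OF inj_trm_code])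
  next
    case (Less s t) then show ?case by (cases b) (auto simp: inj_eq[OF inj_trm_code])
  next
    case (Neg a) then show ?case by (cases b) auto
  next
    case (Conj a1 a2) then show ?case by (cases b) auto
  next
    case (Disj a1 a2) then show ?case by (cases b) auto
  next
    case (Imp a1 a2) then show ?case by (cases b) auto
  next
    case (All i a) then show ?case by (cases b) auto
  next
    case (Ex i a) then show ?case by (cases b) auto
  qed
qed

definition Pi01_codes :: "nat set" where
  "Pi01_codes = fm_code ` {a. Pi01_sentence a}"

definition codes_true_sentence :: "nat \<Rightarrow> bool" where
  "codes_true_sentence N \<longleftrightarrow> (\<exists>a. Pi01_sentence a \<and> true_in_nat a \<and> fm_code a = N)"


section \<open>The two-torus\<close>

definition torus_rel :: "real \<times> real \<Rightarrow> real \<times> real \<Rightarrow> bool" where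
  "torus_rel p q \<longleftrightarrow> fst p - fst q \<in> \<int> \<and> snd p - snd q \<in> \<int>"

lemma equivp_torus_rel: "equivp torus_rel"
proof (rule equivpI)
  show "reflp torus_rel" by (auto simp: reflp_def torus_rel_def)
  show "symp torus_rel" unfolding symp_def torus_rel_def by (metis Ints_minus minus_diff_eq)
  show "transp torus_rel"
  proof (rule transpI)
    fix p q r assume "torus_rel p q" "torus_rel q r"
    hence "(fst p - fst q) + (fst q - fst r) \<in> \<int>" "(snd p - snd q) + (snd q - snd r) \<in> \<int>"
      unfolding torus_rel_def by (blast intro: Ints_add)+
    thus "torus_rel p r" by (simp add: torus_rel_def)
  qed
qed

text \<open>The torus is \<open>\<real>\<^sup>2\<close> modulo \<open>\<int>\<^sup>2\<close>; restricted to the unit square this is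
  exactly the identification of opposite edges.\<close>

quotient_type torus = "real \<times> real" / torus_rel
  morphisms rep_torus to_torus
  by (rule equivp_torus_rel)

definition unit_square :: "(real \<times> real) set" where
  "unit_square = {0..1} \<times> {0..1}"

definition torus_lebesgue :: "torus measure" where
  "torus_lebesgue = distr (lebesgue_on unit_square)
     (sigma UNIV {A. to_torus -` A \<inter> unit_square \<in> sets lebesgue}) to_torus"

lemma unit_square_eq_cbox: "unit_square = cbox (0, 0) (1, 1)"
  by (simp add: unit_square_def cbox_Pair_eq)

lemma to_torus_measurable:
  "to_torus \<in> measurable (lebesgue_on unit_square)
     (sigma UNIV {A. to_torus -` A \<inter> unit_square \<in> sets lebesgue})"
proof (rule measurable_measure_of)
  fix A assume "A \<in> {A. to_torus -` A \<inter> unit_square \<in> sets lebesgue}"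
  thus "to_torus -` A \<inter> space (lebesgue_on unit_square) \<in> sets (lebesgue_on unit_square)"
    by (auto simp: sets_restrict_space_iff unit_square_eq_cbox)
qed auto

lemma space_torus_lebesgue [simp]: "space torus_lebesgue = UNIV"
  by (simp add: torus_lebesgue_def space_measure_of_conv)

lemma sets_torus_lebesgue:
  "sets torus_lebesgue = {A. to_torus -` A \<inter> unit_square \<in> sets lebesgue}" (is "_ = ?S")
proof -
  have us: "unit_square \<in> sets lebesgue" by (simp add: unit_square_eq_cbox)
  have "A \<in> ?S" if "A \<in> sigma_sets UNIV ?S" for A
    using that
  proof induction
    case (Compl A)
    have "to_torus -` (UNIV - A) \<inter> unit_square = unit_square - (to_torus -` A \<inter> unit_square)" by auto
    with sets.Diff[OF us] Compl show ?case by auto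
  next
    case (Union A)
    have "to_torus -` (\<Union>i. A i) \<inter> unit_square = (\<Union>i. to_torus -` A i \<inter> unit_square)" by auto
    moreover have "(\<Union>i. to_torus -` A i \<inter> unit_square) \<in> sets lebesgue"
      using Union by (intro sets.countable_UN) auto
    ultimately show ?case unfolding mem_Collect_eq by (rule ssubst)
  qed auto
  hence "sigma_sets UNIV ?S = ?S" by (intro equalityI subsetI sigma_sets.Basic)
  thus ?thesis by (simp add: torus_lebesgue_def sets_measure_of_conv)
qed

lemma emeasure_torus_lebesgue:
  assumes "A \<in> sets torus_lebesgue"
  shows "emeasure torus_lebesgue A = emeasure lebesgue (to_torus -` A \<inter> unit_square)"
proof -
  have "emeasure torus_lebesgue A =
      emeasure (lebesgue_on unit_square) (to_torus -` A \<inter> space (lebesgue_on unit_square))"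
    using assms unfolding torus_lebesgue_def
    by (intro emeasure_distr to_torus_measurable) (simp add: sets_measure_of_conv)
  thus ?thesis by (simp add: emeasure_restrict_space unit_square_eq_cbox)
qed

lemma emeasure_torus_lebesgue_UNIV: "emeasure torus_lebesgue UNIV = 1"
proof -
  have "emeasure torus_lebesgue UNIV = emeasure lebesgue (cbox (0, 0) (1, 1 :: real) :: (real \<times> real) set)"
    by (subst emeasure_torus_lebesgue)
       (simp_all add: sets_torus_lebesgue flip: unit_square_eq_cbox, simp add: unit_square_eq_cbox)
  also have "\<dots> = 1"
    by (simp add: cbox_Pair_eq lborel_prod[symmetric] lborel.emeasure_pair_measure_Times)
  finally show ?thesis .
qed

definition circle_norm :: "real \<Rightarrow> real" where
  "circle_norm t = min (frac t) (1 - frac t)"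

text \<open>The maximum of the distances of the two coordinates in the circle \<open>\<real>/\<int>\<close>.\<close>

lift_definition torus_dist :: "torus \<Rightarrow> torus \<Rightarrow> real" is
  "\<lambda>p q. max (circle_norm (fst p - fst q)) (circle_norm (snd p - snd q))"
proof -
  have *: "circle_norm (a - b) = circle_norm (a' - b')"
    if "a - a' \<in> \<int>" "b - b' \<in> \<int>" for a a' b b' :: real
  proof -
    have "(a - a') - (b - b') \<in> \<int>" using that by (rule Ints_diff)
    then obtain k where "(a - a') - (b - b') = of_int k" by (rule Ints_cases)
    hence "a - b = (a' - b') + of_int k" by simp
    hence "frac (a - b) = frac (a' - b')" by (simp add: frac_def)
    thus ?thesis by (simp add: circle_norm_def)
  qed
  fix p p' q q' assume "torus_rel p p'" "torus_rel q q'"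
  hence "circle_norm (fst p - fst q) = circle_norm (fst p' - fst q')"
    and "circle_norm (snd p - snd q) = circle_norm (snd p' - snd q')"
    unfolding torus_rel_def by (blast intro: *)+
  thus "max (circle_norm (fst p - fst q)) (circle_norm (snd p - snd q)) =
        max (circle_norm (fst p' - fst q')) (circle_norm (snd p' - snd q'))"
    by simp
qed


section \<open>Smooth maps of the torus\<close>

definition partial_x :: "(real \<times> real \<Rightarrow> real) \<Rightarrow> real \<times> real \<Rightarrow> real" where
  "partial_x g = (\<lambda>(x, y). deriv (\<lambda>t. g (t, y)) x)"

definition partial_y :: "(real \<times> real \<Rightarrow> real) \<Rightarrow> real \<times> real \<Rightarrow> real" where
  "partial_y g = (\<lambda>(x, y). deriv (\<lambda>t. g (x, t)) y)"

primrec C_k :: "nat \<Rightarrow> (real \<times> real \<Rightarrow> real) \<Rightarrow> bool" where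
  "C_k 0 g \<longleftrightarrow> continuous_on UNIV g"
| "C_k (Suc k) g \<longleftrightarrow> continuous_on UNIV g
     \<and> (\<forall>x y. (\<lambda>t. g (t, y)) differentiable at x \<and> (\<lambda>t. g (x, t)) differentiable at y)
     \<and> C_k k (partial_x g) \<and> C_k k (partial_y g)"

definition C_infinity :: "(real \<times> real \<Rightarrow> real) \<Rightarrow> bool" where
  "C_infinity g \<longleftrightarrow> (\<forall>k. C_k k g)"

text \<open>Smoothness is expressed in the standard coordinates of \<open>\<real>\<^sup>2\<close>: since \<open>\<real>\<^sup>2\<close> is the universal
  cover, every continuous self-map of the torus lifts, and two lifts differ by a constant in
  \<open>\<int>\<^sup>2\<close>, hence have the same partial derivatives.\<close>

definition smooth_lift :: "(real \<times> real \<Rightarrow> real \<times> real) \<Rightarrow> (torus \<Rightarrow> torus) \<Rightarrow> bool" where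
  "smooth_lift G T \<longleftrightarrow> (\<forall>p. to_torus (G p) = T (to_torus p))
     \<and> C_infinity (\<lambda>p. fst (G p)) \<and> C_infinity (\<lambda>p. snd (G p))"

definition torus_diffeomorphism :: "(torus \<Rightarrow> torus) \<Rightarrow> bool" where
  "torus_diffeomorphism T \<longleftrightarrow>
     bij T \<and> (\<exists>G. smooth_lift G T) \<and> (\<exists>G. smooth_lift G (inv T))"


section \<open>Measure preserving transformations\<close>

definition measure_preserving :: "'a measure \<Rightarrow> 'b measure \<Rightarrow> ('a \<Rightarrow> 'b) \<Rightarrow> bool" where
  "measure_preserving M N f \<longleftrightarrow> f \<in> measurable M N \<and> distr M N f = N"

definition ergodic :: "'a measure \<Rightarrow> ('a \<Rightarrow> 'a) \<Rightarrow> bool" where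
  "ergodic M T \<longleftrightarrow> measure_preserving M M T \<and>
     (\<forall>A\<in>sets M. T -` A \<inter> space M = A \<longrightarrow> emeasure M A = 0 \<or> emeasure M (space M - A) = 0)"

definition measure_isomorphic ::
    "'a measure \<Rightarrow> ('a \<Rightarrow> 'a) \<Rightarrow> 'b measure \<Rightarrow> ('b \<Rightarrow> 'b) \<Rightarrow> bool" where
  "measure_isomorphic M S N T \<longleftrightarrow>
     (\<exists>h h'. measure_preserving M N h \<and> measure_preserving N M h'
        \<and> (AE x in M. h' (h x) = x) \<and> (AE y in N. h (h' y) = y)
        \<and> (AE x in M. h (S x) = T (h x)))"


section \<open>Computable diffeomorphisms\<close>

type_synonym digits = "(bool \<times> bool) list"

definition binary_value :: "bool list \<Rightarrow> real" where
  "binary_value bs = (\<Sum>i<length bs. of_bool (bs ! i) / 2 ^ Suc i)"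

definition digits_point :: "digits \<Rightarrow> real \<times> real" where
  "digits_point s = (binary_value (map fst s), binary_value (map snd s))"

text \<open>The points both of whose coordinates have a binary expansion starting with the given digits.
  The cell is closed because dyadic rationals have two expansions.\<close>

definition digits_cell :: "digits \<Rightarrow> (real \<times> real) set" where
  "digits_cell s = (let (a, b) = digits_point s; w = 1 / 2 ^ length s in {a..a + w} \<times> {b..b + w})"

definition digits_code :: "digits \<Rightarrow> nat" where
  "digits_code s = list_encode (map (\<lambda>(a, b). 2 * of_bool a + of_bool b) s)"

definition int_pairs_code :: "(int \<times> int) list \<Rightarrow> nat" where
  "int_pairs_code zs = list_encode (map (\<lambda>(a, b). prod_encode (int_encode a, int_encode b)) zs)"

definition effectively_uniformly_continuous ::
    "(nat \<Rightarrow> nat) \<Rightarrow> (digits \<Rightarrow> digits) \<Rightarrow> (torus \<Rightarrow> torus) \<Rightarrow> bool" where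
  "effectively_uniformly_continuous d f T \<longleftrightarrow> (\<forall>n.
     (\<forall>P Q. torus_dist P Q \<le> 1 / 2 ^ d n \<longrightarrow> torus_dist (T P) (T Q) \<le> 1 / 2 ^ n)
     \<and> (\<forall>s. length s = d n \<longrightarrow> length (f s) = n
          \<and> (\<forall>p\<in>digits_cell s. torus_dist (to_torus (digits_point (f s))) (T (to_torus p)) \<le> 1 / 2 ^ n)))"

definition plane_dist :: "real \<times> real \<Rightarrow> real \<times> real \<Rightarrow> real" where
  "plane_dist p q = max \<bar>fst p - fst q\<bar> \<bar>snd p - snd q\<bar>"

text \<open>In both notions of approximation the precision \<open>n\<close> is to be read off from the length \<open>d n\<close> of
  the input; \<open>d\<close> can always be increased so as to be injective.

  The analogue for functions on the torus with values in \<open>\<real>\<^sup>2\<close>, given as periodic functions on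
  the plane. The values are not confined to the unit square, so an approximation with \<open>n\<close> binary
  digits after the point is given by its integer numerators over \<open>2 ^ n\<close>.\<close>

definition effectively_uniformly_continuous_plane ::
    "(nat \<Rightarrow> nat) \<Rightarrow> (digits \<Rightarrow> int \<times> int) \<Rightarrow> (real \<times> real \<Rightarrow> real \<times> real) \<Rightarrow> bool" where
  "effectively_uniformly_continuous_plane d f H \<longleftrightarrow> (\<forall>n.
     (\<forall>p q. plane_dist p q \<le> 1 / 2 ^ d n \<longrightarrow> plane_dist (H p) (H q) \<le> 1 / 2 ^ n)
     \<and> (\<forall>s. length s = d n \<longrightarrow> (\<forall>p\<in>digits_cell s.
          plane_dist (of_int (fst (f s)) / 2 ^ n, of_int (snd (f s)) / 2 ^ n) (H p) \<le> 1 / 2 ^ n)))"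

definition mixed_partial ::
    "nat \<Rightarrow> nat \<Rightarrow> (real \<times> real \<Rightarrow> real \<times> real) \<Rightarrow> real \<times> real \<Rightarrow> real \<times> real" where
  "mixed_partial i j G p =
     ((partial_x ^^ i) ((partial_y ^^ j) (\<lambda>q. fst (G q))) p,
      (partial_x ^^ i) ((partial_y ^^ j) (\<lambda>q. snd (G q))) p)"

text \<open>For \<open>k \<ge> 1\<close> the entry \<open>i \<le> k\<close> of the list \<open>f k s\<close> approximates the partial derivatives of
  order \<open>i\<close> in \<open>x\<close> and \<open>k - i\<close> in \<open>y\<close> of both coordinates.\<close>

definition effectively_smooth ::
    "(nat \<Rightarrow> nat \<Rightarrow> nat) \<Rightarrow> (digits \<Rightarrow> digits) \<Rightarrow> (nat \<Rightarrow> digits \<Rightarrow> (int \<times> int) list)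
      \<Rightarrow> (torus \<Rightarrow> torus) \<Rightarrow> bool" where
  "effectively_smooth d f\<^sub>0 f T \<longleftrightarrow>
     effectively_uniformly_continuous (d 0) f\<^sub>0 T
     \<and> (\<exists>G. smooth_lift G T \<and>
          (\<forall>k\<ge>1. (\<forall>s. length (f k s) = Suc k) \<and>
             (\<forall>i\<le>k. effectively_uniformly_continuous_plane (d k) (\<lambda>s. f k s ! i)
                (mixed_partial i (k - i) G))))"

text \<open>One program computes both functions: first argument \<open>0\<close> selects the moduli of continuity,
  first argument \<open>1\<close> the approximations.\<close>

definition computes_smooth_data :: "prog \<Rightarrow> (torus \<Rightarrow> torus) \<Rightarrow> bool" where
  "computes_smooth_data p T \<longleftrightarrow> has_arity 3 p \<and>
     (\<exists>d f\<^sub>0 f. effectively_smooth d f\<^sub>0 f T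
        \<and> (\<forall>k n. run p [0, k, n] = d k n)
        \<and> (\<forall>s. run p [1, 0, digits_code s] = digits_code (f\<^sub>0 s))
        \<and> (\<forall>k\<ge>1. \<forall>s. run p [1, k, digits_code s] = int_pairs_code (f k s)))"

definition codes_diffeomorphism :: "nat \<Rightarrow> (torus \<Rightarrow> torus) \<Rightarrow> bool" where
  "codes_diffeomorphism c T \<longleftrightarrow>
     torus_diffeomorphism T \<and> measure_preserving torus_lebesgue torus_lebesgue T
     \<and> (\<exists>p. prog_code p = c \<and> computes_smooth_data p T)"

text \<open>A code determines its diffeomorphism.\<close>

lemma circle_norm_le_dist: "circle_norm (a - b) \<le> \<bar>a - b - of_int k\<bar>"
proof -
  have "circle_norm (a - b) = circle_norm (a - b - of_int k)"
    by (simp add: circle_norm_def frac_def)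
  also have "circle_norm t \<le> \<bar>t\<bar>" for t :: real
  proof (cases "t \<ge> 0")
    case True
    then have "0 \<le> real_of_int \<lfloor>t\<rfloor>" by simp
    with True have "frac t \<le> \<bar>t\<bar>" unfolding frac_def by linarith
    then show ?thesis unfolding circle_norm_def by linarith
  next
    case False
    then have "\<lfloor>t\<rfloor> \<le> - 1" by linarith
    then have "real_of_int \<lfloor>t\<rfloor> \<le> - 1" by linarith
    with False have "1 - frac t \<le> \<bar>t\<bar>" unfolding frac_def by linarith
    then show ?thesis unfolding circle_norm_def by linarith
  qed
  finally show ?thesis .
qed

lemma circle_norm_attained: "\<exists>k::int. circle_norm t = \<bar>t - of_int k\<bar>"
proof (cases "frac t \<le> 1 - frac t")
  case True
  then have "circle_norm t = \<bar>t - of_int \<lfloor>t\<rfloor>\<bar>" unfolding circle_norm_def frac_def by linarith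
  then show ?thesis by blast
next
  case False
  then have "circle_norm t = \<bar>t - of_int (\<lfloor>t\<rfloor> + 1)\<bar>" unfolding circle_norm_def frac_def by linarith
  then show ?thesis by blast
qed

lemma circle_norm_triangle: "circle_norm (b - c) \<le> circle_norm (a - b) + circle_norm (a - c)"
proof -
  obtain k l :: int where "circle_norm (a - b) = \<bar>a - b - k\<bar>" "circle_norm (a - c) = \<bar>a - c - l\<bar>"
    using circle_norm_attained by metis
  moreover have "circle_norm (b - c) \<le> \<bar>b - c - of_int (l - k)\<bar>" by (rule circle_norm_le_dist)
  ultimately show ?thesis by (simp add: abs_if split: if_splits)
qed

lemma torus_dist_triangle: "torus_dist Q R \<le> torus_dist P Q + torus_dist P R"
proof (transfer, goal_cases)
  case (1 q r p)
  show ?case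
    using circle_norm_triangle[of "fst q" "fst r" "fst p"]
      circle_norm_triangle[of "snd q" "snd r" "snd p"] by linarith
qed

lemma circle_norm_nonpos:
  assumes "circle_norm t \<le> 0"
  shows "t \<in> \<int>"
proof -
  have "frac t \<le> 0"
    using assms frac_lt_1[of t] unfolding circle_norm_def by linarith
  then have "frac t = 0" using frac_ge_0[of t] by linarith
  thus ?thesis by (rule frac_eq_0_iff[THEN iffD1])
qed

lemma torus_dist_nonpos: "torus_dist P Q \<le> 0 \<Longrightarrow> P = Q"
  by transfer (simp add: torus_rel_def circle_norm_nonpos)

lemma binary_expansion_exists:
  assumes "0 \<le> x" "x < 1"
  shows "\<exists>bs. length bs = m \<and> binary_value bs \<le> x \<and> x < binary_value bs + 1 / 2 ^ m"
proof (induction m)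
  case 0
  show ?case using assms by (simp add: binary_value_def)
next
  case (Suc m)
  then obtain bs where bs: "length bs = m" "binary_value bs \<le> x" "x < binary_value bs + 1 / 2 ^ m" by blast
  define b where "b \<longleftrightarrow> x \<ge> binary_value bs + 1 / 2 ^ Suc m"
  have "binary_value (bs @ [b]) = binary_value bs + of_bool b / 2 ^ Suc m"
    by (simp add: binary_value_def bs(1) nth_append)
  moreover have "(1::real) / 2 ^ m = 1 / 2 ^ Suc m + 1 / 2 ^ Suc m" by simp
  ultimately have "binary_value (bs @ [b]) \<le> x \<and> x < binary_value (bs @ [b]) + 1 / 2 ^ Suc m"
    using bs by (cases b) (auto simp: b_def)
  with bs show ?case by (metis length_append_singleton)
qed

lemma digits_exist: "\<exists>s p. length s = m \<and> p \<in> digits_cell s \<and> to_torus p = P"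
proof -
  obtain x y where P: "P = to_torus (x, y)"
    by (metis Quotient3_abs_rep Quotient3_torus surj_pair)
  have "P = to_torus (frac x, frac y)"
    unfolding P torus.abs_eq_iff by (simp add: torus_rel_def frac_def)
  moreover obtain bs where bs: "length bs = m" "binary_value bs \<le> frac x" "frac x < binary_value bs + 1 / 2 ^ m"
    using binary_expansion_exists frac_ge_0 frac_lt_1 by blast
  moreover obtain cs where cs: "length cs = m" "binary_value cs \<le> frac y" "frac y < binary_value cs + 1 / 2 ^ m"
    using binary_expansion_exists frac_ge_0 frac_lt_1 by blast
  ultimately show ?thesis
    by (intro exI[of _ "zip bs cs"] exI[of _ "(frac x, frac y)"])
       (auto simp: digits_cell_def digits_point_def Let_def)
qed

lemma inj_digits_code: "inj digits_code"
proof (rule injI)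
  fix s t assume "digits_code s = digits_code t"
  then have "map (\<lambda>(a, b). 2 * of_bool a + of_bool b :: nat) s = map (\<lambda>(a, b). 2 * of_bool a + of_bool b) t"
    by (simp add: digits_code_def list_encode_eq)
  moreover have "inj (\<lambda>(a, b). 2 * of_bool a + of_bool b :: nat)"
    by (auto simp: inj_def of_bool_def split: if_splits)
  ultimately show "s = t" by (simp add: inj_map_eq_map)
qed

lemma codes_diffeomorphism_unique:
  assumes "codes_diffeomorphism c T" "codes_diffeomorphism c T'"
  shows "T = T'"
proof
  fix P
  obtain p where p: "prog_code p = c" "computes_smooth_data p T" "computes_smooth_data p T'"
    using assms inj_prog_code unfolding codes_diffeomorphism_def by (metis injD)
  obtain d f where T: "effectively_uniformly_continuous (d 0) f T"
    and d: "\<And>k n. run p [0, k, n] = d k n" and f: "\<And>s. run p [1, 0, digits_code s] = digits_code (f s)"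
    using p(2) unfolding computes_smooth_data_def effectively_smooth_def by blast
  obtain d' f' where T': "effectively_uniformly_continuous (d' 0) f' T'"
    and d': "\<And>k n. run p [0, k, n] = d' k n" and f': "\<And>s. run p [1, 0, digits_code s] = digits_code (f' s)"
    using p(3) unfolding computes_smooth_data_def effectively_smooth_def by blast
  have "d' 0 = d 0" using d d' by (metis ext)
  moreover have "f' = f" using f f' inj_digits_code by (metis ext injD)
  ultimately have T': "effectively_uniformly_continuous (d 0) f T'" using T' by simp
  have le: "torus_dist (T P) (T' P) \<le> 2 * (1 / 2) ^ n" for n
  proof -
    obtain s q where s: "length s = d 0 n" "q \<in> digits_cell s" "to_torus q = P"
      using digits_exist by blast
    have "torus_dist (to_torus (digits_point (f s))) (T P) \<le> 1 / 2 ^ n"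
      "torus_dist (to_torus (digits_point (f s))) (T' P) \<le> 1 / 2 ^ n"
      using T T' s unfolding effectively_uniformly_continuous_def by auto
    with torus_dist_triangle[of "T P" "T' P" "to_torus (digits_point (f s))"]
    show ?thesis by (simp add: power_one_over)
  qed
  have "(\<lambda>n. 2 * (1 / 2) ^ n :: real) \<longlonglongrightarrow> 2 * 0"
    by (intro tendsto_mult tendsto_const LIMSEQ_power_zero) simp
  then have "torus_dist (T P) (T' P) \<le> 2 * 0"
    by (rule LIMSEQ_le_const) (use le in \<open>intro exI allI impI\<close>)
  thus "T P = T' P" using torus_dist_nonpos by simp
qed

end

theory Submission
  imports Defs
begin

text \<open>
  The diffeomorphisms are skew products \<open>T (x, y) = (x + \<alpha>, y + f x)\<close> over an irrational rotation of
  the circle, as in Anzai's examples of transformations that are not isomorphic to their inverses.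
  Write \<open>e t\<close> for \<open>exp (2\<pi>it)\<close>. An isomorphism \<open>h\<close> from \<open>T\<close> to its inverse turns the function
  \<open>e x\<close> into an eigenfunction of \<open>T\<close> with eigenvalue \<open>e (-\<alpha>)\<close>. If \<open>T\<close> has only the eigenfunctions
  \<open>C e (kx)\<close>, then the first coordinate of \<open>h\<close> is \<open>c - x\<close>, and the function \<open>v = e y \<circ> h\<close> satisfies
  \<open>v \<circ> T = e (- f (c - \<alpha> - x)) v\<close>. Some Fourier coefficient \<open>w\<close> of \<open>v\<close> along the fibres is not zero,
  and \<open>w (x + \<alpha>) = e (m f x - f (c - \<alpha> - x)) w x\<close> for an integer \<open>m\<close>. Hence \<open>T\<close> is not isomorphic
  to its inverse when none of the functions \<open>m f x - f (c - x)\<close> is a coboundary modulo 1. If, on the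
  other hand, \<open>f\<close> is odd, then \<open>(x, y) \<mapsto> (\<alpha> - x, y)\<close> conjugates \<open>T\<close> to its inverse.

  The function \<open>f\<close> is a lacunary series \<open>\<Sum>j. 2 ^ (- j s\<^sub>j) g\<^sub>j (2 ^ s\<^sub>j x)\<close> with
  \<open>g\<^sub>j x = sin (2\<pi>x) + sin (4\<pi>x) + b\<^sub>j cos (4\<pi>x)\<close>, and \<open>\<alpha>\<close> differs by a dyadic rational from
  \<open>\<Sum>j. 2 ^ (- s\<^sub>j)\<close>. The integers \<open>s\<^sub>j\<close> grow so fast that \<open>f\<close> is smooth and that at time
  \<open>2 ^ (j s\<^sub>j)\<close> the rotation has almost returned to the identity, whereas the Birkhoff sum of \<open>f\<close> is
  almost \<open>g\<^sub>j (2 ^ s\<^sub>j x)\<close> (\<open>birkhoff_sum_approx\<close>). The sums of a coboundary along such times tend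
  to \<open>0\<close> modulo 1 in measure (\<open>cocycle_rigidity\<close>), so if \<open>m f x - f (c - x)\<close> were a coboundary, then
  \<open>m g\<^sub>j x - g\<^sub>j (\<gamma> - x)\<close> would be almost constant for suitable \<open>\<gamma>\<close>. Comparing the two frequencies
  in \<open>g\<^sub>j\<close> shows that this is impossible if \<open>b\<^sub>j = 1\<close> (\<open>osc_combination_nonconstant\<close>). In the same
  way, \<open>m f\<close> is not a coboundary for \<open>m \<noteq> 0\<close>, whatever the \<open>b\<^sub>j\<close> are; this gives ergodicity and the
  list of eigenfunctions.

  For the sentence with code \<open>N\<close>, let \<open>b\<^sub>j = 1\<close> if one of the valuations with codes up to \<open>j\<close> refutes the
  matrix of the sentence, and \<open>b\<^sub>j = 0\<close> otherwise. If the sentence is true, all \<open>b\<^sub>j\<close> vanish and \<open>f\<close> is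
  odd; if it is false, then \<open>b\<^sub>j = 1\<close> for all large \<open>j\<close>. Computing \<open>b\<^sub>j\<close> takes only a bounded search, and
  the tails of the series for \<open>f\<close> and its derivatives are bounded explicitly without knowledge of the
  \<open>b\<^sub>j\<close>, so a primitive recursive program with parameter \<open>N\<close> approximates all of them
  (\<open>anzai_programs\<close>). The dyadic part \<open>2 ^ (- N - 1)\<close> of \<open>\<alpha>\<close> makes the groups of eigenvalues
  for different \<open>N\<close> different, so the diffeomorphisms of different sentences are not isomorphic.
\<close>

section \<open>Primitive recursive functions between coded types\<close>

text \<open>Nothing is required of the values on lists of a length other than \<open>k\<close>, so that \<open>hd\<close>, \<open>tl\<close>
  and \<open>!\<close> can be used freely.\<close>

definition prn :: "nat \<Rightarrow> (nat list \<Rightarrow> nat) \<Rightarrow> bool" where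
  "prn k f \<longleftrightarrow> (\<exists>p. has_arity k p \<and> (\<forall>xs. length xs = k \<longrightarrow> run p xs = f xs))"

definition pr2 :: "(nat \<Rightarrow> nat \<Rightarrow> nat) \<Rightarrow> bool" where
  "pr2 F \<longleftrightarrow> prn 2 (\<lambda>xs. F (xs ! 0) (xs ! 1))"

lemma prn_cong: "prn k f \<Longrightarrow> (\<And>xs. length xs = k \<Longrightarrow> f xs = g xs) \<Longrightarrow> prn k g"
  unfolding prn_def by auto

lemma primitive_recursive_iff_prn: "primitive_recursive f \<longleftrightarrow> prn 1 (\<lambda>xs. f (xs ! 0))"
proof -
  have "(\<forall>n. run p [n] = f n) \<longleftrightarrow> (\<forall>xs. length xs = 1 \<longrightarrow> run p xs = f (xs ! 0))" for p
    by (auto simp: length_Suc_conv)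
  then show ?thesis unfolding primitive_recursive_def prn_def by simp
qed

lemma prn_proj: "i < k \<Longrightarrow> prn k (\<lambda>xs. xs ! i)"
  unfolding prn_def by (rule exI[of _ "Proj i"]) auto

lemma prn_comp:
  assumes "prn (length hs) g" "\<And>h. h \<in> set hs \<Longrightarrow> prn k h"
  shows "prn k (\<lambda>xs. g (map (\<lambda>h. h xs) hs))"
proof -
  obtain pg where pg: "has_arity (length hs) pg" "\<And>xs. length xs = length hs \<Longrightarrow> run pg xs = g xs"
    using assms(1) unfolding prn_def by auto
  obtain ph where ph: "\<And>h. h \<in> set hs \<Longrightarrow> has_arity k (ph h) \<and> (\<forall>xs. length xs = k \<longrightarrow> run (ph h) xs = h xs)"
    using assms(2) unfolding prn_def by metis
  have "has_arity k (Comp pg (map ph hs))" using pg ph by auto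
  moreover have "run (Comp pg (map ph hs)) xs = g (map (\<lambda>h. h xs) hs)" if "length xs = k" for xs
  proof -
    have "map (\<lambda>h. run h xs) (map ph hs) = map (\<lambda>h. h xs) hs" using ph that by auto
    then show ?thesis using pg(2)[of "map (\<lambda>h. run h xs) (map ph hs)"] by (simp only: run.simps length_map)
  qed
  ultimately show ?thesis unfolding prn_def by blast
qed

lemma prn_comp1: "primitive_recursive F \<Longrightarrow> prn k f \<Longrightarrow> prn k (\<lambda>xs. F (f xs))"
  using prn_comp[of "[f]" "\<lambda>xs. F (xs ! 0)" k] by (simp add: primitive_recursive_iff_prn)

lemma prn_comp2: "pr2 F \<Longrightarrow> prn k f \<Longrightarrow> prn k g \<Longrightarrow> prn k (\<lambda>xs. F (f xs) (g xs))"
  using prn_comp[of "[f, g]" "\<lambda>xs. F (xs ! 0) (xs ! 1)" k] unfolding pr2_def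
  by (auto simp: numeral_2_eq_2)

lemma prn_const: "prn k (\<lambda>_. c)"
proof (induction c)
  case 0
  show ?case unfolding prn_def by (rule exI[of _ Zero]) auto
next
  case (Suc c)
  have "primitive_recursive Suc" unfolding primitive_recursive_def by (rule exI[of _ Succ]) auto
  from prn_comp1[OF this Suc] show ?case .
qed

lemma prn_rec:
  assumes "prn k g" "prn (Suc (Suc k)) h"
  shows "prn (Suc k) (\<lambda>xs. rec_nat (g (tl xs)) (\<lambda>m r. h (m # r # tl xs)) (hd xs))"
proof -
  obtain pg where pg: "has_arity k pg" "\<And>xs. length xs = k \<Longrightarrow> run pg xs = g xs"
    using assms(1) unfolding prn_def by auto
  obtain ph where ph: "has_arity (Suc (Suc k)) ph" "\<And>xs. length xs = Suc (Suc k) \<Longrightarrow> run ph xs = h xs"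
    using assms(2) unfolding prn_def by auto
  show ?thesis unfolding prn_def
  proof (intro exI[of _ "Rec pg ph"] conjI allI impI)
    show "has_arity (Suc k) (Rec pg ph)" using pg ph by simp
    fix xs :: "nat list" assume "length xs = Suc k"
    then show "run (Rec pg ph) xs = rec_nat (g (tl xs)) (\<lambda>m r. h (m # r # tl xs)) (hd xs)"
      by (simp add: pg(2) ph(2))
  qed
qed

lemma primitive_recursive_rec:
  assumes "pr2 h" shows "primitive_recursive (\<lambda>n. rec_nat c h n)"
proof -
  have "prn (Suc 0) (\<lambda>xs. rec_nat c (\<lambda>m r. h ((m # r # tl xs) ! 0) ((m # r # tl xs) ! 1)) (hd xs))"
    using prn_rec[of 0 "\<lambda>_. c" "\<lambda>xs. h (xs ! 0) (xs ! 1)"] assms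
    by (simp add: pr2_def prn_const numeral_2_eq_2)
  then show ?thesis unfolding primitive_recursive_iff_prn One_nat_def
    by (rule prn_cong) (auto simp: length_Suc_conv)
qed

lemma pr2_rec:
  assumes "primitive_recursive g" "prn 3 (\<lambda>xs. h (xs ! 0) (xs ! 1) (xs ! 2))"
  shows "pr2 (\<lambda>n x. rec_nat (g x) (\<lambda>m r. h m r x) n)"
proof -
  have "prn (Suc 1) (\<lambda>xs. rec_nat (g (tl xs ! 0)) (\<lambda>m r. h ((m # r # tl xs) ! 0) ((m # r # tl xs) ! 1) ((m # r # tl xs) ! 2)) (hd xs))"
    using prn_rec[of 1 "\<lambda>xs. g (xs ! 0)" "\<lambda>xs. h (xs ! 0) (xs ! 1) (xs ! 2)"] assms
    by (simp add: primitive_recursive_iff_prn numeral_3_eq_3)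
  then show ?thesis unfolding pr2_def numeral_2_eq_2 One_nat_def
    by (rule prn_cong) (auto simp: length_Suc_conv numeral_2_eq_2)
qed

lemma primitive_recursive_Suc: "primitive_recursive Suc"
  unfolding primitive_recursive_def by (rule exI[of _ Succ]) auto

lemmas prn_intros = prn_proj prn_const prn_comp1[OF primitive_recursive_Suc]

lemma pr2_add: "pr2 (+)"
proof -
  have "pr2 (\<lambda>n x. rec_nat x (\<lambda>m r. Suc r) n)"
    by (rule pr2_rec) (auto simp: primitive_recursive_iff_prn intro!: prn_intros)
  moreover have "rec_nat x (\<lambda>m r. Suc r) n = n + x" for n x by (induction n) auto
  ultimately show ?thesis by (simp only:)
qed

lemma pr2_times: "pr2 (*)"
proof -
  have "pr2 (\<lambda>n x. rec_nat 0 (\<lambda>m r. r + x) n)"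
    by (rule pr2_rec) (auto simp: primitive_recursive_iff_prn intro!: prn_intros prn_comp2[OF pr2_add])
  moreover have "rec_nat 0 (\<lambda>m r. r + x) n = n * x" for n x by (induction n) auto
  ultimately show ?thesis by (simp only:)
qed

lemma pr2_swap: "pr2 F \<Longrightarrow> pr2 (\<lambda>x y. F y x)"
  using prn_comp2[of F 2 "\<lambda>xs. xs ! 1" "\<lambda>xs. xs ! 0"] by (simp add: pr2_def prn_intros)

lemma primitive_recursive_pred: "primitive_recursive (\<lambda>n. n - Suc 0)"
proof -
  have "primitive_recursive (\<lambda>n. rec_nat 0 (\<lambda>m r. m) n)"
    by (rule primitive_recursive_rec) (auto simp: pr2_def intro!: prn_intros)
  moreover have "rec_nat 0 (\<lambda>m r. m) n = n - Suc 0" for n by (cases n) auto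
  ultimately show ?thesis by (simp only:)
qed

lemma pr2_diff: "pr2 (-)"
proof -
  have "pr2 (\<lambda>n x. rec_nat x (\<lambda>m r. r - Suc 0) n)"
    by (rule pr2_rec) (auto simp: primitive_recursive_iff_prn intro!: prn_intros prn_comp1[OF primitive_recursive_pred])
  moreover have "rec_nat x (\<lambda>m r. r - Suc 0) n = x - n" for n x by (induction n) auto
  ultimately have "pr2 (\<lambda>n x. x - n)" by (simp only:)
  from pr2_swap[OF this] show ?thesis .
qed

lemma primitive_recursive_triangle: "primitive_recursive triangle"
proof -
  have "primitive_recursive (\<lambda>n. rec_nat 0 (\<lambda>m r. r + Suc m) n)"
    by (rule primitive_recursive_rec) (auto simp: pr2_def intro!: prn_intros prn_comp2[OF pr2_add])
  moreover have "rec_nat 0 (\<lambda>m r. r + Suc m) n = triangle n" for n by (induction n) auto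
  ultimately show ?thesis by (simp only:)
qed

lemma pr2_prod_encode: "pr2 (\<lambda>m n. prod_encode (m, n))"
  unfolding prod_encode_def pr2_def
  by (auto intro!: prn_intros prn_comp2[OF pr2_add] prn_comp1[OF primitive_recursive_triangle])

text \<open>The number of the antidiagonal on which the pair with a given code lies.\<close>

definition antidiagonal :: "nat \<Rightarrow> nat" where
  "antidiagonal n = fst (prod_decode n) + snd (prod_decode n)"

lemma antidiagonal_bounds: "triangle (antidiagonal n) \<le> n" "n < triangle (Suc (antidiagonal n))"
proof -
  obtain a b where ab: "prod_decode n = (a, b)" by fastforce
  then have "prod_encode (a, b) = n" by (metis prod_decode_inverse)
  then have "n = triangle (a + b) + a" by (simp add: prod_encode_def)
  moreover have "antidiagonal n = a + b" by (simp add: antidiagonal_def ab)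
  ultimately show "triangle (antidiagonal n) \<le> n" "n < triangle (Suc (antidiagonal n))" by simp_all
qed

lemma triangle_mono: "m \<le> n \<Longrightarrow> triangle m \<le> triangle n"
  by (rule lift_Suc_mono_le) auto

text \<open>The pair decoding satisfies a recursion in which the two components depend on each other. The number
  of the antidiagonal satisfies one with a single value, from which both components are then recovered
  by arithmetic.\<close>

lemma antidiagonal_Suc:
  "antidiagonal (Suc n) = antidiagonal n + (1 - (triangle (Suc (antidiagonal n)) - Suc n))"
proof -
  have *: "m = m'" if "triangle m \<le> k" "k < triangle (Suc m)" "triangle m' \<le> k" "k < triangle (Suc m')" for m m' k
  proof -
    have "\<not> Suc m \<le> m'" using triangle_mono[of "Suc m" m'] that by linarith
    moreover have "\<not> Suc m' \<le> m" using triangle_mono[of "Suc m'" m] that by linarith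
    ultimately show ?thesis by linarith
  qed
  show ?thesis
  proof (cases "triangle (Suc (antidiagonal n)) \<le> Suc n")
    case True
    then have "antidiagonal (Suc n) = Suc (antidiagonal n)"
      using antidiagonal_bounds[of n] antidiagonal_bounds[of "Suc n"] by (intro *[of _ "Suc n"]) auto
    then show ?thesis using True by simp
  next
    case False
    then have "antidiagonal (Suc n) = antidiagonal n"
      using antidiagonal_bounds[of n] antidiagonal_bounds[of "Suc n"] by (intro *[of _ "Suc n"]) auto
    then show ?thesis using False by simp
  qed
qed

lemma primitive_recursive_antidiagonal: "primitive_recursive antidiagonal"
proof -
  have "primitive_recursive (\<lambda>n. rec_nat 0 (\<lambda>m r. r + (1 - (triangle (Suc r) - Suc m))) n)"
    by (rule primitive_recursive_rec)
      (auto simp: pr2_def simp del: triangle_Suc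
        intro!: prn_intros prn_comp2[OF pr2_add] prn_comp2[OF pr2_diff] prn_comp1[OF primitive_recursive_triangle])
  moreover have "rec_nat 0 (\<lambda>m r. r + (1 - (triangle (Suc r) - Suc m))) n = antidiagonal n" for n
  proof (induction n)
    case 0
    then show ?case by (simp add: antidiagonal_def prod_decode_def prod_decode_aux.simps)
  next
    case (Suc n)
    then show ?case by (simp add: antidiagonal_Suc del: triangle_Suc)
  qed
  ultimately show ?thesis by (simp only:)
qed

lemma fst_prod_decode: "fst (prod_decode n) = n - triangle (antidiagonal n)"
  and snd_prod_decode: "snd (prod_decode n) = antidiagonal n - (n - triangle (antidiagonal n))"
proof -
  obtain a b where ab: "prod_decode n = (a, b)" by fastforce
  then have "prod_encode (a, b) = n" by (metis prod_decode_inverse)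
  then have "n = triangle (a + b) + a" by (simp add: prod_encode_def)
  moreover have "antidiagonal n = a + b" by (simp add: antidiagonal_def ab)
  ultimately show "fst (prod_decode n) = n - triangle (antidiagonal n)"
    "snd (prod_decode n) = antidiagonal n - (n - triangle (antidiagonal n))"
    unfolding ab by simp_all
qed

lemma primitive_recursive_fst_decode: "primitive_recursive (\<lambda>n. fst (prod_decode n))"
  unfolding fst_prod_decode primitive_recursive_iff_prn
  by (auto intro!: prn_intros prn_comp2[OF pr2_diff] prn_comp1[OF primitive_recursive_triangle]
      prn_comp1[OF primitive_recursive_antidiagonal])

lemma primitive_recursive_snd_decode: "primitive_recursive (\<lambda>n. snd (prod_decode n))"
  unfolding snd_prod_decode primitive_recursive_iff_prn
  by (auto intro!: prn_intros prn_comp2[OF pr2_diff] prn_comp1[OF primitive_recursive_triangle]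
      prn_comp1[OF primitive_recursive_antidiagonal])


text \<open>The coding is required to be onto, so that a function between coded types is the same thing as a
  function on all natural numbers; in particular, the values of a recursion may have any coded type.\<close>

class encodable =
  fixes encode :: "'a \<Rightarrow> nat" and decode :: "nat \<Rightarrow> 'a"
  assumes decode_encode [simp]: "decode (encode x) = x"
    and encode_decode [simp]: "encode (decode n) = n"

instantiation nat :: encodable
begin
definition "encode_nat = (\<lambda>n::nat. n)"
definition "decode_nat = (\<lambda>n::nat. n)"
instance by standard (auto simp: encode_nat_def decode_nat_def)
end

instantiation int :: encodable
begin
definition "encode_int = int_encode"
definition "decode_int = int_decode"
instance by standard (auto simp: encode_int_def decode_int_def)
end

instantiation prod :: (encodable, encodable) encodable
begin
definition "encode_prod = (\<lambda>(x::'a, y::'b). prod_encode (encode x, encode y))"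
definition "decode_prod = (\<lambda>n. (decode (fst (prod_decode n)) :: 'a, decode (snd (prod_decode n)) :: 'b))"
instance by standard (auto simp: encode_prod_def decode_prod_def)
end

instantiation list :: (encodable) encodable
begin
definition "encode_list = (\<lambda>xs :: 'a list. list_encode (map encode xs))"
definition "decode_list = (\<lambda>n. map (decode :: nat \<Rightarrow> 'a) (list_decode n))"
instance by standard (auto simp: encode_list_def decode_list_def o_def)
end

definition PR :: "('a::encodable \<Rightarrow> 'b::encodable) \<Rightarrow> bool" where
  "PR f \<longleftrightarrow> primitive_recursive (\<lambda>n. encode (f (decode n)))"

named_theorems PR_intros

lemma PR_id [PR_intros]: "PR (\<lambda>x. x)"
  unfolding PR_def primitive_recursive_iff_prn by (simp add: prn_proj)

lemma PR_const [PR_intros]: "PR (\<lambda>x. c)"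
  unfolding PR_def primitive_recursive_iff_prn by (simp add: prn_const)

lemma PR_comp:
  assumes "PR f" "PR g" shows "PR (\<lambda>x. f (g x))"
proof -
  have "prn 1 (\<lambda>xs. encode (f (decode (encode (g (decode (xs ! 0)))))))"
    using prn_comp1[of "\<lambda>n. encode (f (decode n))" 1 "\<lambda>xs. encode (g (decode (xs ! 0)))"] assms
    by (simp add: PR_def primitive_recursive_iff_prn[of "\<lambda>n. encode (g (decode n))"])
  then show ?thesis by (simp add: PR_def primitive_recursive_iff_prn)
qed

lemma PR_op1:
  assumes "primitive_recursive F" "\<And>x. encode (G x) = F (encode x)" "PR f"
  shows "PR (\<lambda>x. G (f x))"
  using prn_comp1[OF assms(1), of 1 "\<lambda>xs. encode (f (decode (xs ! 0)))"] assms(2,3)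
  by (simp add: PR_def primitive_recursive_iff_prn)

lemma PR_op2:
  assumes "pr2 F" "\<And>x y. encode (G x y) = F (encode x) (encode y)" "PR f" "PR g"
  shows "PR (\<lambda>x. G (f x) (g x))"
  using prn_comp2[OF assms(1), of 1 "\<lambda>xs. encode (f (decode (xs ! 0)))" "\<lambda>xs. encode (g (decode (xs ! 0)))"] assms(2-)
  by (simp add: PR_def primitive_recursive_iff_prn)

lemma PR_Pair [PR_intros]: "PR f \<Longrightarrow> PR g \<Longrightarrow> PR (\<lambda>x. (f x, g x))"
  by (rule PR_op2[OF pr2_prod_encode]) (auto simp: encode_prod_def)

lemma PR_fst [PR_intros]: "PR f \<Longrightarrow> PR (\<lambda>x. fst (f x))"
  by (rule PR_op1[OF primitive_recursive_fst_decode]) (auto simp: encode_prod_def split: prod.split)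

lemma PR_snd [PR_intros]: "PR f \<Longrightarrow> PR (\<lambda>x. snd (f x))"
  by (rule PR_op1[OF primitive_recursive_snd_decode]) (auto simp: encode_prod_def split: prod.split)

lemma PR_Suc [PR_intros]: "PR f \<Longrightarrow> PR (\<lambda>x. Suc (f x))"
  by (rule PR_op1[OF primitive_recursive_Suc]) (auto simp: encode_nat_def)

lemma PR_add_nat [PR_intros]: "PR f \<Longrightarrow> PR g \<Longrightarrow> PR (\<lambda>x. f x + g x :: nat)"
  by (rule PR_op2[OF pr2_add]) (auto simp: encode_nat_def)

lemma PR_times_nat [PR_intros]: "PR f \<Longrightarrow> PR g \<Longrightarrow> PR (\<lambda>x. f x * g x :: nat)"
  by (rule PR_op2[OF pr2_times]) (auto simp: encode_nat_def)

lemma PR_diff_nat [PR_intros]: "PR f \<Longrightarrow> PR g \<Longrightarrow> PR (\<lambda>x. f x - g x :: nat)"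
  by (rule PR_op2[OF pr2_diff]) (auto simp: encode_nat_def)

text \<open>The step function receives its parameter, the counter and the previous value as one triple, since the
  predicate is about functions of a single argument. Functions with bound variables are treated in the
  same way below.\<close>

lemma PR_rec:
  fixes g :: "'a::encodable \<Rightarrow> 'b::encodable"
  assumes "PR n" "PR g" "PR (\<lambda>z. h (fst z) (fst (snd z)) (snd (snd z)))"
  shows "PR (\<lambda>x. rec_nat (g x) (\<lambda>m r. h x m r) (n x))"
proof -
  define H where "H x m r = encode (h (decode x) m (decode r))" for x m r
  have "primitive_recursive (\<lambda>k. encode (h (fst (decode k :: 'a \<times> nat \<times> 'b)) (fst (snd (decode k :: 'a \<times> nat \<times> 'b))) (snd (snd (decode k :: 'a \<times> nat \<times> 'b)))))"
    using assms(3) unfolding PR_def .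
  then have "prn 3 (\<lambda>xs. (\<lambda>k. encode (h (fst (decode k :: 'a \<times> nat \<times> 'b)) (fst (snd (decode k :: 'a \<times> nat \<times> 'b))) (snd (snd (decode k :: 'a \<times> nat \<times> 'b)))))
       (prod_encode (xs ! 2, prod_encode (xs ! 0, xs ! 1))))"
    by (rule prn_comp1) (auto intro!: prn_comp2[OF pr2_prod_encode] prn_intros)
  then have "prn 3 (\<lambda>xs. H (xs ! 2) (xs ! 0) (xs ! 1))"
    by (simp add: decode_prod_def H_def decode_nat_def)
  then have "pr2 (\<lambda>k x. rec_nat (encode (g (decode x))) (\<lambda>m r. H x m r) k)"
    using assms(2) unfolding PR_def by (intro pr2_rec)
  moreover have "encode (rec_nat (g (decode x)) (\<lambda>m r. h (decode x) m r) k)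
     = rec_nat (encode (g (decode x))) (\<lambda>m r. H x m r) k" for k x
    by (induction k) (simp_all add: H_def, metis decode_encode)
  ultimately have *: "pr2 (\<lambda>k x. encode (rec_nat (g (decode x)) (\<lambda>m r. h (decode x) m r) k))" by simp
  have "PR (\<lambda>x. (\<lambda>k y. rec_nat (g y) (\<lambda>m r. h y m r) k) (n x) x)"
    by (rule PR_op2[OF *]) (auto simp: encode_nat_def assms(1) PR_id)
  then show ?thesis by simp
qed

lemma PR_eq: "PR f \<Longrightarrow> (\<And>x. g x = f x) \<Longrightarrow> PR g"
  by (simp add: PR_def)

lemma PR_fst_arg: "PR f \<Longrightarrow> PR (\<lambda>z. f (fst z))"
  by (rule PR_comp[OF _ PR_fst[OF PR_id]])

definition PRP :: "('a::encodable \<Rightarrow> bool) \<Rightarrow> bool" where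
  "PRP P \<longleftrightarrow> PR (\<lambda>x. of_bool (P x) :: nat)"

lemma PR_of_bool [PR_intros]: "PRP P \<Longrightarrow> PR (\<lambda>x. of_bool (P x) :: nat)"
  by (simp add: PRP_def)

lemma PRP_comp: "PRP P \<Longrightarrow> PR g \<Longrightarrow> PRP (\<lambda>x. P (g x))"
  unfolding PRP_def by (rule PR_comp)

text \<open>A case distinction is a recursion of length \<open>0\<close> or \<open>1\<close>.\<close>

lemma PR_if [PR_intros]:
  assumes "PRP P" "PR f" "PR g" shows "PR (\<lambda>x. if P x then f x else g x)"
proof -
  have pr: "PR (\<lambda>x. rec_nat (g x) (\<lambda>m r. f x) (of_bool (P x)))"
    using assms by (intro PR_rec PR_of_bool PR_fst_arg[of f])
  have eq: "rec_nat (g x) (\<lambda>m r. f x) (of_bool (P x)) = (if P x then f x else g x)" for x by simp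
  show ?thesis by (rule PR_eq[OF pr]) (rule eq eq[symmetric])
qed

lemma PRP_le [PR_intros]: "PR f \<Longrightarrow> PR g \<Longrightarrow> PRP (\<lambda>x. f x \<le> (g x :: nat))"
proof -
  assume "PR f" "PR g"
  then have pr: "PR (\<lambda>x. 1 - (f x - g x))" by (intro PR_intros)
  have eq: "1 - (f x - g x) = of_bool (f x \<le> g x)" for x by auto
  show ?thesis unfolding PRP_def by (rule PR_eq[OF pr]) (rule eq eq[symmetric])
qed

lemma PRP_not [PR_intros]: "PRP P \<Longrightarrow> PRP (\<lambda>x. \<not> P x)"
proof -
  assume "PRP P"
  then have pr: "PR (\<lambda>x. 1 - (of_bool (P x) :: nat))" by (intro PR_intros)
  have eq: "1 - (of_bool (P x) :: nat) = of_bool (\<not> P x)" for x by auto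
  show ?thesis unfolding PRP_def by (rule PR_eq[OF pr]) (rule eq eq[symmetric])
qed

lemma PRP_conj [PR_intros]: "PRP P \<Longrightarrow> PRP Q \<Longrightarrow> PRP (\<lambda>x. P x \<and> Q x)"
proof -
  assume "PRP P" "PRP Q"
  then have "PR (\<lambda>x. of_bool (P x) * of_bool (Q x) :: nat)" by (intro PR_intros)
  then show ?thesis unfolding PRP_def by (simp add: of_bool_conj)
qed

lemma PRP_disj [PR_intros]: "PRP P \<Longrightarrow> PRP Q \<Longrightarrow> PRP (\<lambda>x. P x \<or> Q x)"
  using PRP_not[OF PRP_conj[OF PRP_not PRP_not, of P Q]] by simp

lemma PRP_imp [PR_intros]: "PRP P \<Longrightarrow> PRP Q \<Longrightarrow> PRP (\<lambda>x. P x \<longrightarrow> Q x)"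
  using PRP_not[OF PRP_conj[OF _ PRP_not, of P Q]] by simp

lemma PRP_less [PR_intros]: "PR f \<Longrightarrow> PR g \<Longrightarrow> PRP (\<lambda>x. f x < (g x :: nat))"
  using PRP_not[OF PRP_le[of g f]] by (simp add: not_le)

lemma PR_encode: "PR f \<Longrightarrow> PR (\<lambda>x. encode (f x))"
  by (simp add: PR_def encode_nat_def)

lemma PRP_eq [PR_intros]:
  assumes "PR f" "PR g" shows "PRP (\<lambda>x. f x = g x)"
proof -
  have "f x = g x \<longleftrightarrow> encode (f x) \<le> encode (g x) \<and> encode (g x) \<le> encode (f x)" for x
    by (metis decode_encode order_antisym order_refl)
  then show ?thesis using assms by (simp add: PR_intros PR_encode)
qed


lemma PR_int [PR_intros]: "PR f \<Longrightarrow> PR (\<lambda>x. int (f x))"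
proof -
  assume "PR f"
  then have "PR (\<lambda>x. 2 * f x)" by (intro PR_intros)
  then show ?thesis by (simp add: PR_def encode_int_def encode_nat_def int_encode_def sum_encode_def)
qed

text \<open>Negative integers have odd codes, the nonnegative integers even ones.\<close>

lemma PR_neg_int: "PR f \<Longrightarrow> PR (\<lambda>x. - int (f x))"
proof -
  assume f: "PR f"
  have "PR (\<lambda>x. if f x = 0 then 0 else Suc (2 * (f x - 1)))" using f by (intro PR_intros)
  moreover have "encode (- int (f x)) = (if f x = 0 then 0 else Suc (2 * (f x - 1)))" for x
    by (cases "f x") (auto simp: encode_int_def int_encode_def sum_encode_def nat_diff_distrib)
  ultimately show ?thesis by (simp add: PR_def encode_nat_def)
qed

lemma PR_half: assumes "PR f" shows "PR (\<lambda>x. f x div 2 :: nat)"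
proof -
  have pr: "PR (\<lambda>x. rec_nat 0 (\<lambda>m r. if 2 * Suc r \<le> Suc m then Suc r else r) (f x))"
    using assms by (intro PR_rec) (auto intro!: PR_intros)
  have eq: "rec_nat 0 (\<lambda>m r. if 2 * Suc r \<le> Suc m then Suc r else r) n = n div 2" for n
    by (induction n) auto
  show ?thesis by (rule PR_eq[OF pr]) (rule eq eq[symmetric])
qed

lemma PR_nat [PR_intros]:
  assumes "PR f" shows "PR (\<lambda>x. nat (f x))"
proof -
  have pr: "PR (\<lambda>x. if 2 * (encode (f x) div 2) = encode (f x) then encode (f x) div 2 else 0)"
    using assms by (intro PR_intros PR_half PR_encode)
  have eq: "nat k = (if 2 * (encode k div 2) = encode k then encode k div 2 else 0)" for k :: int
    by (auto simp: encode_int_def int_encode_def sum_encode_def)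
  show ?thesis by (rule PR_eq[OF pr]) (rule eq eq[symmetric])
qed

lemma PR_int_diff_nat:
  assumes "PR f" "PR g" shows "PR (\<lambda>x. int (f x) - int (g x))"
proof -
  have pr: "PR (\<lambda>x. if g x \<le> f x then int (f x - g x) else - int (g x - f x))"
    using assms by (intro PR_intros PR_neg_int)
  have eq: "int a - int b = (if b \<le> a then int (a - b) else - int (b - a))" for a b by auto
  show ?thesis by (rule PR_eq[OF pr]) (rule eq)
qed

lemma PR_uminus_int [PR_intros]:
  assumes "PR f" shows "PR (\<lambda>x. - f x :: int)"
proof -
  have pr: "PR (\<lambda>x. if f x = int (nat (f x)) then - int (nat (f x)) else int (Suc (encode (f x) div 2)))"
    using assms by (intro PR_intros PR_neg_int PR_half PR_encode)
  have eq: "- k = (if k = int (nat k) then - int (nat k) else int (Suc (encode k div 2)))" for k :: int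
    by (auto simp: encode_int_def int_encode_def sum_encode_def)
  show ?thesis by (rule PR_eq[OF pr]) (rule eq)
qed

lemma PR_add_int [PR_intros]:
  assumes "PR f" "PR g" shows "PR (\<lambda>x. f x + g x :: int)"
proof -
  have pr: "PR (\<lambda>x. int (nat (f x) + nat (g x)) - int (nat (- f x) + nat (- g x)))"
    using assms by (intro PR_intros PR_int_diff_nat)
  have eq: "f x + g x = int (nat (f x) + nat (g x)) - int (nat (- f x) + nat (- g x))" for x by auto
  show ?thesis by (rule PR_eq[OF pr]) (rule eq eq[symmetric])
qed

lemma PR_diff_int [PR_intros]: "PR f \<Longrightarrow> PR g \<Longrightarrow> PR (\<lambda>x. f x - g x :: int)"
  using PR_add_int[OF _ PR_uminus_int, of f g] by simp

lemma PR_times_int [PR_intros]: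
  assumes "PR f" "PR g" shows "PR (\<lambda>x. f x * g x :: int)"
proof -
  have pr: "PR (\<lambda>x. int (nat (f x) * nat (g x) + nat (- f x) * nat (- g x)) - int (nat (- f x) * nat (g x) + nat (f x) * nat (- g x)))"
    using assms by (intro PR_intros PR_int_diff_nat)
  have eq: "a * b = int (nat a * nat b + nat (- a) * nat (- b)) - int (nat (- a) * nat b + nat a * nat (- b))" for a b :: int
    by (cases "a \<ge> 0"; cases "b \<ge> 0") auto
  show ?thesis by (rule PR_eq[OF pr]) (rule eq eq[symmetric])
qed

lemma PR_power_nat [PR_intros]:
  assumes "PR f" "PR n" shows "PR (\<lambda>x. f x ^ n x :: nat)"
proof -
  have pr: "PR (\<lambda>x. rec_nat 1 (\<lambda>m r. f x * r) (n x))"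
    using assms by (intro PR_rec PR_intros) (auto intro: PR_fst_arg[of f] PR_fst_arg[of g] PR_intros)
  have eq: "rec_nat 1 (\<lambda>m r. f x * r) k = f x ^ k" for x k by (induction k) auto
  show ?thesis by (rule PR_eq[OF pr]) (rule eq eq[symmetric])
qed

lemma PR_power_int [PR_intros]:
  assumes "PR f" "PR n" shows "PR (\<lambda>x. f x ^ n x :: int)"
proof -
  have pr: "PR (\<lambda>x. rec_nat 1 (\<lambda>m r. f x * r) (n x))"
    using assms by (intro PR_rec PR_intros) (auto intro: PR_fst_arg[of f] PR_fst_arg[of g] PR_intros)
  have eq: "rec_nat 1 (\<lambda>m r. f x * r) k = f x ^ k" for x k by (induction k) auto
  show ?thesis by (rule PR_eq[OF pr]) (rule eq eq[symmetric])
qed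

lemma PR_sum_nat [PR_intros]:
  fixes f :: "'a::encodable \<Rightarrow> nat \<Rightarrow> nat"
  assumes "PR n" "PR (\<lambda>z. f (fst z) (snd z))" shows "PR (\<lambda>x. \<Sum>i<n x. f x i)"
proof -
  have "PR (\<lambda>z. f (fst z) (fst (snd z)))"
    using PR_comp[OF assms(2), of "\<lambda>z. (fst z, fst (snd z))"] by (simp add: PR_intros)
  then have pr: "PR (\<lambda>x. rec_nat 0 (\<lambda>m r. f x m + r) (n x))"
    using assms by (intro PR_rec PR_intros)
  have eq: "rec_nat 0 (\<lambda>m r. f x m + r) k = (\<Sum>i<k. f x i)" for x k by (induction k) (simp_all add: add.commute)
  show ?thesis by (rule PR_eq[OF pr]) (rule eq eq[symmetric])
qed

lemma PR_sum_int [PR_intros]: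
  fixes f :: "'a::encodable \<Rightarrow> nat \<Rightarrow> int"
  assumes "PR n" "PR (\<lambda>z. f (fst z) (snd z))" shows "PR (\<lambda>x. \<Sum>i<n x. f x i)"
proof -
  have "PR (\<lambda>z. f (fst z) (fst (snd z)))"
    using PR_comp[OF assms(2), of "\<lambda>z. (fst z, fst (snd z))"] by (simp add: PR_intros)
  then have pr: "PR (\<lambda>x. rec_nat 0 (\<lambda>m r. f x m + r) (n x))"
    using assms by (intro PR_rec PR_intros)
  have eq: "rec_nat 0 (\<lambda>m r. f x m + r) k = (\<Sum>i<k. f x i)" for x k by (induction k) (simp_all add: add.commute)
  show ?thesis by (rule PR_eq[OF pr]) (rule eq eq[symmetric])
qed

text \<open>The quotient is the number of positive multiples of the divisor that do not exceed the dividend.\<close>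

lemma PR_div_nat [PR_intros]:
  assumes "PR f" "PR g" shows "PR (\<lambda>x. f x div g x :: nat)"
proof -
  have pr: "PR (\<lambda>x. if g x = 0 then 0 else (\<Sum>i<f x. of_bool (Suc i * g x \<le> f x) :: nat))"
    using assms by (intro PR_intros PR_fst_arg[of f] PR_fst_arg[of g])
  have eq: "a div b = (if b = 0 then 0 else \<Sum>i<a. of_bool (Suc i * b \<le> a))" for a b :: nat
  proof (cases "b = 0")
    case False
    have "(\<Sum>i<a. of_bool (Suc i * b \<le> a)) = card {i. i < a \<and> Suc i * b \<le> a}"
      unfolding of_bool_def by (subst sum.If_cases) (auto intro!: arg_cong[of _ _ card])
    also have "{i. i < a \<and> Suc i * b \<le> a} = {..<a div b}"
    proof -
      have "i < a \<and> Suc i * b \<le> a \<longleftrightarrow> i < a div b" for i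
        using False by (metis Suc_le_eq div_le_dividend less_eq_div_iff_mult_less_eq not_gr_zero order_less_le_trans)
      then show ?thesis by auto
    qed
    finally show ?thesis using False by simp
  qed simp
  show ?thesis by (rule PR_eq[OF pr]) (rule eq eq[symmetric])
qed

lemma PR_mod_nat [PR_intros]: "PR f \<Longrightarrow> PR g \<Longrightarrow> PR (\<lambda>x. f x mod g x :: nat)"
  unfolding modulo_nat_def by (intro PR_intros)

text \<open>Adding a large multiple of the divisor reduces the claim to natural numbers.\<close>

lemma PR_div_int_nat [PR_intros]:
  assumes "PR f" "PR g" shows "PR (\<lambda>x. f x div int (g x))"
proof -
  have pr: "PR (\<lambda>x. if g x = 0 then 0 else int (nat (f x + int (nat (- f x)) * int (g x)) div g x) - int (nat (- f x)))"
    using assms by (intro PR_intros)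
  have eq: "k div int b = (if b = 0 then 0 else int (nat (k + int (nat (- k)) * int b) div b) - int (nat (- k)))" for k b
  proof (cases "b = 0")
    case False
    have "- k \<le> int (nat (- k)) * int b"
    proof (cases "k \<ge> 0")
      case True then show ?thesis by simp
    next
      case F: False
      then have "(- k) * 1 \<le> (- k) * int b" using False by (intro mult_left_mono) auto
      then show ?thesis using F by simp
    qed
    then have "int (nat (k + int (nat (- k)) * int b) div b) = (k + int (nat (- k)) * int b) div int b"
      by (simp add: zdiv_int)
    also have "\<dots> = k div int b + int (nat (- k))" using False by simp
    finally show ?thesis using False by simp
  qed simp
  show ?thesis by (rule PR_eq[OF pr]) (rule eq eq[symmetric])
qed

lemma PR_mod_int_nat [PR_intros]: "PR f \<Longrightarrow> PR g \<Longrightarrow> PR (\<lambda>x. f x mod int (g x))"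
  unfolding minus_div_mult_eq_mod[symmetric] by (intro PR_intros)


lemma PR_Cons [PR_intros]: "PR f \<Longrightarrow> PR g \<Longrightarrow> PR (\<lambda>x. f x # g x)"
proof -
  assume "PR f" "PR g"
  then have "PR (\<lambda>x. Suc (encode (f x, g x)))" by (intro PR_intros PR_encode)
  then show ?thesis by (simp add: PR_def encode_nat_def encode_list_def encode_prod_def)
qed

lemma encode_list_decompose:
  "encode (xs :: 'a::encodable list) = (case xs of [] \<Rightarrow> 0 | y # ys \<Rightarrow> Suc (prod_encode (encode y, encode ys)))"
  by (auto simp: encode_list_def split: list.split)

lemma PR_from_encode: "PR (\<lambda>x. encode (f x)) \<Longrightarrow> PR f"
  by (simp add: PR_def encode_nat_def)

lemma PR_prod_decode: "PR f \<Longrightarrow> PR (\<lambda>x. prod_decode (f x))"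
  by (rule PR_from_encode) (simp add: encode_prod_def encode_nat_def case_prod_unfold)

lemma PR_tl [PR_intros]:
  assumes "PR f" shows "PR (\<lambda>x. tl (f x))"
proof (rule PR_from_encode)
  have pr: "PR (\<lambda>x. if encode (f x) = 0 then 0 else snd (prod_decode (encode (f x) - 1)))"
    using assms by (intro PR_intros PR_encode PR_prod_decode)
  have eq: "encode (tl xs) = (if encode xs = 0 then 0 else snd (prod_decode (encode xs - 1)))" for xs :: "'b list"
    by (cases xs) (simp_all add: encode_list_decompose)
  show "PR (\<lambda>x. encode (tl (f x)))" by (rule PR_eq[OF pr]) (rule eq eq[symmetric])
qed

lemma PR_hd [PR_intros]:
  assumes "PR f" shows "PR (\<lambda>x. hd (f x))"
proof (rule PR_from_encode)
  have pr: "PR (\<lambda>x. if encode (f x) = 0 then encode (hd [] :: 'b) else fst (prod_decode (encode (f x) - 1)))"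
    using assms by (intro PR_intros PR_encode PR_prod_decode)
  have eq: "encode (hd xs) = (if encode xs = 0 then encode (hd [] :: 'b) else fst (prod_decode (encode xs - 1)))" for xs :: "'b list"
    by (cases xs) (simp_all add: encode_list_decompose)
  show "PR (\<lambda>x. encode (hd (f x)))" by (rule PR_eq[OF pr]) (rule eq eq[symmetric])
qed

lemma PR_drop [PR_intros]:
  assumes "PR n" "PR f" shows "PR (\<lambda>x. drop (n x) (f x))"
proof -
  have pr: "PR (\<lambda>x. rec_nat (f x) (\<lambda>m r. tl r) (n x))" using assms by (intro PR_rec PR_intros)
  have eq: "rec_nat xs (\<lambda>m r. tl r) k = drop k xs" for xs :: "'b list" and k
    by (induction k) (auto simp: drop_Suc tl_drop)
  show ?thesis by (rule PR_eq[OF pr]) (rule eq eq[symmetric])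
qed

lemma length_le_encode: "length xs \<le> encode xs"
proof (induction xs)
  case (Cons a xs)
  then show ?case using le_prod_encode_2[of "encode xs" "encode a"] by (simp add: encode_list_decompose)
qed simp

lemma PR_length [PR_intros]:
  assumes "PR f" shows "PR (\<lambda>x. length (f x))"
proof -
  have pr: "PR (\<lambda>x. \<Sum>i<encode (f x). of_bool (\<not> drop i (f x) = []) :: nat)"
    using assms by (intro PR_intros PR_encode) (auto intro: PR_fst_arg[of f] PR_fst_arg[of g] PR_intros)
  have eq: "(\<Sum>i<encode xs. of_bool (\<not> drop i xs = [])) = length xs" for xs :: "'b list"
  proof -
    have "(\<Sum>i<encode xs. of_bool (\<not> drop i xs = []) :: nat) = (\<Sum>i<length xs. 1)"
      using length_le_encode[of xs] by (intro sum.mono_neutral_cong_right) auto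
    then show ?thesis by simp
  qed
  show ?thesis by (rule PR_eq[OF pr]) (rule eq eq[symmetric])
qed

text \<open>The list is built from its end, because lists grow at the front.\<close>

lemma PR_map_upt [PR_intros]:
  assumes "PR n" "PR (\<lambda>z. f (fst z) (snd z))" shows "PR (\<lambda>x. map (f x) [0..<n x])"
proof -
  have "PR (\<lambda>z. f (fst z) (n (fst z) - 1 - fst (snd z)))"
    using PR_comp[OF assms(2), of "\<lambda>z. (fst z, n (fst z) - 1 - fst (snd z))"] assms(1)
    by (simp add: PR_intros PR_comp[of n])
  then have pr: "PR (\<lambda>x. rec_nat [] (\<lambda>m r. f x (n x - 1 - m) # r) (n x))"
    using assms by (intro PR_rec PR_intros)
  have eq: "rec_nat [] (\<lambda>m r. f x (n x - 1 - m) # r) k = map (f x) [n x - k..<n x]" if "k \<le> n x" for x k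
    using that
  proof (induction k)
    case (Suc k)
    then have "[n x - Suc k..<n x] = (n x - Suc k) # [n x - k..<n x]"
      by (subst upt_conv_Cons) (auto simp: Suc_diff_Suc)
    then show ?case using Suc by simp
  qed simp
  show ?thesis by (rule PR_eq[OF pr]) (use eq[OF order_refl] in simp)
qed


text \<open>Course-of-values recursion: the table lists the values at \<open>n - 1, \<dots>, 0\<close>.\<close>

definition cov_table :: "(nat \<Rightarrow> 'b list \<Rightarrow> 'b) \<Rightarrow> nat \<Rightarrow> 'b list" where
  "cov_table H n = rec_nat [] (\<lambda>m r. H m r # r) n"

definition cov_rec :: "(nat \<Rightarrow> 'b list \<Rightarrow> 'b) \<Rightarrow> nat \<Rightarrow> 'b" where
  "cov_rec H n = H n (cov_table H n)"

lemma cov_table_lookup: "i < n \<Longrightarrow> hd (drop (n - Suc i) (cov_table H n)) = cov_rec H i"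
proof (induction n)
  case (Suc n)
  show ?case
  proof (cases "i = n")
    case True
    then show ?thesis by (simp add: cov_table_def cov_rec_def)
  next
    case False
    then have "n - i = Suc (n - Suc i)" using Suc by auto
    then show ?thesis using Suc False by (simp add: cov_table_def)
  qed
qed simp

lemma PR_cov_rec:
  assumes "PR (\<lambda>z. H (fst z) (fst (snd z)) (snd (snd z)))" "PR n"
  shows "PR (\<lambda>x. cov_rec (H x) (n x))"
proof -
  have "PR (\<lambda>z. H (fst z) (fst (snd z)) (snd (snd z)) # snd (snd z))" using assms(1) by (intro PR_intros)
  then have "PR (\<lambda>x. cov_table (H x) (n x))"
    unfolding cov_table_def using assms by (intro PR_rec[where h = "\<lambda>x m r. H x m r # r"] PR_const)
  from PR_comp[OF assms(1), of "\<lambda>x. (x, n x, cov_table (H x) (n x))"] this assms(2)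
  show ?thesis by (simp add: cov_rec_def PR_intros)
qed


fun const_prog :: "nat \<Rightarrow> prog" where
  "const_prog 0 = Zero"
| "const_prog (Suc n) = Comp Succ [const_prog n]"

lemma run_const_prog: "run (const_prog n) xs = n"
  by (induction n) auto

lemma has_arity_const_prog: "has_arity k (const_prog n)"
  by (induction n) auto

lemma PR_prog_code_const: "PR (\<lambda>n. prog_code (const_prog n))"
proof -
  have pr: "PR (\<lambda>n. rec_nat (prog_code Zero) (\<lambda>m r. encode (3::nat, prog_code Succ, [r])) (n::nat))"
    by (intro PR_rec PR_intros PR_encode)
  have eq: "rec_nat (prog_code Zero) (\<lambda>m r. encode (3::nat, prog_code Succ, [r])) n = prog_code (const_prog n)" for n
    by (induction n) (auto simp: encode_prod_def encode_nat_def encode_list_def)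
  show ?thesis by (rule PR_eq[OF pr]) (rule eq eq[symmetric])
qed

text \<open>This is the parameter theorem for primitive recursive programs: the parameter is replaced by a program
  for a constant function, and the code of the resulting program depends on the parameter primitive
  recursively.\<close>

lemma parametrized_programs:
  fixes \<Phi> :: "nat \<times> nat \<times> nat \<times> nat \<Rightarrow> nat"
  assumes "PR \<Phi>"
  shows "\<exists>P. (\<forall>N. has_arity 3 (P N)) \<and> (\<forall>N a b c. run (P N) [a, b, c] = \<Phi> (N, a, b, c))
     \<and> primitive_recursive (\<lambda>N. prog_code (P N))"
proof -
  obtain p where p: "has_arity 1 p" "\<And>n. run p [n] = encode (\<Phi> (decode n))"
    using assms unfolding PR_def primitive_recursive_def by auto
  obtain e where e: "has_arity 2 e" "\<And>x y. run e [x, y] = prod_encode (x, y)"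
    using pr2_prod_encode unfolding pr2_def prn_def by (metis One_nat_def length_Cons list.size(3) nth_Cons_0 nth_Cons_Suc numeral_2_eq_2)
  define P where "P N = Comp p [Comp e [const_prog N, Comp e [Proj 0, Comp e [Proj 1, Proj 2]]]]" for N
  have "has_arity 3 (P N)" for N
    using p e by (auto simp: P_def has_arity_const_prog numeral_2_eq_2)
  moreover have "run (P N) [a, b, c] = \<Phi> (N, a, b, c)" for N a b c
    by (simp add: P_def p e run_const_prog encode_nat_def decode_prod_def decode_nat_def)
  moreover have "primitive_recursive (\<lambda>N. prog_code (P N))"
  proof -
    define E where "E = prog_code (Comp e [Proj 0, Comp e [Proj 1, Proj 2]])"
    have "PR (\<lambda>N. encode (3::nat, prog_code p, [encode (3::nat, prog_code e, [prog_code (const_prog N), E])]))"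
      by (intro PR_intros PR_encode PR_prog_code_const)
    moreover have "prog_code (P N) = encode (3::nat, prog_code p, [encode (3::nat, prog_code e, [prog_code (const_prog N), E])])" for N
      unfolding P_def E_def encode_prod_def encode_nat_def encode_list_def by simp
    ultimately show ?thesis by (simp add: PR_def encode_nat_def decode_nat_def)
  qed
  ultimately show ?thesis by blast
qed


section \<open>Computable real functions\<close>

text \<open>An error of two units is allowed, because rounding a rational number that is within one unit of the
  value costs another unit.\<close>

definition CR :: "('a::encodable \<Rightarrow> real) \<Rightarrow> bool" where
  "CR r \<longleftrightarrow> (\<exists>g. PR g \<and> (\<forall>x n. \<bar>real_of_int (g (x, n)) / 2 ^ n - r x\<bar> \<le> 2 / 2 ^ n))"

named_theorems CR_intros

lemma CR_E:
  assumes "CR r"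
  obtains g where "PR g" "\<And>x n. \<bar>real_of_int (g (x, n)) / 2 ^ n - r x\<bar> \<le> 2 / 2 ^ n"
  using assms unfolding CR_def by blast

text \<open>Arbitrary denominators may be used, and the result is rounded to the prescribed denominator \<open>2 ^ n\<close>.\<close>

lemma CR_I:
  assumes g: "PR g" and d: "PR d" and pos: "\<And>x n. d (x, n) > (0::nat)"
    and close: "\<And>x n. \<bar>real_of_int (g (x, n)) / real (d (x, n)) - r x\<bar> \<le> 1 / 2 ^ n"
  shows "CR r"
  unfolding CR_def
proof (intro exI conjI allI)
  show "PR (\<lambda>z. (g z * 2 ^ snd z) div int (d z))" by (intro PR_intros g d)
  fix x n
  define a where "a = real_of_int (g (x, n)) / real (d (x, n))"
  have "real_of_int ((g (x, n) * 2 ^ n) div int (d (x, n))) = of_int \<lfloor>real_of_int (g (x, n) * 2 ^ n) / real_of_int (int (d (x, n)))\<rfloor>"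
    by (simp only: floor_divide_of_int_eq)
  also have "real_of_int (g (x, n) * 2 ^ n) / real_of_int (int (d (x, n))) = a * 2 ^ n" by (simp add: a_def)
  finally have eq: "real_of_int ((g (x, n) * 2 ^ n) div int (d (x, n))) = of_int \<lfloor>a * 2 ^ n\<rfloor>" .
  have "\<bar>of_int \<lfloor>a * 2 ^ n\<rfloor> - a * 2 ^ n\<bar> \<le> 1" by linarith
  then have "\<bar>of_int \<lfloor>a * 2 ^ n\<rfloor> / 2 ^ n - a\<bar> \<le> 1 / 2 ^ n"
  proof -
    have "of_int \<lfloor>a * 2 ^ n\<rfloor> / 2 ^ n - a = (of_int \<lfloor>a * 2 ^ n\<rfloor> - a * 2 ^ n) / 2 ^ n"
      by (simp add: diff_divide_distrib)
    then show ?thesis using \<open>\<bar>of_int \<lfloor>a * 2 ^ n\<rfloor> - a * 2 ^ n\<bar> \<le> 1\<close> by (simp add: divide_right_mono)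
  qed
  with close[of x n] have "\<bar>of_int \<lfloor>a * 2 ^ n\<rfloor> / 2 ^ n - r x\<bar> \<le> 1 / 2 ^ n + 1 / 2 ^ n"
    unfolding a_def[symmetric] by linarith
  then show "\<bar>real_of_int ((g (x, n) * 2 ^ snd (x, n)) div int (d (x, n))) / 2 ^ n - r x\<bar> \<le> 2 / 2 ^ n"
    by (simp add: eq)
qed

lemma CR_cong: "CR f \<Longrightarrow> (\<And>x. g x = f x) \<Longrightarrow> CR g"
  by (simp add: CR_def)

lemma CR_int [CR_intros]: "PR i \<Longrightarrow> CR (\<lambda>x. real_of_int (i x))"
  by (rule CR_I[where g = "\<lambda>z. i (fst z)" and d = "\<lambda>z. 1"]) (auto intro!: PR_fst_arg[of i] PR_intros)

lemma CR_nat [CR_intros]: "PR i \<Longrightarrow> CR (\<lambda>x. real (i x))"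
  using CR_int[OF PR_int, of i] by simp

lemma CR_of_bool [CR_intros]: "PRP P \<Longrightarrow> CR (\<lambda>x. of_bool (P x))"
  using CR_nat[OF PR_of_bool, of P] by simp

lemma CR_inverse_nat [CR_intros]: "PR h \<Longrightarrow> (\<And>x. h x > 0) \<Longrightarrow> CR (\<lambda>x. 1 / real (h x))"
  by (rule CR_I[where g = "\<lambda>z. 1" and d = "\<lambda>z. h (fst z)"]) (auto intro!: PR_fst_arg[of h] PR_intros)

lemma CR_comp: assumes "CR r" "PR f" shows "CR (\<lambda>x. r (f x))"
proof -
  obtain g where g: "PR g" "\<And>x n. \<bar>real_of_int (g (x, n)) / 2 ^ n - r x\<bar> \<le> 2 / 2 ^ n"
    using CR_E[OF assms(1)] by blast
  have "PR (\<lambda>z. g (f (fst z), snd z))" by (intro PR_comp[OF g(1)] PR_intros PR_fst_arg[of f] assms)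
  then show ?thesis unfolding CR_def using g(2) by force
qed

lemma CR_if [CR_intros]:
  assumes "PRP P" "CR r" "CR s" shows "CR (\<lambda>x. if P x then r x else s x)"
proof -
  obtain g where g: "PR g" "\<And>x n. \<bar>real_of_int (g (x, n)) / 2 ^ n - r x\<bar> \<le> 2 / 2 ^ n"
    using CR_E[OF assms(2)] by blast
  obtain h where h: "PR h" "\<And>x n. \<bar>real_of_int (h (x, n)) / 2 ^ n - s x\<bar> \<le> 2 / 2 ^ n"
    using CR_E[OF assms(3)] by blast
  have "PR (\<lambda>z. if P (fst z) then g z else h z)"
    by (intro PR_intros PRP_comp[OF assms(1)] g h)
  then show ?thesis unfolding CR_def using g(2) h(2) by (intro exI conjI) auto
qed

lemma CR_bound:
  assumes "CR r" obtains B where "PR B" "\<And>x. \<bar>r x\<bar> \<le> real (B x)"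
proof -
  obtain g where g: "PR g" "\<And>x n. \<bar>real_of_int (g (x, n)) / 2 ^ n - r x\<bar> \<le> 2 / 2 ^ n"
    using CR_E[OF assms(1)] by blast
  have p: "PR (\<lambda>x. nat (g (x, 0)) + nat (- g (x, 0)) + 2)"
    by (intro PR_intros PR_comp[OF g(1)])
  have "\<bar>r x\<bar> \<le> real (nat (g (x, 0)) + nat (- g (x, 0)) + 2)" for x
    using g(2)[of x 0] by (cases "g (x, 0) \<ge> 0") auto
  with p show ?thesis using that by blast
qed

lemma CR_add [CR_intros]:
  assumes "CR r" "CR s" shows "CR (\<lambda>x. r x + s x)"
proof -
  obtain g where g: "PR g" "\<And>x n. \<bar>real_of_int (g (x, n)) / 2 ^ n - r x\<bar> \<le> 2 / 2 ^ n"
    using CR_E[OF assms(1)] by blast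
  obtain h where h: "PR h" "\<And>x n. \<bar>real_of_int (h (x, n)) / 2 ^ n - s x\<bar> \<le> 2 / 2 ^ n"
    using CR_E[OF assms(2)] by blast
  show ?thesis
  proof (rule CR_I[where g = "\<lambda>z. g (fst z, snd z + 2) + h (fst z, snd z + 2)" and d = "\<lambda>z. 2 ^ (snd z + 2)"])
    fix x n
    show "\<bar>real_of_int (g (fst (x, n), snd (x, n) + 2) + h (fst (x, n), snd (x, n) + 2)) / real (2 ^ (snd (x, n) + 2))
          - (r x + s x)\<bar> \<le> 1 / 2 ^ n"
      using g(2)[of x "n + 2"] h(2)[of x "n + 2"] by (simp add: add_divide_distrib)
  qed (auto intro!: PR_intros PR_comp[OF g(1)] PR_comp[OF h(1)])
qed

lemma CR_mult [CR_intros]: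
  assumes "CR r" "CR s" shows "CR (\<lambda>x. r x * s x)"
proof -
  obtain g where g: "PR g" "\<And>x n. \<bar>real_of_int (g (x, n)) / 2 ^ n - r x\<bar> \<le> 2 / 2 ^ n"
    using CR_E[OF assms(1)] by blast
  obtain h where h: "PR h" "\<And>x n. \<bar>real_of_int (h (x, n)) / 2 ^ n - s x\<bar> \<le> 2 / 2 ^ n"
    using CR_E[OF assms(2)] by blast
  obtain B where B: "PR B" "\<And>x. \<bar>r x\<bar> \<le> real (B x)" using CR_bound[OF assms(1)] by blast
  obtain C where C: "PR C" "\<And>x. \<bar>s x\<bar> \<le> real (C x)" using CR_bound[OF assms(2)] by blast
  \<comment> \<open>The error of the product is at most \<open>2 (B + C + 2) / 2 ^ m\<close>, and \<open>k \<le> 2 ^ k\<close>.\<close>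
  define m where "m = (\<lambda>z. snd z + 2 * (B (fst z) + C (fst z) + 2))"
  have m: "PR m" unfolding m_def by (intro PR_intros PR_fst_arg[of B] PR_fst_arg[of C] B C)
  show ?thesis
  proof (rule CR_I[where g = "\<lambda>z. g (fst z, m z) * h (fst z, m z)" and d = "\<lambda>z. 2 ^ (2 * m z)"])
    fix x n
    define M where "M = m (x, n)"
    define a where "a = real_of_int (g (x, M)) / 2 ^ M"
    define b where "b = real_of_int (h (x, M)) / 2 ^ M"
    have a: "\<bar>a - r x\<bar> \<le> 2 / 2 ^ M" and b: "\<bar>b - s x\<bar> \<le> 2 / 2 ^ M"
      unfolding a_def b_def using g(2) h(2) by auto
    have "(2::real) / 2 ^ M \<le> 2" by (simp add: field_simps)
    then have a': "\<bar>a\<bar> \<le> real (B x) + 2" using a B(2)[of x] by linarith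
    have "a * b - r x * s x = a * (b - s x) + s x * (a - r x)" by (simp add: algebra_simps)
    then have "\<bar>a * b - r x * s x\<bar> \<le> \<bar>a\<bar> * \<bar>b - s x\<bar> + \<bar>s x\<bar> * \<bar>a - r x\<bar>"
      by (metis abs_mult abs_triangle_ineq)
    also have "\<dots> \<le> (real (B x) + 2) * (2 / 2 ^ M) + real (C x) * (2 / 2 ^ M)"
      using a b a' C(2)[of x] by (intro add_mono mult_mono) auto
    also have "\<dots> = real (2 * (B x + C x + 2)) / 2 ^ M" by (simp add: field_simps)
    also have "\<dots> \<le> 2 ^ (2 * (B x + C x + 2)) / 2 ^ M"
      by (intro divide_right_mono) (use less_exp[of "2 * (B x + C x + 2)"] in \<open>simp only: of_nat_le_numeral_power_cancel_iff less_imp_le\<close>, simp)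
    also have "\<dots> = 1 / 2 ^ n" by (simp add: M_def m_def power_add)
    finally have "\<bar>a * b - r x * s x\<bar> \<le> 1 / 2 ^ n" .
    moreover have "a * b = real_of_int (g (x, M) * h (x, M)) / real (2 ^ (2 * M))"
      by (simp add: a_def b_def power_add mult_2)
    ultimately show "\<bar>real_of_int (g (fst (x, n), m (x, n)) * h (fst (x, n), m (x, n))) / real (2 ^ (2 * m (x, n)))
          - r x * s x\<bar> \<le> 1 / 2 ^ n" by (simp add: M_def)
  qed (auto intro!: PR_intros PR_comp[OF g(1)] PR_comp[OF h(1)] m)
qed

lemma CR_const_int: "CR (\<lambda>x. real_of_int k)" by (intro CR_intros PR_intros)

lemma CR_0 [CR_intros]: "CR (\<lambda>x. 0)" using CR_const_int[of 0] by simp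
lemma CR_1 [CR_intros]: "CR (\<lambda>x. 1)" using CR_const_int[of 1] by simp
lemma CR_numeral [CR_intros]: "CR (\<lambda>x. numeral k)" using CR_const_int[of "numeral k"] by simp

lemma CR_uminus [CR_intros]: "CR r \<Longrightarrow> CR (\<lambda>x. - r x)"
  using CR_mult[OF CR_const_int[of "-1"], of r] by simp

lemma CR_diff [CR_intros]: "CR r \<Longrightarrow> CR s \<Longrightarrow> CR (\<lambda>x. r x - s x)"
  using CR_add[OF _ CR_uminus, of r s] by simp

lemma CR_divide_nat:
  assumes "CR r" "PR h" "\<And>x. h x > 0" shows "CR (\<lambda>x. r x / real (h x))"
  using CR_mult[OF assms(1) CR_inverse_nat[OF assms(2,3)]] by simp

lemma CR_divide_numeral [CR_intros]: "CR r \<Longrightarrow> CR (\<lambda>x. r x / numeral k)"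
  using CR_divide_nat[of r "\<lambda>x. numeral k"] by (simp add: PR_const)

lemma of_nat_le_two_power: "real n \<le> 2 ^ n"
  using less_exp[of n] by (simp only: of_nat_le_numeral_power_cancel_iff less_imp_le)

lemma CR_sum [CR_intros]:
  fixes h :: "'a::encodable \<Rightarrow> nat"
  assumes "PR h" "CR (\<lambda>z. f (fst z) (snd z))" shows "CR (\<lambda>x. \<Sum>i<h x. f x i)"
proof -
  obtain g where g: "PR g" "\<And>x n. \<bar>real_of_int (g (x, n)) / 2 ^ n - f (fst x) (snd x)\<bar> \<le> 2 / 2 ^ n"
    using CR_E[OF assms(2)] by blast
  define m where "m = (\<lambda>z. snd z + 1 + h (fst z))"
  have m: "PR m" unfolding m_def by (intro PR_intros PR_fst_arg[of h] assms)
  show ?thesis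
  proof (rule CR_I[where g = "\<lambda>z. \<Sum>i<h (fst z). g ((fst z, i), m z)" and d = "\<lambda>z. 2 ^ m z"])
    show "PR (\<lambda>z. \<Sum>i<h (fst z). g ((fst z, i), m z))"
      by (intro PR_intros PR_comp[OF g(1)] PR_fst_arg[of h] PR_fst_arg[of m] assms m)
    fix x n
    define M where "M = m (x, n)"
    have "\<bar>real_of_int (\<Sum>i<h x. g ((x, i), M)) / 2 ^ M - (\<Sum>i<h x. f x i)\<bar>
        = \<bar>\<Sum>i<h x. real_of_int (g ((x, i), M)) / 2 ^ M - f x i\<bar>"
      by (simp add: sum_subtractf sum_divide_distrib)
    also have "\<dots> \<le> (\<Sum>i<h x. 2 / 2 ^ M)"
      by (rule order_trans[OF sum_abs], rule sum_mono) (use g(2) in force)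
    also have "\<dots> = real (h x) * 2 / 2 ^ M" by simp
    also have "\<dots> \<le> 2 ^ h x * 2 / 2 ^ M"
      by (intro divide_right_mono mult_right_mono of_nat_le_two_power) auto
    also have "\<dots> = 1 / 2 ^ n" by (simp add: M_def m_def power_add)
    finally show "\<bar>real_of_int (\<Sum>i<h (fst (x, n)). g ((fst (x, n), i), m (x, n))) / real (2 ^ m (x, n))
       - (\<Sum>i<h x. f x i)\<bar> \<le> 1 / 2 ^ n" by (simp add: M_def)
  qed (auto intro!: PR_intros m)
qed

lemma abs_power_diff_le:
  fixes a b C :: real
  assumes "\<bar>a\<bar> \<le> C" "\<bar>b\<bar> \<le> C" "1 \<le> C"
  shows "\<bar>a ^ k - b ^ k\<bar> \<le> real k * C ^ k * \<bar>a - b\<bar>"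
proof (induction k)
  case (Suc k)
  have "a ^ Suc k - b ^ Suc k = a * (a ^ k - b ^ k) + b ^ k * (a - b)" by (simp add: algebra_simps)
  then have "\<bar>a ^ Suc k - b ^ Suc k\<bar> \<le> \<bar>a\<bar> * \<bar>a ^ k - b ^ k\<bar> + \<bar>b\<bar> ^ k * \<bar>a - b\<bar>"
    by (metis abs_mult abs_triangle_ineq power_abs)
  also have "\<dots> \<le> C * (real k * C ^ k * \<bar>a - b\<bar>) + C ^ Suc k * \<bar>a - b\<bar>"
  proof (intro add_mono mult_mono Suc)
    have "\<bar>b\<bar> ^ k \<le> C ^ k" using assms by (intro power_mono) auto
    also have "\<dots> \<le> C ^ Suc k" using assms by (intro power_increasing) auto
    finally show "\<bar>b\<bar> ^ k \<le> C ^ Suc k" .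
  qed (use assms in auto)
  also have "\<dots> = real (Suc k) * C ^ Suc k * \<bar>a - b\<bar>" by (simp add: algebra_simps)
  finally show ?case .
qed simp

lemma CR_power [CR_intros]:
  assumes "CR r" "PR k" shows "CR (\<lambda>x. r x ^ k x)"
proof -
  obtain g where g: "PR g" "\<And>x n. \<bar>real_of_int (g (x, n)) / 2 ^ n - r x\<bar> \<le> 2 / 2 ^ n"
    using CR_E[OF assms(1)] by blast
  obtain B where B: "PR B" "\<And>x. \<bar>r x\<bar> \<le> real (B x)" using CR_bound[OF assms(1)] by blast
  \<comment> \<open>The error is at most \<open>2 / 2 ^ m\<close> times the Lipschitz constant \<open>k (B + 2) ^ k\<close> of the power.\<close>
  define m where "m = (\<lambda>z. snd z + 1 + k (fst z) * (B (fst z) + 2) ^ k (fst z))"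
  have m: "PR m" unfolding m_def by (intro PR_intros PR_fst_arg[of B] PR_fst_arg[of k] B assms)
  show ?thesis
  proof (rule CR_I[where g = "\<lambda>z. g (fst z, m z) ^ k (fst z)" and d = "\<lambda>z. 2 ^ (m z * k (fst z))"])
    show "PR (\<lambda>z. g (fst z, m z) ^ k (fst z))" "PR (\<lambda>z. 2 ^ (m z * k (fst z)) :: nat)"
      by (intro PR_intros PR_comp[OF g(1)] PR_fst_arg[of k] assms m)+
    fix x n
    define M where "M = m (x, n)"
    define a where "a = real_of_int (g (x, M)) / 2 ^ M"
    define C where "C = real (B x + 2)"
    have a: "\<bar>a - r x\<bar> \<le> 2 / 2 ^ M"
      unfolding a_def using g(2) by auto
    have "(2::real) / 2 ^ M \<le> 2" by (simp add: field_simps)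
    then have "\<bar>a\<bar> \<le> C" "\<bar>r x\<bar> \<le> C" "1 \<le> C" using a B(2)[of x] unfolding C_def by auto
    then have "\<bar>a ^ k x - r x ^ k x\<bar> \<le> real (k x) * C ^ k x * \<bar>a - r x\<bar>" by (rule abs_power_diff_le)
    also have "\<dots> \<le> real (k x) * C ^ k x * (2 / 2 ^ M)"
      using a unfolding C_def by (intro mult_left_mono) auto
    also have "\<dots> = real (k x * (B x + 2) ^ k x) * 2 / 2 ^ M" by (simp add: C_def)
    also have "\<dots> \<le> 2 ^ (k x * (B x + 2) ^ k x) * 2 / 2 ^ M"
      by (intro divide_right_mono mult_right_mono of_nat_le_two_power) auto
    also have "\<dots> = 1 / 2 ^ n" by (simp add: M_def m_def power_add)
    finally show "\<bar>real_of_int (g (fst (x, n), m (x, n)) ^ k (fst (x, n))) / real (2 ^ (m (x, n) * k (fst (x, n))))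
          - r x ^ k x\<bar> \<le> 1 / 2 ^ n" by (simp add: M_def a_def power_divide power_mult)
  qed auto
qed

lemma CR_lim:
  assumes "CR (\<lambda>z. R (fst z) (snd z))" "\<And>x n. \<bar>R x n - r x\<bar> \<le> 1 / 2 ^ n"
  shows "CR r"
proof -
  obtain g where g: "PR g" "\<And>x n. \<bar>real_of_int (g (x, n)) / 2 ^ n - R (fst x) (snd x)\<bar> \<le> 2 / 2 ^ n"
    using CR_E[OF assms(1)] by blast
  show ?thesis
  proof (rule CR_I[where g = "\<lambda>z. g ((fst z, snd z + 2), snd z + 2)" and d = "\<lambda>z. 2 ^ (snd z + 2)"])
    fix x n
    have "\<bar>real_of_int (g ((x, n + 2), n + 2)) / 2 ^ (n + 2) - r x\<bar> \<le> 2 / 2 ^ (n + 2) + 1 / 2 ^ (n + 2)"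
      using g(2)[of "(x, n + 2)" "n + 2"] assms(2)[of x "n + 2"] unfolding fst_conv snd_conv by linarith
    also have "\<dots> \<le> 1 / 2 ^ n" by (simp add: field_simps)
    finally show "\<bar>real_of_int (g ((fst (x, n), snd (x, n) + 2), snd (x, n) + 2)) / real (2 ^ (snd (x, n) + 2))
          - r x\<bar> \<le> 1 / 2 ^ n" by simp
  qed (auto intro!: PR_intros PR_comp[OF g(1)])
qed

lemma PR_fact [PR_intros]: assumes "PR n" shows "PR (\<lambda>x. fact (n x) :: nat)"
proof -
  have pr: "PR (\<lambda>x. rec_nat 1 (\<lambda>m r. Suc m * r) (n x))" using assms by (intro PR_rec PR_intros)
  have eq: "rec_nat 1 (\<lambda>m r. Suc m * r) k = fact k" for k by (induction k) (auto simp: algebra_simps)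
  show ?thesis by (rule PR_eq[OF pr]) (simp only: eq)
qed

lemma CR_sin_coeff: "PR i \<Longrightarrow> CR (\<lambda>x. sin_coeff (i x))"
proof -
  assume i: "PR i"
  have "CR (\<lambda>x. if i x mod 2 = 0 then 0 else (- 1) ^ ((i x - 1) div 2) / real (fact (i x)))"
    by (intro CR_intros CR_divide_nat PR_intros i) auto
  then show ?thesis by (rule CR_cong) (auto simp: sin_coeff_def even_iff_mod_2_eq_zero)
qed

lemma power_le_fact: "M ^ k \<le> fact (M + k)" for M k :: nat
proof (induction k)
  case (Suc k)
  have "M ^ Suc k \<le> (M + Suc k) * fact (M + k)" using Suc by (simp only: power_Suc, intro mult_mono) auto
  then show ?case by simp
qed simp

text \<open>The Taylor series, cut off at a place that depends on a bound for the argument; as no efficiency is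
  required, the argument need not be reduced modulo the period.\<close>

lemma CR_sin [CR_intros]:
  assumes "CR y" shows "CR (\<lambda>x. sin (y x))"
proof -
  obtain B0 where B0: "PR B0" "\<And>x. \<bar>y x\<bar> \<le> real (B0 x)" using CR_bound[OF assms(1)] by blast
  define B where "B x = Suc (B0 x)" for x
  have B: "PR B" "\<And>x. \<bar>y x\<bar> \<le> real (B x)" "\<And>x. B x \<ge> 1"
  proof -
    show "PR B" unfolding B_def by (intro PR_intros B0)
    fix x
    show "\<bar>y x\<bar> \<le> real (B x)" using B0(2)[of x] by (simp add: B_def)
    show "B x \<ge> 1" by (simp add: B_def)
  qed
  \<comment> \<open>With \<open>K = 2 B + j\<close> terms, the remainder is at most
    \<open>B ^ K / fact K \<le> B ^ (2 B + j) / (2 B) ^ j = B ^ (2 B) / 2 ^ j\<close>.\<close>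
  define K where "K = (\<lambda>x n. 2 * B x + (n + B x * (2 * B x)))"
  have K: "PR (\<lambda>z. K (fst z) (snd z))"
    unfolding K_def by (intro PR_intros PR_fst_arg[of B] B)
  show ?thesis
  proof (rule CR_lim[where R = "\<lambda>x n. \<Sum>i<K x n. sin_coeff i * y x ^ i"])
    show "CR (\<lambda>z. \<Sum>i<K (fst z) (snd z). sin_coeff i * y (fst z) ^ i)"
      by (intro CR_intros K CR_sin_coeff PR_intros CR_comp[OF assms])
    fix x n
    define j where "j = n + B x * (2 * B x)"
    have Kj: "K x n = 2 * B x + j" by (simp add: K_def j_def)
    have "\<bar>sin (y x) - (\<Sum>i<K x n. sin_coeff i * y x ^ i)\<bar> \<le> inverse (fact (K x n)) * \<bar>y x\<bar> ^ K x n"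
      by (rule Maclaurin_sin_bound)
    also have "\<dots> \<le> inverse (real ((2 * B x) ^ j)) * real (B x) ^ K x n"
    proof (intro mult_mono power_mono B le_imp_inverse_le)
      have "real ((2 * B x) ^ j) \<le> real (fact (2 * B x + j))" by (intro of_nat_mono power_le_fact)
      then show "real ((2 * B x) ^ j) \<le> fact (K x n)" by (simp add: K_def j_def)
      show "0 < real ((2 * B x) ^ j)" using B(3)[of x] by simp
    qed auto
    also have "\<dots> = real (B x) ^ (2 * B x) / 2 ^ j"
      using B(3)[of x] by (simp add: Kj power_add power_mult_distrib field_simps)
    also have "\<dots> \<le> (2 ^ B x) ^ (2 * B x) / 2 ^ j"
      by (intro divide_right_mono power_mono of_nat_le_two_power) auto
    also have "\<dots> = 1 / 2 ^ n" by (simp add: j_def power_add power_mult)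
    finally show "\<bar>(\<Sum>i<K x n. sin_coeff i * y x ^ i) - sin (y x)\<bar> \<le> 1 / 2 ^ n"
      by (simp add: abs_minus_commute)
  qed
qed

text \<open>The Leibniz series: the error of an alternating sum is at most its next term.\<close>

lemma pi_partial_sum: "\<bar>(\<Sum>k<2 * m. (- 1) ^ k * 1 / real (k * 2 + 1)) - pi / 4\<bar> \<le> 1 / real (4 * m + 1)"
proof -
  define a where "a k = 1 / real (k * 2 + 1)" for k
  have lim: "a \<longlonglongrightarrow> 0" unfolding a_def by real_asymp
  have mono: "a (Suc n) \<le> a n" for n unfolding a_def by (simp add: frac_le)
  have pos: "0 \<le> a n" for n unfolding a_def by simp
  have sum: "pi / 4 = (\<Sum>k. (- 1) ^ k * a k)" unfolding a_def using pi_series by simp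
  have l: "(\<Sum>i<2 * n. (- 1) ^ i * a i) \<le> (\<Sum>i. (- 1) ^ i * a i)"
    and u: "(\<Sum>i. (- 1) ^ i * a i) \<le> (\<Sum>i<2 * n + 1. (- 1) ^ i * a i)" for n
    using summable_Leibniz'(2,4)[of a n, OF lim pos mono] by auto
  have "(\<Sum>i<2 * m + 1. (- 1) ^ i * a i) = (\<Sum>i<2 * m. (- 1) ^ i * a i) + a (2 * m)" by simp
  then have "\<bar>(\<Sum>i<2 * m. (- 1) ^ i * a i) - pi / 4\<bar> \<le> a (2 * m)" using l[of m] u[of m] sum by linarith
  then show ?thesis by (simp add: a_def algebra_simps)
qed

lemma CR_pi [CR_intros]: "CR (\<lambda>x. pi)"
proof -
  define S where "S m = (\<Sum>k<2 * m. (- 1) ^ k * 1 / real (k * 2 + 1))" for m :: nat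
  have "CR (\<lambda>x. pi / 4 * 4)"
  proof (rule CR_mult[OF _ CR_numeral], rule CR_lim[where R = "\<lambda>x n. S (2 ^ n)"])
    have "CR (\<lambda>z. \<Sum>k<2 * 2 ^ snd z. (- 1) ^ k * 1 / real (k * 2 + 1))"
      by (intro CR_intros CR_divide_nat PR_intros) auto
    then show "CR (\<lambda>z. S (2 ^ snd z))" by (simp add: S_def)
    fix n
    have "\<bar>S (2 ^ n) - pi / 4\<bar> \<le> 1 / real (4 * 2 ^ n + 1)" unfolding S_def by (rule pi_partial_sum)
    also have "\<dots> \<le> 1 / 2 ^ n" by (intro frac_le) auto
    finally show "\<bar>S (2 ^ n) - pi / 4\<bar> \<le> 1 / 2 ^ n" .
  qed
  then show ?thesis by simp
qed

lemma CR_cos [CR_intros]: "CR y \<Longrightarrow> CR (\<lambda>x. cos (y x))"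
proof -
  assume "CR y"
  then have "CR (\<lambda>x. sin (pi / 2 - y x))" by (intro CR_intros)
  then show ?thesis by (rule CR_cong) (simp add: cos_sin_eq)
qed

text \<open>Rounding to the nearest multiple of the unit leaves room for a further error of a
  quarter of the unit.\<close>

lemma CR_round:
  assumes "CR r"
  obtains g where "PR g" "\<And>x n. \<bar>real_of_int (g (x, n)) / 2 ^ n - r x\<bar> \<le> (3 / 4) / 2 ^ n"
proof -
  obtain g where g: "PR g" "\<And>x n. \<bar>real_of_int (g (x, n)) / 2 ^ n - r x\<bar> \<le> 2 / 2 ^ n"
    using CR_E[OF assms(1)] by blast
  have "PR (\<lambda>z. (g (fst z, snd z + 4) + 8) div int 16)" by (intro PR_intros PR_comp[OF g(1)])
  moreover have "\<bar>real_of_int ((g (x, n + 4) + 8) div int 16) / 2 ^ n - r x\<bar> \<le> (3 / 4) / 2 ^ n" for x n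
  proof -
    define G where "G = g (x, n + 4)"
    define q where "q = (G + 8) div 16"
    have "16 * q \<le> G + 8" "G + 8 < 16 * q + 16" unfolding q_def by presburger+
    then have "real_of_int (16 * q) \<le> real_of_int (G + 8)" "real_of_int (G + 8) < real_of_int (16 * q + 16)"
      by (simp_all only: of_int_le_iff of_int_less_iff)
    then have "\<bar>real_of_int q - real_of_int G / 16\<bar> \<le> 1 / 2"
      unfolding of_int_add of_int_mult of_int_numeral abs_le_iff by linarith
    then have "\<bar>(real_of_int (q) - real_of_int G / 16) / 2 ^ n\<bar> \<le> (1 / 2) / 2 ^ n"
      unfolding abs_divide power_abs abs_numeral by (rule divide_right_mono) simp
    moreover have "\<bar>real_of_int G / 16 / 2 ^ n - r x\<bar> \<le> (1 / 8) / 2 ^ n"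
      using g(2)[of x "n + 4"] by (simp add: G_def power_add)
    ultimately have "\<bar>real_of_int (q) / 2 ^ n - r x\<bar> \<le> (1 / 2) / 2 ^ n + (1 / 8) / 2 ^ n"
      unfolding diff_divide_distrib by linarith
    also have "\<dots> \<le> (3 / 4) / 2 ^ n" by (simp add: field_simps)
    finally show ?thesis by (simp add: G_def q_def)
  qed
  ultimately show ?thesis using that by fastforce
qed


section \<open>Searching for counterexamples\<close>

text \<open>The valuation with code \<open>e\<close>: the number \<open>e\<close> is read as an infinitely nested pair, so that every
  finite list of values is an initial segment of some valuation.\<close>

definition env :: "nat \<Rightarrow> nat \<Rightarrow> nat" where
  "env e i = fst (prod_decode (((\<lambda>m. snd (prod_decode m)) ^^ i) e))"

lemma env_exists: "\<exists>e. \<forall>i<n. env e i = a i"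
proof (induction n arbitrary: a)
  case (Suc n)
  obtain e where e: "\<forall>i<n. env e i = a (Suc i)" using Suc[of "\<lambda>i. a (Suc i)"] by blast
  have "env (prod_encode (a 0, e)) i = a i" if "i < Suc n" for i
    using that e by (cases i) (auto simp: env_def funpow_swap1 simp del: funpow.simps(2) simp add: funpow_Suc_right)
  then show ?case by blast
qed simp

lemma PR_env [PR_intros]:
  assumes "PR f" "PR g" shows "PR (\<lambda>x. env (f x) (g x))"
proof -
  have pr: "PR (\<lambda>x. fst (prod_decode (rec_nat (f x) (\<lambda>m r. snd (prod_decode r)) (g x))))"
    using assms by (intro PR_intros PR_prod_decode PR_rec)
  have eq: "rec_nat e (\<lambda>m r. snd (prod_decode r)) i = ((\<lambda>m. snd (prod_decode m)) ^^ i) e" for e i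
    by (induction i) auto
  show ?thesis by (rule PR_eq[OF pr]) (simp only: env_def eq)
qed

text \<open>In the table of the values of all codes below \<open>c\<close>, in descending order, the entry for \<open>i\<close> is
  preceded by those for \<open>c - 1, \<dots>, i + 1\<close>.\<close>

definition table_entry :: "nat \<Rightarrow> nat list \<Rightarrow> nat \<Rightarrow> nat" where
  "table_entry c tbl i = hd (drop (c - Suc i) tbl)"

definition trm_step :: "nat \<Rightarrow> nat \<Rightarrow> nat list \<Rightarrow> nat" where
  "trm_step e c tbl = (if fst (prod_decode c) = 0 then env e (snd (prod_decode c))
     else if fst (prod_decode c) = 1 then 0
     else if fst (prod_decode c) = 2 then 1
     else if fst (prod_decode c) = 3 then
       table_entry c tbl (fst (prod_decode (snd (prod_decode c)))) + table_entry c tbl (snd (prod_decode (snd (prod_decode c))))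
     else table_entry c tbl (fst (prod_decode (snd (prod_decode c)))) * table_entry c tbl (snd (prod_decode (snd (prod_decode c)))))"

definition eval_trm :: "nat \<Rightarrow> nat \<Rightarrow> nat" where
  "eval_trm e = cov_rec (trm_step e)"

lemma PR_table_entry [PR_intros]: "PR f \<Longrightarrow> PR g \<Longrightarrow> PR h \<Longrightarrow> PR (\<lambda>x. table_entry (f x) (g x) (h x))"
  unfolding table_entry_def by (intro PR_intros)

lemma PR_eval_trm [PR_intros]:
  assumes "PR f" "PR g" shows "PR (\<lambda>x. eval_trm (f x) (g x))"
  unfolding eval_trm_def
  by (rule PR_cov_rec[OF _ assms(2)]) (unfold trm_step_def, intro PR_intros PR_prod_decode PR_fst_arg[of f] assms)

lemma less_prod_encode: "a > 0 \<Longrightarrow> b < prod_encode (a, b)"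
proof -
  have "n \<le> triangle n" for n by (induction n) auto
  from this[of "a + b"] show "a > 0 \<Longrightarrow> b < prod_encode (a, b)" by (simp add: prod_encode_def)
qed

lemma less_prod_encode_left: "t > 0 \<Longrightarrow> a < prod_encode (t, prod_encode (a, b))"
  and less_prod_encode_right: "t > 0 \<Longrightarrow> b < prod_encode (t, prod_encode (a, b))"
  using less_prod_encode[of t "prod_encode (a, b)"] le_prod_encode_1[of a b] le_prod_encode_2[of b a] by linarith+

lemma table_entry_lookup: "i < c \<Longrightarrow> table_entry c (cov_table H c) i = cov_rec H i"
  unfolding table_entry_def by (rule cov_table_lookup)

lemma eval_trm_unfold: "eval_trm e c = trm_step e c (cov_table (trm_step e) c)"
  by (simp add: eval_trm_def cov_rec_def)

lemma eval_trm_code: "eval_trm e (trm_code s) = trm_value (env e) s"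
proof (induction s)
  case (Add s t)
  then show ?case
    by (simp add: eval_trm_unfold[of e "prod_encode (3, prod_encode (trm_code s, trm_code t))"] trm_step_def table_entry_lookup less_prod_encode_left less_prod_encode_right
        flip: eval_trm_def)
next
  case (Mult s t)
  then show ?case
    by (simp add: eval_trm_unfold[of e "prod_encode (4, prod_encode (trm_code s, trm_code t))"] trm_step_def table_entry_lookup less_prod_encode_left less_prod_encode_right
        flip: eval_trm_def)
qed (simp_all add: eval_trm_unfold trm_step_def)

text \<open>The quantifiers are skipped, so that a universal sentence is evaluated as its matrix under the valuation
  \<open>e\<close>. The values of the subformulas are looked up in the table of the values of all smaller codes.\<close>

definition fm_step :: "nat \<Rightarrow> nat \<Rightarrow> nat list \<Rightarrow> nat" where
  "fm_step e c tbl =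
    (let t = fst (prod_decode c); a = snd (prod_decode c); l = fst (prod_decode a); r = snd (prod_decode a) in
     if t = 0 then of_bool (eval_trm e l = eval_trm e r)
     else if t = 1 then of_bool (eval_trm e l < eval_trm e r)
     else if t = 2 then of_bool (table_entry c tbl a = 0)
     else if t = 3 then of_bool (\<not> table_entry c tbl l = 0 \<and> \<not> table_entry c tbl r = 0)
     else if t = 4 then of_bool (\<not> table_entry c tbl l = 0 \<or> \<not> table_entry c tbl r = 0)
     else if t = 5 then of_bool (\<not> table_entry c tbl l = 0 \<longrightarrow> \<not> table_entry c tbl r = 0)
     else table_entry c tbl r)"

definition eval_fm :: "nat \<Rightarrow> nat \<Rightarrow> nat" where
  "eval_fm e = cov_rec (fm_step e)"

lemma PR_eval_fm [PR_intros]: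
  assumes "PR f" "PR g" shows "PR (\<lambda>x. eval_fm (f x) (g x))"
  unfolding eval_fm_def
  by (rule PR_cov_rec[OF _ assms(2)]) (unfold fm_step_def Let_def, intro PR_intros PR_prod_decode PR_fst_arg[of f] assms)

lemma eval_fm_unfold: "eval_fm e c = fm_step e c (cov_table (fm_step e) c)"
  by (simp add: eval_fm_def cov_rec_def)

lemma eval_fm_quantifier_free: "quantifier_free a \<Longrightarrow> eval_fm e (fm_code a) = of_bool (satisfies (env e) a)"
proof (induction a)
  case (Eq s t) then show ?case by (simp add: eval_fm_unfold fm_step_def eval_trm_code)
next
  case (Less s t) then show ?case by (simp add: eval_fm_unfold fm_step_def eval_trm_code)
next
  case (Neg a)
  then show ?case
    by (simp add: eval_fm_unfold[of e "prod_encode (2, fm_code a)"] fm_step_def table_entry_lookup less_prod_encode flip: eval_fm_def)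
next
  case (Conj a b)
  then show ?case
    by (simp add: eval_fm_unfold[of e "prod_encode (3, prod_encode (fm_code a, fm_code b))"] fm_step_def table_entry_lookup less_prod_encode_left less_prod_encode_right flip: eval_fm_def)
next
  case (Disj a b)
  then show ?case
    by (simp add: eval_fm_unfold[of e "prod_encode (4, prod_encode (fm_code a, fm_code b))"] fm_step_def table_entry_lookup less_prod_encode_left less_prod_encode_right flip: eval_fm_def)
next
  case (Imp a b)
  then show ?case
    by (simp add: eval_fm_unfold[of e "prod_encode (5, prod_encode (fm_code a, fm_code b))"] fm_step_def table_entry_lookup less_prod_encode_left less_prod_encode_right flip: eval_fm_def)
qed simp_all

lemma eval_fm_All: "eval_fm e (fm_code (All i a)) = eval_fm e (fm_code a)"
  by (simp add: eval_fm_unfold[of e "prod_encode (6, prod_encode (i, fm_code a))"] fm_step_def table_entry_lookup less_prod_encode_right flip: eval_fm_def)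

lemma eval_fm_foldr_All: "eval_fm e (fm_code (foldr All is a)) = eval_fm e (fm_code a)"
  by (induction "is") (simp_all add: eval_fm_All del: fm_code.simps)

lemma trm_value_cong: "(\<And>i. i \<in> trm_vars s \<Longrightarrow> e i = e' i) \<Longrightarrow> trm_value e s = trm_value e' s"
  by (induction s) auto

lemma satisfies_cong: "(\<And>i. i \<in> free_vars a \<Longrightarrow> e i = e' i) \<Longrightarrow> satisfies e a = satisfies e' a"
proof (induction a arbitrary: e e')
  case (Eq s t)
  then have "trm_value e s = trm_value e' s" "trm_value e t = trm_value e' t" by (auto intro!: trm_value_cong)
  then show ?case by simp
next
  case (Less s t)
  then have "trm_value e s = trm_value e' s" "trm_value e t = trm_value e' t" by (auto intro!: trm_value_cong)
  then show ?case by simp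
next
  case (Neg a)
  have "satisfies e a = satisfies e' a" by (rule Neg.IH) (use Neg.prems in auto)
  then show ?case by simp
next
  case (Conj a b)
  have "satisfies e a = satisfies e' a" by (rule Conj.IH(1)) (use Conj.prems in auto)
  moreover have "satisfies e b = satisfies e' b" by (rule Conj.IH(2)) (use Conj.prems in auto)
  ultimately show ?case by simp
next
  case (Disj a b)
  have "satisfies e a = satisfies e' a" by (rule Disj.IH(1)) (use Disj.prems in auto)
  moreover have "satisfies e b = satisfies e' b" by (rule Disj.IH(2)) (use Disj.prems in auto)
  ultimately show ?case by simp
next
  case (Imp a b)
  have "satisfies e a = satisfies e' a" by (rule Imp.IH(1)) (use Imp.prems in auto)
  moreover have "satisfies e b = satisfies e' b" by (rule Imp.IH(2)) (use Imp.prems in auto)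
  ultimately show ?case by simp
next
  case (All i a)
  have "satisfies (e(i := m)) a = satisfies (e'(i := m)) a" for m
    by (rule All.IH) (use All.prems in auto)
  then show ?case by simp
next
  case (Ex i a)
  have "satisfies (e(i := m)) a = satisfies (e'(i := m)) a" for m
    by (rule Ex.IH) (use Ex.prems in auto)
  then show ?case by simp
qed

lemma free_vars_foldr_All: "free_vars (foldr All is a) = free_vars a - set is"
  by (induction "is") auto

lemma true_foldr_All: "true_in_nat (foldr All is a) \<longleftrightarrow> true_in_nat a"
proof (induction "is")
  case (Cons i "is")
  have "true_in_nat (All i c) \<longleftrightarrow> true_in_nat c" for c
    unfolding true_in_nat_def by (simp, metis fun_upd_triv)
  then show ?case using Cons by simp
qed simp

text \<open>The truth of the matrix depends only on finitely many variables, hence the valuations with a code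
  suffice.\<close>

lemma Pi01_true_iff:
  assumes "Pi01_sentence a" shows "true_in_nat a \<longleftrightarrow> (\<forall>e. eval_fm e (fm_code a) \<noteq> 0)"
proof -
  obtain n c where c: "quantifier_free c" "a = foldr All [0..<Suc n] c" "free_vars a = {}"
    using assms unfolding Pi01_sentence_def by blast
  have fv: "free_vars c \<subseteq> {..<Suc n}" using c(3) unfolding c(2) free_vars_foldr_All by auto
  have "true_in_nat c \<longleftrightarrow> (\<forall>e. satisfies (env e) c)"
    unfolding true_in_nat_def
  proof (intro iffI allI)
    fix e assume all: "\<forall>e. satisfies (env e) c"
    obtain k where k: "\<forall>i<Suc n. env k i = e i" using env_exists by blast
    have "satisfies (env k) c = satisfies e c" by (rule satisfies_cong) (use k fv in auto)
    then show "satisfies e c" using all by simp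
  qed simp
  then show ?thesis unfolding c(2) true_foldr_All eval_fm_foldr_All by (simp add: eval_fm_quantifier_free[OF c(1)])
qed

text \<open>The bounded search makes this decidable, and monotone in \<open>j\<close>.\<close>

definition refuted :: "nat \<Rightarrow> nat \<Rightarrow> bool" where
  "refuted N j \<longleftrightarrow> (\<exists>i\<le>j. eval_fm i N = 0)"

lemma PRP_refuted [PR_intros]:
  assumes "PR f" "PR g" shows "PRP (\<lambda>x. refuted (f x) (g x))"
proof -
  have "PRP (\<lambda>x. 0 < (\<Sum>i<Suc (g x). of_bool (eval_fm i (f x) = 0) :: nat))"
    by (intro PR_intros PR_fst_arg[of f] assms)
  moreover have "0 < (\<Sum>i<Suc k. of_bool (eval_fm i N = 0) :: nat) \<longleftrightarrow> refuted N k" for N k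
    unfolding refuted_def neq0_conv[symmetric] sum_eq_0_iff[OF finite_lessThan] by (auto simp: less_Suc_eq_le)
  ultimately show ?thesis by simp
qed

lemma codes_true_iff:
  assumes "N \<in> Pi01_codes" shows "codes_true_sentence N \<longleftrightarrow> (\<forall>j. \<not> refuted N j)"
proof -
  obtain a where a: "Pi01_sentence a" "N = fm_code a" using assms unfolding Pi01_codes_def by blast
  have "codes_true_sentence N \<longleftrightarrow> true_in_nat a"
    unfolding codes_true_sentence_def a(2) using a(1) inj_eq[OF inj_fm_code] by auto
  also have "\<dots> \<longleftrightarrow> (\<forall>j. \<not> refuted N j)"
    unfolding Pi01_true_iff[OF a(1)] refuted_def a(2) by auto
  finally show ?thesis .
qed


section \<open>Lebesgue measure on the circle\<close>

text \<open>The circle is the interval \<open>{0..<1}\<close>, and the measure lives on the whole line, so that Borel functions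
  on the line can be integrated as they are. Rotations are composed with \<open>frac\<close>.\<close>

definition circle_measure :: "real measure" where
  "circle_measure = density lborel (indicator {0..<1})"

lemma sets_circle_measure [simp, measurable_cong]: "sets circle_measure = sets borel"
  by (simp add: circle_measure_def)

lemma space_circle_measure [simp]: "space circle_measure = UNIV"
  by (simp add: circle_measure_def)

lemma emeasure_circle_measure:
  "A \<in> sets borel \<Longrightarrow> emeasure circle_measure A = emeasure lborel (A \<inter> {0..<1})"
  by (simp add: circle_measure_def emeasure_density ac_simps flip: indicator_inter_arith)

lemma emeasure_circle_measure_UNIV: "emeasure circle_measure UNIV = 1"
  by (simp add: emeasure_circle_measure)

interpretation circle: finite_measure circle_measure
  by standard (simp add: emeasure_circle_measure_UNIV)

lemma AE_circle_iff: "(AE x in circle_measure. P x) \<longleftrightarrow> (AE x in lborel. x \<in> {0..<1} \<longrightarrow> P x)"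
  unfolding circle_measure_def by (subst AE_density) (auto simp: indicator_def)

lemma AE_circle_unit: "AE x in circle_measure. x \<in> {0..<1}"
  by (simp add: AE_circle_iff)

lemma emeasure_affine_vimage:
  fixes c t :: real
  assumes "c \<noteq> 0" "B \<in> sets borel"
  shows "emeasure lborel B = ennreal \<bar>c\<bar> * emeasure lborel ((\<lambda>x. t + c * x) -` B)"
proof -
  have "emeasure lborel B = emeasure (density (distr lborel borel (\<lambda>x. t + c * x)) (\<lambda>_. ennreal \<bar>c\<bar>)) B"
    using lborel_real_affine[OF assms(1), of t] by simp
  also have "\<dots> = ennreal \<bar>c\<bar> * emeasure lborel ((\<lambda>x. t + c * x) -` B)"
    using assms by (subst emeasure_density_const) (simp_all add: emeasure_distr)
  finally show ?thesis .
qed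

lemma measure_preserving_circleI:
  assumes [measurable]: "\<rho> \<in> borel_measurable borel"
    and "\<And>A. A \<in> sets borel \<Longrightarrow> emeasure lborel (\<rho> -` A \<inter> {0..<1}) = emeasure lborel (A \<inter> {0..<1})"
  shows "measure_preserving circle_measure circle_measure \<rho>"
  unfolding measure_preserving_def
proof
  show m: "\<rho> \<in> measurable circle_measure circle_measure"
    by (simp add: measurable_cong_sets[OF sets_circle_measure sets_circle_measure])
  show "distr circle_measure circle_measure \<rho> = circle_measure"
  proof (rule measure_eqI)
    fix A assume "A \<in> sets (distr circle_measure circle_measure \<rho>)"
    then have [measurable]: "A \<in> sets borel" by simp
    have "\<rho> -` A \<in> sets borel" using measurable_sets_borel[of \<rho> borel A] by simp
    then show "emeasure (distr circle_measure circle_measure \<rho>) A = emeasure circle_measure A"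
      using assms(2)[of A] by (simp add: emeasure_distr m emeasure_circle_measure)
  qed simp
qed

lemma measurable_frac [measurable]: "frac \<in> borel_measurable (borel :: real measure)"
  unfolding frac_def by measurable

lemma frac_eq_if: "frac (x + of_int k) = frac (x :: real)"
  by (simp add: frac_def)

lemma measure_preserving_shift: "measure_preserving circle_measure circle_measure (\<lambda>x. frac (x + c))"
proof (rule measure_preserving_circleI)
  fix A :: "real set" assume A [measurable]: "A \<in> sets borel"
  define d where "d = frac c"
  have d: "0 \<le> d" "d < 1" by (auto simp: d_def frac_lt_1)
  have fr: "frac (x + c) = (if x + d < 1 then x + d else x + d - 1)" if "x \<in> {0..<1}" for x
    using that d unfolding d_def frac_add by (auto simp: frac_eq)
  have "(\<lambda>x. frac (x + c)) -` A \<inter> {0..<1}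
      = ((\<lambda>x. d + 1 * x) -` (A \<inter> {d..<1})) \<union> ((\<lambda>x. (d - 1) + 1 * x) -` (A \<inter> {0..<d}))"
    (is "?L = ?P \<union> ?Q")
  proof (intro set_eqI iffI)
    fix x assume "x \<in> ?L"
    then show "x \<in> ?P \<union> ?Q" using fr[of x] d by (auto simp: algebra_simps split: if_splits)
  next
    fix x assume x: "x \<in> ?P \<union> ?Q"
    then have "x \<in> {0..<1}" using d by auto
    then show "x \<in> ?L" using fr[of x] x d by (auto simp: algebra_simps split: if_splits)
  qed
  moreover have "emeasure lborel (?P \<union> ?Q) = emeasure lborel ?P + emeasure lborel ?Q"
    by (intro plus_emeasure[symmetric]) (auto intro!: measurable_sets_borel[of _ borel])
  moreover have "emeasure lborel ?P = emeasure lborel (A \<inter> {d..<1})"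
    by (subst emeasure_affine_vimage[of 1 "A \<inter> {d..<1}" d]) auto
  moreover have "emeasure lborel ?Q = emeasure lborel (A \<inter> {0..<d})"
    by (subst emeasure_affine_vimage[of 1 "A \<inter> {0..<d}" "d - 1"]) auto
  moreover have "emeasure lborel (A \<inter> {0..<1}) = emeasure lborel (A \<inter> {d..<1}) + emeasure lborel (A \<inter> {0..<d})"
    by (subst plus_emeasure) (use d in \<open>auto intro!: arg_cong[of _ _ "emeasure lborel"]\<close>)
  ultimately show "emeasure lborel ((\<lambda>x. frac (x + c)) -` A \<inter> {0..<1}) = emeasure lborel (A \<inter> {0..<1})"
    by simp
qed measurable

lemma measure_preserving_comp:
  assumes "measure_preserving M N f" "measure_preserving N L g"
  shows "measure_preserving M L (\<lambda>x. g (f x))"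
proof -
  have f: "f \<in> measurable M N" "distr M N f = N" and g: "g \<in> measurable N L" "distr N L g = L"
    using assms by (auto simp: measure_preserving_def)
  have "distr M L (g \<circ> f) = L" using distr_distr[OF g(1) f(1)] f g by simp
  then show ?thesis using measurable_comp[OF f(1) g(1)] by (simp add: measure_preserving_def o_def)
qed

lemma measure_preserving_neg: "measure_preserving circle_measure circle_measure (\<lambda>x. frac (- x))"
proof (rule measure_preserving_circleI)
  fix A :: "real set" assume A [measurable]: "A \<in> sets borel"
  have fr: "frac (- x) = 1 - x" if "x \<in> {0<..<1}" for x :: real
    using that by (subst frac_unique_iff) auto
  have "emeasure lborel ((\<lambda>x. frac (- x)) -` A \<inter> {0..<1}) = emeasure lborel ((\<lambda>x. frac (- x)) -` A \<inter> {0<..<1})"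
  proof (rule emeasure_eq_AE)
    have "AE x in lborel. x \<noteq> (0::real)" by (rule AE_lborel_singleton)
    then show "AE x in lborel. x \<in> (\<lambda>x. frac (- x)) -` A \<inter> {0..<1} \<longleftrightarrow> x \<in> (\<lambda>x. frac (- x)) -` A \<inter> {0<..<1}"
      by eventually_elim auto
  qed (auto intro!: measurable_sets_borel[of _ borel] sets.Int)
  also have "(\<lambda>x. frac (- x)) -` A \<inter> {0<..<1} = (\<lambda>x. 1 + (- 1) * x) -` (A \<inter> {0<..<1})"
    using fr by auto
  also have "emeasure lborel \<dots> = emeasure lborel (A \<inter> {0<..<1})"
    by (subst emeasure_affine_vimage[of "-1" "A \<inter> {0<..<1}" 1]) auto
  also have "\<dots> = emeasure lborel (A \<inter> {0..<1})"
  proof (rule emeasure_eq_AE)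
    have "AE x in lborel. x \<noteq> (0::real)" by (rule AE_lborel_singleton)
    then show "AE x in lborel. x \<in> A \<inter> {0<..<1} \<longleftrightarrow> x \<in> A \<inter> {0..<1}" by eventually_elim auto
  qed auto
  finally show "emeasure lborel ((\<lambda>x. frac (- x)) -` A \<inter> {0..<1}) = emeasure lborel (A \<inter> {0..<1})" .
qed measurable

lemma measure_preserving_reflect: "measure_preserving circle_measure circle_measure (\<lambda>x. frac (c - x))"
  using measure_preserving_comp[OF measure_preserving_neg measure_preserving_shift[of c]]
  by simp

text \<open>The preimage of a set consists of \<open>q\<close> translates of one copy that is scaled down by the factor \<open>q\<close>.\<close>

lemma measure_preserving_multiple:
  assumes "q > (0::nat)"
  shows "measure_preserving circle_measure circle_measure (\<lambda>x. frac (real q * x))"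
proof (rule measure_preserving_circleI)
  fix A :: "real set" assume A [measurable]: "A \<in> sets borel"
  define P where "P k = (\<lambda>x. - real k + real q * x) -` (A \<inter> {0..<1})" for k
  have mP: "P k \<in> sets borel" for k unfolding P_def by (rule measurable_sets_borel[of _ borel]) auto
  have fl: "\<lfloor>real q * x\<rfloor> = int k" if "x \<in> P k" for x k
    using that by (auto simp: P_def floor_eq_iff)
  have "(\<lambda>x. frac (real q * x)) -` A \<inter> {0..<1} = (\<Union>k<q. P k)"
  proof (intro set_eqI iffI)
    fix x assume x: "x \<in> (\<lambda>x. frac (real q * x)) -` A \<inter> {0..<1}"
    define k where "k = nat \<lfloor>real q * x\<rfloor>"
    have nn: "\<lfloor>real q * x\<rfloor> \<ge> 0" using x by simp
    have "real q * x < real q" using x assms by simp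
    then have "k < q" unfolding k_def using nn by (simp add: nat_less_iff floor_less_iff)
    moreover have "frac (real q * x) = - real k + real q * x" unfolding k_def frac_def using nn by simp
    then have "x \<in> P k" using x frac_lt_1[of "real q * x"] frac_ge_0[of "real q * x"] by (auto simp: P_def)
    ultimately show "x \<in> (\<Union>k<q. P k)" by auto
  next
    fix x assume "x \<in> (\<Union>k<q. P k)"
    then obtain k where k: "k < q" "x \<in> P k" by auto
    have "frac (real q * x) = - real k + real q * x" unfolding frac_def fl[OF k(2)] by simp
    moreover have nn: "0 \<le> real q * x" "real q * x < real q * 1"
    proof -
      show "0 \<le> real q * x" using k by (auto simp: P_def)
      have "real k + 1 \<le> real q" using k(1) by linarith
      moreover have "real q * x < real k + 1" using k by (auto simp: P_def)
      ultimately show "real q * x < real q * 1" by linarith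
    qed
    have "0 \<le> x" using nn(1) assms by (simp add: zero_le_mult_iff)
    moreover have "x < 1" using nn(2) assms by (subst (asm) mult_less_cancel_left_pos) auto
    ultimately show "x \<in> (\<lambda>x. frac (real q * x)) -` A \<inter> {0..<1}" using k by (auto simp: P_def)
  qed
  moreover have "disjoint_family_on P {..<q}"
    unfolding disjoint_family_on_def
  proof (intro ballI impI)
    fix m n :: nat assume "m \<noteq> n"
    then show "P m \<inter> P n = {}" using fl[of _ m] fl[of _ n] by force
  qed
  then have "emeasure lborel (\<Union>k<q. P k) = (\<Sum>k<q. emeasure lborel (P k))"
    using mP by (intro sum_emeasure[symmetric]) auto
  ultimately have eq: "emeasure lborel ((\<lambda>x. frac (real q * x)) -` A \<inter> {0..<1}) = (\<Sum>k<q. emeasure lborel (P k))"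
    by simp
  have "of_nat q * (\<Sum>k<q. emeasure lborel (P k)) = (\<Sum>k<q. emeasure lborel (A \<inter> {0..<1}))"
    unfolding sum_distrib_left
    by (rule sum.cong) (use assms emeasure_affine_vimage[of "real q" "A \<inter> {0..<1}" "- real k" for k] in
        \<open>simp_all add: P_def ennreal_of_nat_eq_real_of_nat\<close>)
  also have "\<dots> = of_nat q * emeasure lborel (A \<inter> {0..<1})" by simp
  finally show "emeasure lborel ((\<lambda>x. frac (real q * x)) -` A \<inter> {0..<1}) = emeasure lborel (A \<inter> {0..<1})"
    unfolding eq using assms by (subst (asm) ennreal_mult_cancel_left) auto
qed measurable


section \<open>The torus as a product of circles\<close>

definition square_measure :: "(real \<times> real) measure" where
  "square_measure = circle_measure \<Otimes>\<^sub>M circle_measure"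

lemma sets_square_measure [simp, measurable_cong]: "sets square_measure = sets borel"
proof -
  have "sets (circle_measure \<Otimes>\<^sub>M circle_measure) = sets (borel \<Otimes>\<^sub>M borel :: (real \<times> real) measure)"
    by (rule sets_pair_measure_cong) auto
  then show ?thesis unfolding square_measure_def by (simp only: borel_prod)
qed

lemma space_square_measure [simp]: "space square_measure = UNIV"
  by (simp add: square_measure_def space_pair_measure)

lemma square_measure_eq_density:
  "square_measure = density lborel (indicator ({0..<1} \<times> {0..<1}))"
proof -
  have "square_measure = density (lborel \<Otimes>\<^sub>M lborel) (\<lambda>(x, y). indicator {0..<1} x * indicator {0..<1} y)"
    unfolding square_measure_def circle_measure_def
    by (rule pair_measure_density)
      (use circle.sigma_finite_measure_axioms lborel.sigma_finite_measure_axioms in \<open>auto simp: circle_measure_def\<close>)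
  also have "\<dots> = density lborel (indicator ({0..<1} \<times> {0..<1}))"
    unfolding lborel_prod by (intro arg_cong2[of _ _ _ _ density] refl ext) (auto simp: indicator_def)
  finally show ?thesis .
qed

interpretation square: pair_sigma_finite circle_measure circle_measure ..

text \<open>By Fubini, since the map rotates each fibre.\<close>

lemma measure_preserving_skew:
  assumes \<rho>: "measure_preserving circle_measure circle_measure \<rho>"
    and [measurable]: "\<phi> \<in> borel_measurable borel"
  shows "measure_preserving square_measure square_measure (\<lambda>p. (\<rho> (fst p), frac (snd p + \<phi> (fst p))))"
    (is "measure_preserving _ _ ?s")
proof -
  have [measurable]: "\<rho> \<in> borel_measurable borel"
    using \<rho> by (simp add: measure_preserving_def measurable_cong_sets[OF sets_circle_measure sets_circle_measure])
  have ms [measurable]: "?s \<in> measurable square_measure square_measure"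
    unfolding measurable_cong_sets[OF sets_square_measure sets_square_measure] borel_prod[symmetric] by measurable
  have "emeasure (distr square_measure square_measure ?s) A = emeasure square_measure A"
    if "A \<in> sets borel" for A
  proof -
    have [measurable]: "A \<in> sets (borel \<Otimes>\<^sub>M borel)" using that by (simp only: borel_prod)
    then have [measurable]: "A \<in> sets square_measure" using that by simp
    have "emeasure (distr square_measure square_measure ?s) A = (\<integral>\<^sup>+ p. indicator A (?s p) \<partial>square_measure)"
    proof -
      have "emeasure (distr square_measure square_measure ?s) A = (\<integral>\<^sup>+ p. indicator A p \<partial>distr square_measure square_measure ?s)"
        by (rule nn_integral_indicator[symmetric]) (use that in simp)
      also have "\<dots> = (\<integral>\<^sup>+ p. indicator A (?s p) \<partial>square_measure)"
        by (rule nn_integral_distr) auto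
      finally show ?thesis .
    qed
    also have "\<dots> = (\<integral>\<^sup>+ x. \<integral>\<^sup>+ y. indicator A (\<rho> x, frac (y + \<phi> x)) \<partial>circle_measure \<partial>circle_measure)"
      unfolding square_measure_def by (subst circle.nn_integral_fst[symmetric]) auto
    also have "\<dots> = (\<integral>\<^sup>+ x. \<integral>\<^sup>+ y. indicator A (\<rho> x, y) \<partial>circle_measure \<partial>circle_measure)"
    proof (rule nn_integral_cong)
      fix x
      have mp: "(\<lambda>y. frac (y + \<phi> x)) \<in> measurable circle_measure circle_measure"
        "distr circle_measure circle_measure (\<lambda>y. frac (y + \<phi> x)) = circle_measure"
        using measure_preserving_shift[of "\<phi> x"] by (auto simp: measure_preserving_def)
      show "(\<integral>\<^sup>+ y. indicator A (\<rho> x, frac (y + \<phi> x)) \<partial>circle_measure) = (\<integral>\<^sup>+ y. indicator A (\<rho> x, y) \<partial>circle_measure)"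
        by (subst (2) mp(2)[symmetric]) (simp add: nn_integral_distr[OF mp(1)])
    qed
    also have "\<dots> = (\<integral>\<^sup>+ x. \<integral>\<^sup>+ y. indicator A (x, y) \<partial>circle_measure \<partial>circle_measure)"
    proof -
      have mp: "\<rho> \<in> measurable circle_measure circle_measure" "distr circle_measure circle_measure \<rho> = circle_measure"
        using \<rho> by (auto simp: measure_preserving_def)
      have "(\<lambda>x. \<integral>\<^sup>+ y. indicator A (x, y) \<partial>circle_measure) \<in> borel_measurable circle_measure"
        by (rule circle.borel_measurable_nn_integral_fst) simp
      then have "(\<integral>\<^sup>+ x. \<integral>\<^sup>+ y. indicator A (x, y) \<partial>circle_measure \<partial>distr circle_measure circle_measure \<rho>)
          = (\<integral>\<^sup>+ x. \<integral>\<^sup>+ y. indicator A (\<rho> x, y) \<partial>circle_measure \<partial>circle_measure)"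
        by (intro nn_integral_distr[OF mp(1)]) simp
      then show ?thesis unfolding mp(2) by simp
    qed
    also have "\<dots> = emeasure square_measure A"
      unfolding square_measure_def
      by (subst circle.nn_integral_fst) (use that in \<open>auto simp flip: square_measure_def intro!: nn_integral_indicator\<close>)
    finally show ?thesis .
  qed
  then have "distr square_measure square_measure ?s = square_measure" by (intro measure_eqI) auto
  with ms show ?thesis by (simp add: measure_preserving_def)
qed

lemma measure_preserving_completion:
  assumes "measure_preserving M N f"
  shows "measure_preserving (completion M) (completion N) f"
proof -
  have f: "f \<in> measurable M N" "distr M N f = N" using assms by (auto simp: measure_preserving_def)
  have f': "f \<in> measurable (completion M) N" by (rule measurable_completion[OF f(1)])
  have d: "distr (completion M) N f = N" using distr_completion[OF f(1)] f(2) by simp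
  have "f \<in> measurable (completion M) (completion N)"
    by (rule completion.measurable_completion2[OF f']) (simp add: d)
  moreover have "distr (completion M) (completion N) f = completion N"
    using completion.completion_distr_eq[OF f'] d by simp
  ultimately show ?thesis by (simp add: measure_preserving_def)
qed

text \<open>The measure of the torus is defined through Lebesgue measurable sets, whereas Fubini concerns the Borel
  sets of the product. Completing the product measure relates the two.\<close>

lemma unit_square_lebesgue_completion:
  shows "S \<in> sets (completion square_measure) \<longleftrightarrow> S \<inter> unit_square \<in> sets lebesgue" (is ?A)
    and "S \<in> sets (completion square_measure) \<Longrightarrow>
      emeasure (completion square_measure) S = emeasure lebesgue (S \<inter> unit_square)" (is "_ \<Longrightarrow> ?B")
proof -
  define U :: "(real \<times> real) set" where "U = {0..<1} \<times> {0..<1}"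
  have U [measurable]: "U \<in> sets borel" unfolding U_def by (simp add: borel_Times)
  have nullK: "N \<in> null_sets square_measure \<longleftrightarrow> N \<in> sets borel \<and> N \<inter> U \<in> null_sets lborel" for N
  proof -
    have "(AE x in lborel. x \<in> N \<longrightarrow> indicator U x = (0::ennreal)) \<longleftrightarrow> N \<inter> U \<in> null_sets lborel" if "N \<in> sets borel"
    proof -
      have "N \<inter> U \<in> sets lborel" using that by simp
      from AE_iff_null_sets[OF this] show ?thesis by (simp add: indicator_def)
    qed
    then show ?thesis
      unfolding square_measure_eq_density U_def[symmetric] by (subst null_sets_density_iff) auto
  qed
  have emK: "B \<in> sets borel \<Longrightarrow> emeasure square_measure B = emeasure lborel (B \<inter> U)" for B
    unfolding square_measure_eq_density U_def[symmetric]
    by (simp add: emeasure_density ac_simps flip: indicator_inter_arith)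
  have edge: "unit_square - U \<in> null_sets lebesgue"
  proof -
    have "negligible ({x :: real \<times> real. x \<bullet> (1, 0) = 1})" "negligible ({x :: real \<times> real. x \<bullet> (0, 1) = 1})"
      by (intro negligible_standard_hyperplane; simp add: Basis_prod_def)+
    then have "negligible ({x :: real \<times> real. x \<bullet> (1, 0) = 1} \<union> {x. x \<bullet> (0, 1) = 1})" by (rule negligible_Un)
    then have "negligible (unit_square - U)"
      by (rule negligible_subset) (auto simp: U_def unit_square_def)
    then show ?thesis by (simp add: negligible_iff_null_sets)
  qed
  have sub: "U \<subseteq> unit_square" by (auto simp: U_def unit_square_def)
  have fwd: "S \<inter> unit_square \<in> sets lebesgue \<and> emeasure (completion square_measure) S = emeasure lebesgue (S \<inter> unit_square)"
    if S: "S \<in> sets (completion square_measure)" for S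
  proof -
    obtain B N N' where BN: "S = B \<union> N" "N \<subseteq> N'" "N' \<in> null_sets square_measure" "B \<in> sets square_measure"
      using S unfolding sets_completion by auto
    have "emeasure (completion square_measure) S = emeasure (completion square_measure) B"
    proof (rule emeasure_eq_AE)
      have "AE x in completion square_measure. x \<notin> N'"
        using BN(3) by (intro AE_completion AE_not_in)
      then show "AE x in completion square_measure. x \<in> S \<longleftrightarrow> x \<in> B"
        by eventually_elim (use BN in auto)
    qed (use S BN in auto)
    also have "\<dots> = emeasure lborel (B \<inter> U)" using BN emK by simp
    also have "\<dots> = emeasure lebesgue (B \<inter> U)" using BN by simp
    finally have e: "emeasure (completion square_measure) S = emeasure lebesgue (B \<inter> U)" .
    define Z where "Z = (N' \<inter> U) \<union> (unit_square - U)"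
    have Z: "Z \<in> null_sets lebesgue"
      unfolding Z_def
    proof (rule null_sets.Un)
      show "N' \<inter> U \<in> null_sets lebesgue" using BN(3) nullK by (intro null_sets_completionI) auto
    qed (rule edge)
    have BU: "B \<inter> U \<in> sets lebesgue" using BN by simp
    have "S \<inter> unit_square - B \<inter> U \<subseteq> Z" using BN sub by (auto simp: Z_def)
    then have D: "S \<inter> unit_square - B \<inter> U \<in> null_sets lebesgue" using Z by (rule null_sets_completion_subset)
    have eqS: "S \<inter> unit_square = B \<inter> U \<union> (S \<inter> unit_square - B \<inter> U)" using BN sub by auto
    have "S \<inter> unit_square \<in> sets lebesgue" by (subst eqS) (rule sets.Un[OF BU null_setsD2[OF D]])
    moreover have "emeasure lebesgue (S \<inter> unit_square) = emeasure lebesgue (B \<inter> U)"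
      by (subst eqS) (rule emeasure_Un_null_set[OF BU D])
    ultimately show ?thesis using e by simp
  qed
  moreover have "S \<in> sets (completion square_measure)" if S: "S \<inter> unit_square \<in> sets lebesgue" for S
  proof -
    have "S \<inter> unit_square \<inter> U \<in> sets lebesgue" by (rule sets.Int[OF S]) simp
    then obtain B N N' where BN: "S \<inter> unit_square \<inter> U = B \<union> N" "N \<subseteq> N'" "N' \<in> null_sets lborel" "B \<in> sets lborel"
      unfolding sets_completion by auto
    have "N' \<union> - U \<in> null_sets square_measure"
      unfolding nullK using BN(3) by (auto simp: Int_Un_distrib2 intro: null_set_Int2)
    moreover have "S = B \<union> (N \<union> (S - U))" using BN(1) sub by auto
    moreover have "N \<union> (S - U) \<subseteq> N' \<union> - U" using BN by auto
    ultimately show ?thesis using BN(4) unfolding sets_completion by (intro CollectI exI conjI) auto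
  qed
  ultimately show ?A and "S \<in> sets (completion square_measure) \<Longrightarrow> ?B" by blast+
qed

lemma sets_torus_iff: "A \<in> sets torus_lebesgue \<longleftrightarrow> to_torus -` A \<in> sets (completion square_measure)"
  by (simp add: sets_torus_lebesgue unit_square_lebesgue_completion)

lemma emeasure_torus_eq:
  "A \<in> sets torus_lebesgue \<Longrightarrow> emeasure torus_lebesgue A = emeasure (completion square_measure) (to_torus -` A)"
  by (simp add: emeasure_torus_lebesgue unit_square_lebesgue_completion(2) sets_torus_iff del: emeasure_completion)

lemma measurable_to_torus: "to_torus \<in> measurable (completion square_measure) torus_lebesgue"
  by (rule measurableI) (auto simp: sets_torus_iff)

lemma distr_to_torus: "distr (completion square_measure) torus_lebesgue to_torus = torus_lebesgue"
  by (rule measure_eqI) (auto simp: emeasure_distr measurable_to_torus emeasure_torus_eq simp del: emeasure_completion)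

lemma AE_torus_iff: "(AE P in torus_lebesgue. Q P) \<longleftrightarrow> (AE p in square_measure. Q (to_torus p))"
proof
  assume "AE P in torus_lebesgue. Q P"
  then have "AE p in completion square_measure. Q (to_torus p)"
    by (subst (asm) distr_to_torus[symmetric]) (rule AE_distrD[OF measurable_to_torus])
  then show "AE p in square_measure. Q (to_torus p)" by (simp add: AE_completion_iff)
next
  assume "AE p in square_measure. Q (to_torus p)"
  then have "AE p in completion square_measure. Q (to_torus p)" by (rule AE_completion)
  then have n: "{p. \<not> Q (to_torus p)} \<in> null_sets (completion square_measure)"
    by (subst (asm) completion.AE_iff_null_sets) simp
  have v: "to_torus -` {P. \<not> Q P} = {p. \<not> Q (to_torus p)}" by auto
  have "{P. \<not> Q P} \<in> null_sets torus_lebesgue"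
    using n by (auto simp: null_sets_def sets_torus_iff emeasure_torus_eq v simp del: emeasure_completion)
  then show "AE P in torus_lebesgue. Q P" by (rule AE_I') auto
qed

lemma measure_preserving_torusI:
  assumes "measure_preserving square_measure square_measure \<sigma>" "\<And>p. to_torus (\<sigma> p) = T (to_torus p)"
  shows "measure_preserving torus_lebesgue torus_lebesgue T"
proof -
  have \<sigma>: "\<sigma> \<in> measurable (completion square_measure) (completion square_measure)"
    "distr (completion square_measure) (completion square_measure) \<sigma> = completion square_measure"
    using measure_preserving_completion[OF assms(1)] by (auto simp: measure_preserving_def)
  have v: "to_torus -` (T -` A) = \<sigma> -` (to_torus -` A)" for A
    by (simp add: vimage_def assms(2))
  have m: "T \<in> measurable torus_lebesgue torus_lebesgue"
    by (rule measurableI) (use measurable_sets[OF \<sigma>(1)] in \<open>auto simp: sets_torus_iff v\<close>)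
  have "distr torus_lebesgue torus_lebesgue T = torus_lebesgue"
  proof (rule measure_eqI)
    fix A assume "A \<in> sets (distr torus_lebesgue torus_lebesgue T)"
    then have A: "A \<in> sets torus_lebesgue" by simp
    then have TA: "T -` A \<in> sets torus_lebesgue" using measurable_sets[OF m, of A] by simp
    have "emeasure (distr torus_lebesgue torus_lebesgue T) A = emeasure torus_lebesgue (T -` A)"
      using m A by (simp add: emeasure_distr)
    also have "\<dots> = emeasure (completion square_measure) (\<sigma> -` (to_torus -` A))"
      by (simp add: emeasure_torus_eq TA v del: emeasure_completion)
    also have "\<dots> = emeasure (distr (completion square_measure) (completion square_measure) \<sigma>) (to_torus -` A)"
      using A by (simp add: emeasure_distr \<sigma>(1) sets_torus_iff del: emeasure_completion)
    also have "\<dots> = emeasure torus_lebesgue A" by (simp add: \<sigma>(2) emeasure_torus_eq A del: emeasure_completion)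
    finally show "emeasure (distr torus_lebesgue torus_lebesgue T) A = emeasure torus_lebesgue A" .
  qed simp
  with m show ?thesis by (simp add: measure_preserving_def)
qed

text \<open>A function on the torus is replaced by a Borel function to which Fubini applies.\<close>

lemma torus_function_borel_representative:
  fixes v :: "torus \<Rightarrow> complex"
  assumes "v \<in> borel_measurable torus_lebesgue" "\<And>P. norm (v P) \<le> 1"
  obtains V where "V \<in> borel_measurable borel" "\<And>p. norm (V p) \<le> 1" "AE p in square_measure. V p = v (to_torus p)"
proof -
  have m: "(\<lambda>p. v (to_torus p)) \<in> borel_measurable (completion square_measure)"
    by (rule measurable_compose[OF measurable_to_torus assms(1)])
  have re: "(\<lambda>p. Re (v (to_torus p))) \<in> borel_measurable (completion square_measure)"
    and im: "(\<lambda>p. Im (v (to_torus p))) \<in> borel_measurable (completion square_measure)"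
    by (rule measurable_compose[OF m], simp)+
  then obtain a b where a: "a \<in> borel_measurable square_measure" "AE p in square_measure. Re (v (to_torus p)) = a p"
    and b: "b \<in> borel_measurable square_measure" "AE p in square_measure. Im (v (to_torus p)) = b p"
    using completion_ex_borel_measurable_real[OF re] completion_ex_borel_measurable_real[OF im] by blast
  define V where "V p = (if norm (Complex (a p) (b p)) \<le> 1 then Complex (a p) (b p) else 0)" for p
  have [measurable]: "a \<in> borel_measurable borel" "b \<in> borel_measurable borel" using a b by auto
  have "(\<lambda>p. Complex (a p) (b p)) \<in> borel_measurable borel" unfolding Complex_eq by measurable
  then have "V \<in> borel_measurable borel" unfolding V_def by measurable
  moreover have "norm (V p) \<le> 1" for p by (simp add: V_def)
  moreover have "AE p in square_measure. V p = v (to_torus p)"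
    using a(2) b(2)
  proof eventually_elim
    case (elim p)
    then have "Complex (a p) (b p) = v (to_torus p)" by (simp add: complex_eq_iff)
    then show ?case using assms(2)[of "to_torus p"] by (simp add: V_def)
  qed
  ultimately show ?thesis using that by blast
qed


section \<open>Fourier coefficients on the circle\<close>

definition cis2pi :: "real \<Rightarrow> complex" where
  "cis2pi t = cis (2 * pi * t)"

lemma cis2pi_add: "cis2pi (x + y) = cis2pi x * cis2pi y"
  by (simp add: cis2pi_def cis_mult algebra_simps)

lemma norm_cis2pi [simp]: "norm (cis2pi x) = 1"
  by (simp add: cis2pi_def)

lemma cis2pi_0 [simp]: "cis2pi 0 = 1"
  by (simp add: cis2pi_def)

lemma cis2pi_nonzero [simp]: "cis2pi x \<noteq> 0"
  using norm_cis2pi[of x] by (metis norm_zero zero_neq_one)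

lemma cis2pi_minus: "cis2pi (- x) * cis2pi x = 1" "cis2pi x * cis2pi (- x) = 1"
  using cis2pi_add[of "- x" x] cis2pi_add[of x "- x"] by simp_all

lemma cis2pi_eq_1_iff: "cis2pi x = 1 \<longleftrightarrow> x \<in> \<int>"
proof -
  have "cis2pi x = 1 \<longleftrightarrow> cos (2 * pi * x) = 1"
    unfolding cis2pi_def by (auto simp: complex_eq_iff dest: cos_one_sin_zero)
  also have "\<dots> \<longleftrightarrow> (\<exists>n::int. 2 * pi * x = of_int n * 2 * pi)"
    using cos_one_2pi_int[of "2 * pi * x"] by (simp add: mult.commute mult.left_commute)
  also have "\<dots> \<longleftrightarrow> (\<exists>n::int. x = of_int n)" by (simp add: algebra_simps)
  finally show ?thesis by (auto simp: Ints_def)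
qed

lemma cis2pi_eqD: "cis2pi x = cis2pi y \<Longrightarrow> x - y \<in> \<int>"
  using cis2pi_add[of x "- y"] cis2pi_eq_1_iff[of "x - y"] by (simp add: cis2pi_minus)

lemma cis2pi_of_int [simp]: "cis2pi (of_int k) = 1"
  by (simp add: cis2pi_eq_1_iff)

lemma cis2pi_add_int [simp]: "cis2pi (x + of_int k) = cis2pi x"
  by (simp add: cis2pi_add)

lemma cis2pi_int_mult_frac: "cis2pi (of_int k * frac x) = cis2pi (of_int k * x)"
  using cis2pi_add_int[of "of_int k * x" "- (k * \<lfloor>x\<rfloor>)"] by (simp add: frac_def algebra_simps)

lemma cis2pi_frac [simp]: "cis2pi (frac x) = cis2pi x"
  using cis2pi_int_mult_frac[of 1 x] by simp

lemma continuous_on_cis2pi [continuous_intros]: "continuous_on S f \<Longrightarrow> continuous_on S (\<lambda>x. cis2pi (f x))"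
  unfolding cis2pi_def by (intro continuous_intros)

lemma measurable_cis2pi [measurable]: "cis2pi \<in> borel_measurable borel"
  by (intro borel_measurable_continuous_onI continuous_intros)

definition bounded_borel :: "(real \<Rightarrow> complex) \<Rightarrow> bool" where
  "bounded_borel w \<longleftrightarrow> w \<in> borel_measurable borel \<and> (\<exists>B. \<forall>x. norm (w x) \<le> B)"

lemma bounded_borel_measurable: "bounded_borel w \<Longrightarrow> w \<in> borel_measurable borel"
  by (simp add: bounded_borel_def)

lemma bounded_borel_mult: "bounded_borel v \<Longrightarrow> bounded_borel w \<Longrightarrow> bounded_borel (\<lambda>x. v x * w x)"
  unfolding bounded_borel_def
proof (elim conjE exE, intro conjI)
  fix A B assume "\<forall>x. norm (v x) \<le> A" "\<forall>x. norm (w x) \<le> B"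
  then have "\<forall>x. norm (v x * w x) \<le> A * B"
    by (auto simp: norm_mult intro!: mult_mono order_trans[OF norm_ge_zero])
  then show "\<exists>B. \<forall>x. norm (v x * w x) \<le> B" by blast
qed measurable

lemma bounded_borel_add: "bounded_borel v \<Longrightarrow> bounded_borel w \<Longrightarrow> bounded_borel (\<lambda>x. v x + w x)"
  unfolding bounded_borel_def
proof (elim conjE exE, intro conjI)
  fix A B assume "\<forall>x. norm (v x) \<le> A" "\<forall>x. norm (w x) \<le> B"
  then have "\<forall>x. norm (v x + w x) \<le> A + B" by (auto intro: norm_triangle_mono)
  then show "\<exists>B. \<forall>x. norm (v x + w x) \<le> B" by blast
qed measurable

lemma bounded_borel_const: "bounded_borel (\<lambda>x. c)"
  by (auto simp: bounded_borel_def)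

lemma bounded_borel_cis2pi: "f \<in> borel_measurable borel \<Longrightarrow> bounded_borel (\<lambda>x. cis2pi (f x))"
  by (auto simp: bounded_borel_def intro!: exI[of _ 1])

lemma bounded_borel_integrable: "bounded_borel w \<Longrightarrow> integrable circle_measure w"
  unfolding bounded_borel_def by (auto intro!: circle.integrable_const_bound AE_I2)

lemma bounded_borel_continuous_on_circle:
  fixes G :: "complex \<Rightarrow> real"
  assumes "continuous_on (sphere 0 1) G"
  shows "bounded_borel (\<lambda>x. complex_of_real (G (cis2pi x)))"
proof -
  have "continuous_on UNIV (\<lambda>x. G (cis2pi x))"
    by (rule continuous_on_compose2[OF assms]) (auto intro!: continuous_intros)
  then have "(\<lambda>x. complex_of_real (G (cis2pi x))) \<in> borel_measurable borel"
    by (intro borel_measurable_continuous_onI continuous_intros)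
  moreover have "bounded (G ` sphere 0 1)"
    by (intro compact_imp_bounded compact_continuous_image assms compact_sphere)
  then obtain B where "\<forall>z\<in>sphere 0 1. norm (G z) \<le> B" unfolding bounded_iff by auto
  then have "\<forall>x. norm (complex_of_real (G (cis2pi x))) \<le> B" by simp
  ultimately show ?thesis unfolding bounded_borel_def by blast
qed

definition fourier_coeff :: "(real \<Rightarrow> complex) \<Rightarrow> int \<Rightarrow> complex" where
  "fourier_coeff w k = (LINT x|circle_measure. w x * cis2pi (of_int k * x))"

lemma fourier_integrable: "bounded_borel w \<Longrightarrow> integrable circle_measure (\<lambda>x. w x * cis2pi (of_int k * x))"
  by (intro bounded_borel_integrable bounded_borel_mult bounded_borel_cis2pi) auto

text \<open>Multiplication by a linear function of \<open>cos\<close> and \<open>sin\<close> shifts Fourier coefficients, so the functions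
  all of whose Fourier coefficients vanish are closed under it; products follow by iteration.\<close>

lemma zero_coeffs_times_polynomial:
  assumes "real_polynomial_function p" "bounded_borel w" "\<And>k. fourier_coeff w k = 0"
  shows "fourier_coeff (\<lambda>x. w x * complex_of_real (p (cis2pi x))) k = 0"
  using assms
proof (induction p arbitrary: w k rule: real_polynomial_function.induct)
  case (linear f)
  interpret bounded_linear f by fact
  define A where "A = (complex_of_real (f 1) - \<i> * complex_of_real (f \<i>)) / 2"
  define B where "B = (complex_of_real (f 1) + \<i> * complex_of_real (f \<i>)) / 2"
  have f: "complex_of_real (f (cis2pi x)) = A * cis2pi x + B * cis2pi (- x)" for x
  proof -
    have "f (cis2pi x) = f (cos (2 * pi * x) *\<^sub>R 1 + sin (2 * pi * x) *\<^sub>R \<i>)"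
      by (rule arg_cong[of _ _ f]) (simp add: cis2pi_def complex_eq_iff)
    also have "\<dots> = cos (2 * pi * x) * f 1 + sin (2 * pi * x) * f \<i>" by (simp add: add scaleR)
    finally show ?thesis by (simp add: A_def B_def cis2pi_def complex_eq_iff algebra_simps add_divide_distrib diff_divide_distrib)
  qed
  have "w x * complex_of_real (f (cis2pi x)) * cis2pi (of_int k * x)
      = A * (w x * cis2pi (of_int (k + 1) * x)) + B * (w x * cis2pi (of_int (k - 1) * x))" for x
  proof -
    have "cis2pi (of_int (k + 1) * x) = cis2pi (of_int k * x) * cis2pi x"
      "cis2pi (of_int (k - 1) * x) = cis2pi (of_int k * x) * cis2pi (- x)"
      by (simp_all add: algebra_simps flip: cis2pi_add)
    then show ?thesis unfolding f by (simp add: algebra_simps)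
  qed
  then have "fourier_coeff (\<lambda>x. w x * complex_of_real (f (cis2pi x))) k
      = A * fourier_coeff w (k + 1) + B * fourier_coeff w (k - 1)"
    using fourier_integrable[OF linear.prems(1), of "k + 1"] fourier_integrable[OF linear.prems(1), of "k - 1"] unfolding fourier_coeff_def
    by (simp add: Bochner_Integration.integral_add)
  then show ?case using linear.prems(2) by simp
next
  case (const c)
  have "fourier_coeff (\<lambda>x. w x * complex_of_real c) k = complex_of_real c * fourier_coeff w k"
    unfolding fourier_coeff_def by (simp add: ac_simps flip: integral_mult_right_zero)
  then show ?case using const.prems by simp
next
  case (add f g)
  have bb: "bounded_borel (\<lambda>x. w x * complex_of_real (h (cis2pi x)))" if "real_polynomial_function h" for h
    using that add.prems(1) by (intro bounded_borel_mult bounded_borel_continuous_on_circle continuous_at_imp_continuous_on)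
      (auto intro: continuous_real_polymonial_function)
  have "fourier_coeff (\<lambda>x. w x * complex_of_real (f (cis2pi x) + g (cis2pi x))) k
     = fourier_coeff (\<lambda>x. w x * complex_of_real (f (cis2pi x))) k + fourier_coeff (\<lambda>x. w x * complex_of_real (g (cis2pi x))) k"
    using fourier_integrable[OF bb[OF add.hyps(1)], of k] fourier_integrable[OF bb[OF add.hyps(2)], of k]
    unfolding fourier_coeff_def by (simp add: algebra_simps flip: Bochner_Integration.integral_add)
  then show ?case using add.IH add.prems by simp
next
  case (mult f g)
  have bb: "bounded_borel (\<lambda>x. w x * complex_of_real (f (cis2pi x)))"
    using mult.hyps(1) mult.prems(1) by (intro bounded_borel_mult bounded_borel_continuous_on_circle continuous_at_imp_continuous_on)
      (auto intro: continuous_real_polymonial_function)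
  have "fourier_coeff (\<lambda>x. w x * complex_of_real (f (cis2pi x)) * complex_of_real (g (cis2pi x))) k = 0"
    by (rule mult.IH(2)[OF bb mult.IH(1)[OF mult.prems]])
  then show ?case by (simp add: mult.assoc)
qed

lemma measure_circle_UNIV [simp]: "measure circle_measure UNIV = 1"
  by (simp add: measure_def emeasure_circle_measure_UNIV)

lemma zero_coeffs_times_continuous:
  fixes G :: "complex \<Rightarrow> real"
  assumes w: "bounded_borel w" and zero: "\<And>k. fourier_coeff w k = 0" and G: "continuous_on (sphere 0 1) G"
  shows "(LINT x|circle_measure. w x * complex_of_real (G (cis2pi x))) = 0"
proof -
  obtain B where B: "\<And>x. norm (w x) \<le> B" using w unfolding bounded_borel_def by blast
  then have B0: "0 \<le> B" using order_trans[OF norm_ge_zero] by blast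
  let ?I = "LINT x|circle_measure. w x * complex_of_real (G (cis2pi x))"
  have "norm ?I \<le> B * e" if e: "e > 0" for e
  proof -
    obtain p where p: "real_polynomial_function p" "\<And>z. z \<in> sphere 0 1 \<Longrightarrow> \<bar>G z - p z\<bar> < e"
      using Stone_Weierstrass_real_polynomial_function[OF compact_sphere G e] by blast
    have pc: "continuous_on (sphere 0 1) p"
      using p(1) by (intro continuous_at_imp_continuous_on) (auto intro: continuous_real_polymonial_function)
    have i1: "integrable circle_measure (\<lambda>x. w x * complex_of_real (G (cis2pi x)))"
      and i2: "integrable circle_measure (\<lambda>x. w x * complex_of_real (p (cis2pi x)))"
      by (intro bounded_borel_integrable bounded_borel_mult w bounded_borel_continuous_on_circle G pc)+
    have "(LINT x|circle_measure. w x * complex_of_real (p (cis2pi x))) = 0"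
      using zero_coeffs_times_polynomial[OF p(1) w zero, of 0] by (simp add: fourier_coeff_def)
    then have "?I = (LINT x|circle_measure. w x * complex_of_real (G (cis2pi x)) - w x * complex_of_real (p (cis2pi x)))"
      using i1 i2 by (simp add: Bochner_Integration.integral_diff)
    also have "norm \<dots> \<le> (LINT x|circle_measure. norm (w x * complex_of_real (G (cis2pi x)) - w x * complex_of_real (p (cis2pi x))))"
      by (rule integral_norm_bound)
    also have "\<dots> \<le> (LINT x|circle_measure. B * e)"
    proof (rule integral_mono)
      show "integrable circle_measure (\<lambda>x. norm (w x * complex_of_real (G (cis2pi x)) - w x * complex_of_real (p (cis2pi x))))"
        using i1 i2 by auto
      fix x
      have "norm (w x * complex_of_real (G (cis2pi x)) - w x * complex_of_real (p (cis2pi x)))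
          = norm (w x) * \<bar>G (cis2pi x) - p (cis2pi x)\<bar>"
        by (metis norm_mult norm_of_real of_real_diff right_diff_distrib)
      also have "\<dots> \<le> B * e" using p(2)[of "cis2pi x"] B[of x] B0 by (intro mult_mono) auto
      finally show "norm (w x * complex_of_real (G (cis2pi x)) - w x * complex_of_real (p (cis2pi x))) \<le> B * e" .
    qed simp
    also have "\<dots> = B * e" by simp
    finally show ?thesis .
  qed
  note small = this
  show ?thesis
  proof (rule ccontr)
    assume "?I \<noteq> 0"
    define N where "N = norm ?I"
    have n: "N > 0" using \<open>?I \<noteq> 0\<close> by (simp add: N_def)
    have "N \<le> B * (N / (2 * (B + 1)))" unfolding N_def using B0 n by (intro small) (auto simp: N_def)
    also have "\<dots> = N * (B / (2 * (B + 1)))" by simp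
    also have "\<dots> < N * 1" using B0 n by (intro mult_strict_left_mono) (auto simp: field_simps)
    finally show False by simp
  qed
qed

text \<open>A closed arc is a closed subset of the unit circle of the complex plane, so its indicator is a limit of
  continuous functions. The endpoint \<open>1\<close> is excluded, since it represents the same point as \<open>0\<close>.\<close>

lemma zero_coeffs_interval:
  assumes w: "bounded_borel w" and zero: "\<And>k. fourier_coeff w k = 0" and ab: "0 \<le> a" "a \<le> b" "b < 1"
  shows "(LINT x|circle_measure. indicator {a..b} x *\<^sub>R w x) = 0"
proof -
  define A where "A = cis2pi ` {a..b}"
  have A: "closed A" "A \<noteq> {}"
    unfolding A_def using ab by (auto intro!: compact_imp_closed compact_continuous_image continuous_intros)
  define G where "G n z = max 0 (1 - real n * infdist z A)" for n z
  obtain B where B: "\<And>x. norm (w x) \<le> B" using w unfolding bounded_borel_def by blast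
  have mem: "cis2pi x \<in> A \<longleftrightarrow> x \<in> {a..b}" if "x \<in> {0..<1}" for x
  proof
    assume "cis2pi x \<in> A"
    then obtain y where y: "y \<in> {a..b}" "cis2pi x = cis2pi y" by (auto simp: A_def)
    then have "x - y \<in> \<int>" by (intro cis2pi_eqD)
    moreover have "\<bar>x - y\<bar> < 1" using that y(1) ab by auto
    ultimately have "x - y = 0" by (rule Ints_nonzero_abs_less1)
    then show "x \<in> {a..b}" using y by simp
  qed (auto simp: A_def)
  have "(\<lambda>n. LINT x|circle_measure. w x * complex_of_real (G n (cis2pi x))) \<longlonglongrightarrow>
      (LINT x|circle_measure. indicator {a..b} x *\<^sub>R w x)"
  proof (rule integral_dominated_convergence[where w = "\<lambda>x. B"])
    show "(\<lambda>x. indicator {a..b} x *\<^sub>R w x) \<in> borel_measurable circle_measure"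
      using bounded_borel_measurable[OF w] by simp
    show "(\<lambda>x. w x * complex_of_real (G n (cis2pi x))) \<in> borel_measurable circle_measure" for n
    proof -
      have "(\<lambda>x. complex_of_real (G n (cis2pi x))) \<in> borel_measurable borel"
        by (rule bounded_borel_measurable[OF bounded_borel_continuous_on_circle])
          (auto simp: G_def intro!: continuous_intros)
      with bounded_borel_measurable[OF w] have "(\<lambda>x. w x * complex_of_real (G n (cis2pi x))) \<in> borel_measurable borel"
        by (rule borel_measurable_times)
      then show ?thesis by simp
    qed
    show "AE x in circle_measure. norm (w x * complex_of_real (G n (cis2pi x))) \<le> B" for n
    proof (rule AE_I2)
      fix x
      have "norm (w x * complex_of_real (G n (cis2pi x))) \<le> norm (w x) * 1"
        unfolding norm_mult by (intro mult_left_mono) (auto simp: G_def infdist_nonneg)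
      then show "norm (w x * complex_of_real (G n (cis2pi x))) \<le> B" using B[of x] by simp
    qed
    show "AE x in circle_measure. (\<lambda>n. w x * complex_of_real (G n (cis2pi x))) \<longlonglongrightarrow> indicator {a..b} x *\<^sub>R w x"
      using AE_circle_unit
    proof eventually_elim
      case (elim x)
      show ?case
      proof (cases "x \<in> {a..b}")
        case True
        then have "G n (cis2pi x) = 1" for n using mem[OF elim] by (simp add: G_def)
        then show ?thesis using True by simp
      next
        case False
        then have "infdist (cis2pi x) A > 0"
          using mem[OF elim] A in_closed_iff_infdist_zero[OF A, of "cis2pi x"] infdist_nonneg[of "cis2pi x" A] by linarith
        then obtain m where m: "1 < real m * infdist (cis2pi x) A" using reals_Archimedean3 by blast
        have "\<forall>\<^sub>F n in sequentially. w x * complex_of_real (G n (cis2pi x)) = indicator {a..b} x *\<^sub>R w x"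
        proof (rule eventually_sequentiallyI[of m])
          fix n assume "m \<le> n"
          then have "real m * infdist (cis2pi x) A \<le> real n * infdist (cis2pi x) A"
            by (intro mult_right_mono) (auto simp: infdist_nonneg)
          then show "w x * complex_of_real (G n (cis2pi x)) = indicator {a..b} x *\<^sub>R w x"
            using m False by (simp add: G_def)
        qed
        then show ?thesis by (rule tendsto_eventually)
      qed
    qed
  qed simp
  moreover have "(LINT x|circle_measure. w x * complex_of_real (G n (cis2pi x))) = 0" for n
    by (rule zero_coeffs_times_continuous[OF w zero]) (auto simp: G_def intro!: continuous_intros)
  ultimately have "(\<lambda>n. 0) \<longlonglongrightarrow> (LINT x|circle_measure. indicator {a..b} x *\<^sub>R w x)" by simp
  from LIMSEQ_unique[OF this tendsto_const] show ?thesis .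
qed

text \<open>Completeness of the trigonometric system: intervals generate the Borel sets, so the integral over every
  Borel set vanishes.\<close>

lemma zero_coeffs_AE:
  assumes w: "bounded_borel w" and zero: "\<And>k. fourier_coeff w k = 0"
  shows "AE x in circle_measure. w x = 0"
proof (rule circle.density_zero)
  show int: "integrable circle_measure w" by (rule bounded_borel_integrable[OF w])
  have wm [measurable]: "w \<in> borel_measurable borel" by (rule bounded_borel_measurable[OF w])
  have total: "(LINT x|circle_measure. w x) = 0" using zero[of 0] by (simp add: fourier_coeff_def)
  have iA: "integrable circle_measure (\<lambda>x. indicator A x *\<^sub>R w x)" if "A \<in> sets borel" for A
    using that int by (intro integrable_mult_indicator) auto
  have compl_zero: "(LINT x|circle_measure. indicator (- A) x *\<^sub>R w x) = 0"
    if "A \<in> sets borel" "(LINT x|circle_measure. indicator A x *\<^sub>R w x) = 0" for A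
  proof -
    have "indicator (- A) x *\<^sub>R w x = w x - indicator A x *\<^sub>R w x" for x by (auto simp: indicator_def)
    then show ?thesis using that total int iA[OF that(1)] by simp
  qed
  fix A assume "A \<in> sets circle_measure"
  then have "A \<in> sets borel" by simp
  then show "set_lebesgue_integral circle_measure A w = 0"
    unfolding set_lebesgue_integral_def
  proof (induction A rule: borel_set_induct)
    case (interval a b)
    define a' where "a' = max a 0"
    have cong: "(LINT x|circle_measure. indicator A x *\<^sub>R w x) = (LINT x|circle_measure. indicator A' x *\<^sub>R w x)"
      if "AE x in circle_measure. x \<in> A \<longleftrightarrow> x \<in> A'" "A \<in> sets borel" "A' \<in> sets borel" for A A'
      using that by (intro integral_cong_AE) (auto simp: indicator_def)
    \<comment> \<open>An interval that meets \<open>{0..<1}\<close> up to its end is treated through its complement.\<close>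
    consider "b < 0 \<or> 1 \<le> a" | "a < 1" "0 \<le> b" "b < 1" | "a < 1" "1 \<le> b" using interval by linarith
    then show ?case
    proof cases
      case 1
      have "AE x in circle_measure. x \<in> {a..b} \<longleftrightarrow> x \<in> {}"
        using AE_circle_unit by eventually_elim (use 1 in auto)
      then show ?thesis by (subst cong[of _ "{}"]) auto
    next
      case 2
      have "AE x in circle_measure. x \<in> {a..b} \<longleftrightarrow> x \<in> {a'..b}"
        using AE_circle_unit by eventually_elim (auto simp: a'_def)
      then show ?thesis
        using 2 interval by (subst cong[of _ "{a'..b}"]) (auto intro!: zero_coeffs_interval[OF w zero] simp: a'_def)
    next
      case 3
      have "AE x in circle_measure. x \<noteq> a'"
        unfolding AE_circle_iff using AE_lborel_singleton[of a'] by eventually_elim auto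
      with AE_circle_unit have "AE x in circle_measure. x \<in> {a..b} \<longleftrightarrow> x \<in> - {0..a'}"
        by eventually_elim (use 3 in \<open>auto simp: a'_def\<close>)
      moreover have "(LINT x|circle_measure. indicator (- {0..a'}) x *\<^sub>R w x) = 0"
        by (rule compl_zero) (use 3 in \<open>auto intro!: zero_coeffs_interval[OF w zero] simp: a'_def\<close>)
      ultimately show ?thesis by (subst cong[of _ "- {0..a'}"]) auto
    qed
  next
    case (compl A)
    then show ?case by (intro compl_zero)
  next
    case (union f)
    have "(LINT x:(\<Union>i. f i)|circle_measure. w x) = (\<Sum>i. (LINT x:(f i)|circle_measure. w x))"
    proof (rule lebesgue_integral_countable_add)
      show "set_integrable circle_measure (\<Union>i. f i) w"
        unfolding set_integrable_def using union(2) by (intro iA) auto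
    qed (use union in \<open>auto simp: disjoint_family_on_def\<close>)
    then show ?case using union(3) by (simp add: set_lebesgue_integral_def)
  qed simp
qed


section \<open>Rotations of the circle\<close>

lemma integral_measure_preserving:
  fixes g :: "_ \<Rightarrow> _ :: {banach, second_countable_topology}"
  assumes "measure_preserving M N f" "g \<in> borel_measurable N"
  shows "(LINT x|M. g (f x)) = (LINT y|N. g y)"
  using assms integral_distr[of f M N g] by (simp add: measure_preserving_def)

lemma AE_measure_preserving:
  assumes "measure_preserving M N f" "AE y in N. P y"
  shows "AE x in M. P (f x)"
  using assms by (metis AE_distrD measure_preserving_def)

text \<open>Invariance of the integral under the rotation, applied to \<open>w x e (kx)\<close>.\<close>

lemma rotation_fourier_coeff:
  assumes w: "bounded_borel w" and eq: "AE x in circle_measure. w (frac (x + \<alpha>)) = \<mu> * w x"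
  shows "fourier_coeff w k = \<mu> * cis2pi (of_int k * \<alpha>) * fourier_coeff w k"
proof -
  have [measurable]: "w \<in> borel_measurable borel" by (rule bounded_borel_measurable[OF w])
  have "fourier_coeff w k = (LINT x|circle_measure. w (frac (x + \<alpha>)) * cis2pi (of_int k * frac (x + \<alpha>)))"
    unfolding fourier_coeff_def
    by (rule integral_measure_preserving[OF measure_preserving_shift, symmetric]) measurable
  also have "\<dots> = (LINT x|circle_measure. \<mu> * cis2pi (of_int k * \<alpha>) * (w x * cis2pi (of_int k * x)))"
  proof (rule integral_cong_AE)
    show "AE x in circle_measure. w (frac (x + \<alpha>)) * cis2pi (of_int k * frac (x + \<alpha>))
        = \<mu> * cis2pi (of_int k * \<alpha>) * (w x * cis2pi (of_int k * x))"
      using eq by eventually_elim (simp add: cis2pi_int_mult_frac distrib_left cis2pi_add)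
  qed measurable
  also have "\<dots> = \<mu> * cis2pi (of_int k * \<alpha>) * fourier_coeff w k"
    unfolding fourier_coeff_def by simp
  finally show ?thesis .
qed

lemma rotation_not_eigenvalue:
  assumes "bounded_borel w" "AE x in circle_measure. w (frac (x + \<alpha>)) = \<mu> * w x"
    and "\<And>k::int. \<mu> * cis2pi (of_int k * \<alpha>) \<noteq> 1"
  shows "AE x in circle_measure. w x = 0"
proof (rule zero_coeffs_AE[OF assms(1)])
  fix k
  have "fourier_coeff w k * (\<mu> * cis2pi (of_int k * \<alpha>) - 1) = 0"
    using rotation_fourier_coeff[OF assms(1,2), of k] by (simp add: algebra_simps)
  then show "fourier_coeff w k = 0" using assms(3)[of k] by simp
qed

lemma irrational_cis2pi: "\<alpha> \<notin> \<rat> \<Longrightarrow> k \<noteq> 0 \<Longrightarrow> cis2pi (of_int k * \<alpha>) \<noteq> 1"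
proof
  assume "\<alpha> \<notin> \<rat>" "k \<noteq> 0" "cis2pi (of_int k * \<alpha>) = 1"
  then obtain n :: int where "of_int k * \<alpha> = of_int n" unfolding cis2pi_eq_1_iff by (auto elim: Ints_cases)
  then have "\<alpha> = of_int n / of_int k" using \<open>k \<noteq> 0\<close> by (simp add: field_simps)
  then show False using \<open>\<alpha> \<notin> \<rat>\<close> by simp
qed

lemma rotation_ergodic:
  assumes irr: "\<alpha> \<notin> \<rat>" and w: "bounded_borel w"
    and eq: "AE x in circle_measure. w (frac (x + \<alpha>)) = w x"
  shows "AE x in circle_measure. w x = fourier_coeff w 0"
proof -
  let ?v = "\<lambda>x. w x + (- fourier_coeff w 0)"
  have v: "bounded_borel ?v" by (intro bounded_borel_add w bounded_borel_const)
  have eqv: "AE x in circle_measure. ?v (frac (x + \<alpha>)) = 1 * ?v x" using eq by eventually_elim simp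
  have "AE x in circle_measure. ?v x = 0"
  proof (rule zero_coeffs_AE[OF v])
    fix k
    show "fourier_coeff ?v k = 0"
    proof (cases "k = 0")
      case True
      have "fourier_coeff ?v 0 = fourier_coeff w 0 + (LINT x|circle_measure. - fourier_coeff w 0)"
        unfolding fourier_coeff_def using bounded_borel_integrable[OF w]
        by (simp add: Bochner_Integration.integral_diff)
      then show ?thesis using True by simp
    next
      case False
      have "fourier_coeff ?v k * (cis2pi (of_int k * \<alpha>) - 1) = 0"
        using rotation_fourier_coeff[OF v eqv, of k] by (simp add: algebra_simps)
      then show ?thesis using irrational_cis2pi[OF irr False] by simp
    qed
  qed
  then show ?thesis by eventually_elim simp
qed

text \<open>Translation is continuous in mean. Being measurable, \<open>w\<close> is a limit of continuous functions almost
  everywhere; projecting these to a ball makes the convergence dominated, and for a continuous function the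
  claim is pointwise.\<close>

lemma translation_L1_continuous:
  assumes w: "bounded_borel w" and c: "\<And>j. c j = of_int (z j) + \<delta> j" "\<delta> \<longlonglongrightarrow> 0"
  shows "(\<lambda>j. LINT x|circle_measure. norm (w (frac (x + c j)) - w x)) \<longlonglongrightarrow> 0"
proof -
  obtain B where B: "\<And>x. norm (w x) \<le> B" using w unfolding bounded_borel_def by blast
  then have B0: "0 \<le> B" using order_trans[OF norm_ge_zero] by blast
  have [measurable]: "w \<in> borel_measurable borel" by (rule bounded_borel_measurable[OF w])
  have "w measurable_on UNIV"
    by (rule lebesgue_measurable_imp_measurable_on) (auto intro: measurable_completion)
  then obtain N g where N: "negligible N" and g: "\<And>n. continuous_on UNIV (g n)"
    and lim: "\<And>x. x \<notin> N \<Longrightarrow> (\<lambda>n. g n x) \<longlonglongrightarrow> w x"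
    unfolding measurable_on_def by auto
  define h where "h n x = closest_point (cball 0 B) (g n x)" for n x
  have cb: "convex (cball (0::complex) B)" "closed (cball (0::complex) B)" "cball (0::complex) B \<noteq> {}"
    using B0 by auto
  have hc: "continuous_on UNIV (h n)" for n
    unfolding h_def by (rule continuous_on_compose2[OF continuous_on_closest_point[OF cb] g]) auto
  then have [measurable]: "h n \<in> borel_measurable borel" for n by (rule borel_measurable_continuous_onI)
  have hB: "norm (h n x) \<le> B" for n x
    using closest_point_in_set[OF cb(2,3), of "g n x"] by (simp add: h_def)
  have hlim: "AE x in circle_measure. (\<lambda>n. h n x) \<longlonglongrightarrow> w x"
  proof -
    have "AE x in lebesgue. x \<notin> N" using N by (simp add: negligible_iff_null_sets AE_not_in)
    then have "AE x in lborel. x \<notin> N" by (simp add: AE_completion_iff)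
    then have "AE x in circle_measure. x \<notin> N" unfolding AE_circle_iff by eventually_elim simp
    then show ?thesis
    proof eventually_elim
      case (elim x)
      have "(\<lambda>n. closest_point (cball 0 B) (g n x)) \<longlonglongrightarrow> closest_point (cball 0 B) (w x)"
        by (rule isCont_tendsto_compose[OF continuous_at_closest_point[OF cb] lim[OF elim]])
      moreover have "closest_point (cball 0 B) (w x) = w x" using B[of x] by (intro closest_point_self) simp
      ultimately show ?case by (simp add: h_def)
    qed
  qed
  have approx: "(\<lambda>n. LINT x|circle_measure. norm (w x - h n x)) \<longlonglongrightarrow> (LINT x|circle_measure. norm (w x - w x))"
  proof (rule integral_dominated_convergence[where w = "\<lambda>x. 2 * B"])
    show "AE x in circle_measure. (\<lambda>n. norm (w x - h n x)) \<longlonglongrightarrow> norm (w x - w x)"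
      using hlim by eventually_elim (intro tendsto_intros)
    show "AE x in circle_measure. norm (norm (w x - h n x)) \<le> 2 * B" for n
    proof (rule AE_I2)
      fix x show "norm (norm (w x - h n x)) \<le> 2 * B"
        using norm_triangle_ineq4[of "w x" "h n x"] B[of x] hB[of n x] by simp
    qed
  qed auto
  have move: "(\<lambda>j. LINT x|circle_measure. norm (h n (frac (x + c j)) - h n x)) \<longlonglongrightarrow> (LINT x|circle_measure. norm (h n x - h n x))" for n
  proof (rule integral_dominated_convergence[where w = "\<lambda>x. 2 * B"])
    have "AE x in circle_measure. x \<noteq> 0"
      unfolding AE_circle_iff using AE_lborel_singleton[of 0] by eventually_elim auto
    with AE_circle_unit show "AE x in circle_measure. (\<lambda>j. norm (h n (frac (x + c j)) - h n x)) \<longlonglongrightarrow> norm (h n x - h n x)"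
    proof eventually_elim
      case (elim x)
      \<comment> \<open>Away from \<open>0\<close>, a small translation does not wrap around.\<close>
      then have x: "0 < x" "x < 1" by auto
      have "(\<lambda>j. x + \<delta> j) \<longlonglongrightarrow> x + 0" by (intro tendsto_intros c)
      then have l: "(\<lambda>j. x + \<delta> j) \<longlonglongrightarrow> x" by simp
      have "\<forall>\<^sub>F j in sequentially. frac (x + c j) = x + \<delta> j"
        using order_tendstoD(1)[OF l x(1)] order_tendstoD(2)[OF l x(2)]
      proof eventually_elim
        case (elim j)
        have "frac (x + c j) = frac (x + \<delta> j)" using frac_eq_if[of "x + \<delta> j" "z j"] by (simp add: c ac_simps)
        then show ?case using elim by (simp add: frac_eq)
      qed
      then have "(\<lambda>j. frac (x + c j)) \<longlonglongrightarrow> x" using l by (simp cong: tendsto_cong)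
      then have "(\<lambda>j. h n (frac (x + c j))) \<longlonglongrightarrow> h n x"
        using hc[of n] by (intro isCont_tendsto_compose[of x "h n"]) (auto simp: continuous_on_eq_continuous_at)
      then show ?case by (intro tendsto_intros)
    qed
    show "AE x in circle_measure. norm (norm (h n (frac (x + c j)) - h n x)) \<le> 2 * B" for j
    proof (rule AE_I2)
      fix x show "norm (norm (h n (frac (x + c j)) - h n x)) \<le> 2 * B"
        using norm_triangle_ineq4[of "h n (frac (x + c j))" "h n x"] hB[of n x] hB[of n "frac (x + c j)"] by simp
    qed
  qed auto
  have int: "integrable circle_measure (\<lambda>x. norm (u x - v x))"
    if "u \<in> borel_measurable borel" "v \<in> borel_measurable borel" "\<And>x. norm (u x) \<le> B" "\<And>x. norm (v x) \<le> B" for u v :: "real \<Rightarrow> complex"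
  proof (rule circle.integrable_const_bound[where B = "2 * B"])
    show "AE x in circle_measure. norm (norm (u x - v x)) \<le> 2 * B"
    proof (rule AE_I2)
      fix x show "norm (norm (u x - v x)) \<le> 2 * B"
        using norm_triangle_ineq4[of "u x" "v x"] that(3,4)[of x] by simp
    qed
  qed (use that in auto)
  show ?thesis
  proof (rule tendstoI)
    fix e :: real assume e: "e > 0"
    have "\<forall>\<^sub>F n in sequentially. (LINT x|circle_measure. norm (w x - h n x)) < e / 3"
      using order_tendstoD(2)[OF approx, of "e / 3"] e by simp
    then obtain n where n: "(LINT x|circle_measure. norm (w x - h n x)) < e / 3"
      using eventually_sequentially by auto
    have "\<forall>\<^sub>F j in sequentially. (LINT x|circle_measure. norm (h n (frac (x + c j)) - h n x)) < e / 3"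
      using order_tendstoD(2)[OF move[of n], of "e / 3"] e by simp
    then show "\<forall>\<^sub>F j in sequentially. dist (LINT x|circle_measure. norm (w (frac (x + c j)) - w x)) 0 < e"
    proof eventually_elim
      case (elim j)
      have i1: "integrable circle_measure (\<lambda>x. norm (w (frac (x + c j)) - h n (frac (x + c j))))"
        and i2: "integrable circle_measure (\<lambda>x. norm (h n (frac (x + c j)) - h n x))"
        and i3: "integrable circle_measure (\<lambda>x. norm (w x - h n x))"
        and i4: "integrable circle_measure (\<lambda>x. norm (w (frac (x + c j)) - w x))"
        by (rule int; simp add: B hB)+
      have sh: "(LINT x|circle_measure. norm (w (frac (x + c j)) - h n (frac (x + c j)))) = (LINT x|circle_measure. norm (w x - h n x))"
        by (rule integral_measure_preserving[OF measure_preserving_shift]) measurable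
      have "(LINT x|circle_measure. norm (w (frac (x + c j)) - w x))
          \<le> (LINT x|circle_measure. norm (w (frac (x + c j)) - h n (frac (x + c j))) + norm (h n (frac (x + c j)) - h n x) + norm (w x - h n x))"
      proof (rule integral_mono)
        fix x
        have "w (frac (x + c j)) - w x = (w (frac (x + c j)) - h n (frac (x + c j))) + (h n (frac (x + c j)) - h n x) + (h n x - w x)"
          by simp
        then show "norm (w (frac (x + c j)) - w x)
          \<le> norm (w (frac (x + c j)) - h n (frac (x + c j))) + norm (h n (frac (x + c j)) - h n x) + norm (w x - h n x)"
          using norm_triangle_ineq[of "(w (frac (x + c j)) - h n (frac (x + c j))) + (h n (frac (x + c j)) - h n x)" "h n x - w x"]
            norm_triangle_ineq[of "w (frac (x + c j)) - h n (frac (x + c j))" "h n (frac (x + c j)) - h n x"]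
          by (simp add: norm_minus_commute)
      qed (use i1 i2 i3 i4 in auto)
      also have "\<dots> = (LINT x|circle_measure. norm (w x - h n x)) + (LINT x|circle_measure. norm (h n (frac (x + c j)) - h n x))
          + (LINT x|circle_measure. norm (w x - h n x))"
        using i1 i2 i3 sh by simp
      also have "\<dots> < e" using n elim by linarith
      finally have "(LINT x|circle_measure. norm (w (frac (x + c j)) - w x)) < e" .
      moreover have "0 \<le> (LINT x|circle_measure. norm (w (frac (x + c j)) - w x))" by simp
      ultimately show ?case by simp
    qed
  qed
qed

lemma cocycle_iterate:
  assumes per: "\<And>x. cis2pi (\<Phi> (frac x)) = cis2pi (\<Phi> x)"
    and eq: "AE x in circle_measure. w (frac (x + \<alpha>)) = cis2pi (\<Phi> x) * w x"
  shows "AE x in circle_measure. w (frac (x + real n * \<alpha>)) = cis2pi (\<Sum>i<n. \<Phi> (x + real i * \<alpha>)) * w x"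
proof (induction n)
  case 0
  show ?case using AE_circle_unit by eventually_elim (simp add: frac_eq)
next
  case (Suc n)
  have "AE x in circle_measure. w (frac (frac (x + real n * \<alpha>) + \<alpha>)) = cis2pi (\<Phi> (frac (x + real n * \<alpha>))) * w (frac (x + real n * \<alpha>))"
    by (rule AE_measure_preserving[OF measure_preserving_shift eq])
  with Suc show ?case
  proof eventually_elim
    case (elim x)
    have "frac (x + real (Suc n) * \<alpha>) = frac (frac (x + real n * \<alpha>) + \<alpha>)"
      by (simp add: algebra_simps)
    then show ?case using elim by (simp add: per cis2pi_add)
  qed
qed

text \<open>The modulus of \<open>w\<close> is invariant under the rotation, hence constant, so \<open>w\<close> can be divided out. Iterating
  the equation expresses the exponential of a Birkhoff sum as the quotient of a translate of \<open>w\<close> and \<open>w\<close>,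
  and at the times \<open>t j\<close> the translation tends to the identity.\<close>

lemma cocycle_rigidity:
  assumes irr: "\<alpha> \<notin> \<rat>" and w: "bounded_borel w" and [measurable]: "\<Phi> \<in> borel_measurable borel"
    and per: "\<And>x. cis2pi (\<Phi> (frac x)) = cis2pi (\<Phi> x)"
    and eq: "AE x in circle_measure. w (frac (x + \<alpha>)) = cis2pi (\<Phi> x) * w x"
    and t: "\<And>j. real (t j) * \<alpha> = of_int (z j) + \<delta> j" "\<delta> \<longlonglongrightarrow> 0"
    and nz: "\<not> (AE x in circle_measure. w x = 0)"
  shows "(\<lambda>j. LINT x|circle_measure. norm (cis2pi (\<Sum>i<t j. \<Phi> (x + real i * \<alpha>)) - 1)) \<longlonglongrightarrow> 0"
proof -
  have wm [measurable]: "w \<in> borel_measurable borel" by (rule bounded_borel_measurable[OF w])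
  have "bounded_borel (\<lambda>x. complex_of_real (norm (w x)))"
    using w unfolding bounded_borel_def by auto
  moreover have "AE x in circle_measure. complex_of_real (norm (w (frac (x + \<alpha>)))) = complex_of_real (norm (w x))"
    using eq by eventually_elim (simp add: norm_mult)
  ultimately have "AE x in circle_measure. complex_of_real (norm (w x)) = fourier_coeff (\<lambda>x. complex_of_real (norm (w x))) 0"
    by (rule rotation_ergodic[OF irr])
  then have C: "AE x in circle_measure. norm (w x) = C" if "C = Re (fourier_coeff (\<lambda>x. complex_of_real (norm (w x))) 0)" for C
    by eventually_elim (metis Re_complex_of_real that)
  define C where "C = Re (fourier_coeff (\<lambda>x. complex_of_real (norm (w x))) 0)"
  note C = C[OF C_def]
  have Cpos: "C > 0"
  proof (rule ccontr)
    assume "\<not> C > 0"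
    then have "AE x in circle_measure. w x = 0"
      using C by (auto elim!: eventually_mono simp flip: norm_le_zero_iff)
    then show False using nz by simp
  qed
  have "(LINT x|circle_measure. norm (w (frac (x + real (t j) * \<alpha>)) - w x))
      = C * (LINT x|circle_measure. norm (cis2pi (\<Sum>i<t j. \<Phi> (x + real i * \<alpha>)) - 1))" for j
  proof -
    have "(LINT x|circle_measure. norm (w (frac (x + real (t j) * \<alpha>)) - w x))
      = (LINT x|circle_measure. C * norm (cis2pi (\<Sum>i<t j. \<Phi> (x + real i * \<alpha>)) - 1))"
    proof (rule integral_cong_AE)
      show "AE x in circle_measure. norm (w (frac (x + real (t j) * \<alpha>)) - w x) = C * norm (cis2pi (\<Sum>i<t j. \<Phi> (x + real i * \<alpha>)) - 1)"
        using cocycle_iterate[OF per eq, of "t j"] C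
      proof eventually_elim
        case (elim x)
        have "w (frac (x + real (t j) * \<alpha>)) - w x = (cis2pi (\<Sum>i<t j. \<Phi> (x + real i * \<alpha>)) - 1) * w x"
          using elim by (simp add: algebra_simps)
        then show ?case using elim(2) by (simp add: norm_mult)
      qed
    qed measurable
    then show ?thesis by simp
  qed
  moreover have "(\<lambda>j. LINT x|circle_measure. norm (w (frac (x + real (t j) * \<alpha>)) - w x)) \<longlonglongrightarrow> 0"
    by (rule translation_L1_continuous[OF w t])
  ultimately have "(\<lambda>j. C * (LINT x|circle_measure. norm (cis2pi (\<Sum>i<t j. \<Phi> (x + real i * \<alpha>)) - 1))) \<longlonglongrightarrow> 0"
    by simp
  then have "(\<lambda>j. inverse C * (C * (LINT x|circle_measure. norm (cis2pi (\<Sum>i<t j. \<Phi> (x + real i * \<alpha>)) - 1)))) \<longlonglongrightarrow> inverse C * 0"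
    by (intro tendsto_intros)
  then show ?thesis using Cpos by (simp add: mult.assoc[symmetric])
qed


section \<open>A Liouville rotation and a lacunary cocycle\<close>

text \<open>The binary exponents of the frequencies. What matters is that \<open>lac (j + 1)\<close> exceeds \<open>2 j lac j\<close> by an
  unbounded amount.\<close>

definition lac :: "nat \<Rightarrow> nat" where
  "lac j = 2 ^ ((j + 1)\<^sup>2)"

lemma lac_pos: "lac j > 0" by (simp add: lac_def)

lemma lac_Suc: "lac (Suc j) = 2 ^ (2 * j + 3) * lac j"
proof -
  have "(Suc j + 1)\<^sup>2 = (2 * j + 3) + (j + 1)\<^sup>2" by (simp add: power2_eq_square algebra_simps)
  then show ?thesis unfolding lac_def by (simp add: power_add)
qed

lemma lac_growth: "(2 * j + 1) * lac j + lac j + j + 1 \<le> lac (Suc j)"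
proof -
  have "2 * j + 4 \<le> 2 ^ (2 * j + 3)" using less_exp[of "2 * j + 3"] by linarith
  then have "(2 * j + 4) * lac j \<le> lac (Suc j)" unfolding lac_Suc by (rule mult_right_mono) simp
  moreover have "j + 1 \<le> lac j"
  proof -
    have "j + 1 < 2 ^ (j + 1)" by (rule less_exp)
    also have "\<dots> \<le> lac j" unfolding lac_def by (intro power_increasing) (auto simp: power2_eq_square)
    finally show ?thesis by simp
  qed
  ultimately show ?thesis by (simp add: algebra_simps)
qed

lemma lac_less_Suc: "lac j + 2 \<le> lac (Suc j)"
proof -
  have "lac j \<ge> 1" using lac_pos[of j] by simp
  moreover have "(2 * j + 1) * lac j \<ge> 1 * lac j" by (intro mult_right_mono) auto
  ultimately show ?thesis using lac_growth[of j] by linarith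
qed

lemma lac_less: "i < j \<Longrightarrow> lac i + 2 \<le> lac j"
proof (induction j)
  case (Suc j)
  then show ?case using lac_less_Suc[of j] by (cases "i = j") auto
qed simp

lemma lac_mono: "i \<le> j \<Longrightarrow> lac i \<le> lac j"
  using lac_less[of i j] by (cases "i = j") auto

lemma lac_ge: "j + 1 \<le> lac j"
proof (induction j)
  case (Suc j) then show ?case using lac_less_Suc[of j] by simp
qed (simp add: lac_def)

definition liouville :: real where
  "liouville = (\<Sum>j. 1 / 2 ^ lac j)"

definition liouville_tail :: "nat \<Rightarrow> real" where
  "liouville_tail j = (\<Sum>i. 1 / 2 ^ lac (i + Suc j))"

lemma summable_half_powers:
  assumes "\<And>i. e i \<ge> i + k"
  shows "summable (\<lambda>i. 1 / 2 ^ e i :: real)" "(\<Sum>i. 1 / 2 ^ e i :: real) \<le> 2 / 2 ^ k"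
proof -
  have le: "norm (1 / 2 ^ e i :: real) \<le> (1 / 2) ^ i * (1 / 2 ^ k)" for i
  proof -
    have "(2::real) ^ (i + k) \<le> 2 ^ e i" using assms by (intro power_increasing) auto
    then have "1 / (2::real) ^ e i \<le> 1 / 2 ^ (i + k)" by (intro frac_le) auto
    then show ?thesis by (simp add: power_add power_divide)
  qed
  have s: "summable (\<lambda>i. (1 / 2) ^ i * (1 / 2 ^ k) :: real)"
    by (intro summable_mult2 summable_geometric) simp
  show sm: "summable (\<lambda>i. 1 / 2 ^ e i :: real)"
    by (rule summable_comparison_test'[OF s]) (use le in auto)
  have "(\<Sum>i. 1 / 2 ^ e i :: real) \<le> (\<Sum>i. (1 / 2) ^ i * (1 / 2 ^ k))"
    by (rule suminf_le[OF _ sm s]) (use le in auto)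
  also have "\<dots> = 2 / 2 ^ k"
    by (subst suminf_mult2[symmetric]) (auto simp: suminf_geometric intro: summable_geometric)
  finally show "(\<Sum>i. 1 / 2 ^ e i :: real) \<le> 2 / 2 ^ k" .
qed

lemma lac_shift: "lac (i + j) \<ge> i + lac j"
proof (induction i)
  case (Suc i) then show ?case using lac_less_Suc[of "i + j"] by simp
qed simp

lemma summable_liouville: "summable (\<lambda>j. 1 / 2 ^ lac j :: real)"
proof (rule summable_half_powers(1)[where k = 0])
  show "i + 0 \<le> lac i" for i using lac_ge[of i] by simp
qed

lemma liouville_split: "liouville = (\<Sum>i<k. 1 / 2 ^ lac i) + (\<Sum>i. 1 / 2 ^ lac (i + k))"
  unfolding liouville_def using suminf_split_initial_segment[OF summable_liouville, of k] by simp

lemma liouville_tail_le: "liouville_tail j \<le> 2 / 2 ^ lac (Suc j)"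
  unfolding liouville_tail_def by (rule summable_half_powers(2)) (rule lac_shift)

lemma liouville_tail_pos: "liouville_tail j > 0"
  unfolding liouville_tail_def
  by (rule suminf_pos[OF summable_half_powers(1)[OF lac_shift]]) simp

definition liouville_numerator :: "nat \<Rightarrow> nat" where
  "liouville_numerator j = (\<Sum>i\<le>j. 2 ^ (lac j - lac i))"

lemma odd_liouville_numerator: "odd (liouville_numerator j)"
proof -
  have "liouville_numerator j = (\<Sum>i<j. 2 ^ (lac j - lac i)) + 1"
    unfolding liouville_numerator_def by (simp add: lessThan_Suc_atMost[symmetric])
  moreover have "even (\<Sum>i<j. 2 ^ (lac j - lac i) :: nat)"
    by (intro dvd_sum) (use lac_less in fastforce)
  ultimately show ?thesis by simp
qed

lemma liouville_eq: "liouville = real (liouville_numerator j) / 2 ^ lac j + liouville_tail j"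
proof -
  have "(\<Sum>i<Suc j. 1 / 2 ^ lac i :: real) = real (liouville_numerator j) / 2 ^ lac j"
    unfolding liouville_numerator_def lessThan_Suc_atMost of_nat_sum sum_divide_distrib
  proof (rule sum.cong)
    fix i assume "i \<in> {..j}"
    then have "(2::real) ^ (lac j - lac i) = 2 ^ lac j / 2 ^ lac i" by (intro power_diff lac_mono) auto
    then show "1 / 2 ^ lac i = real (2 ^ (lac j - lac i)) / 2 ^ lac j" by simp
  qed simp
  then show ?thesis using liouville_split[of "Suc j"] by (simp add: liouville_tail_def)
qed

text \<open>Multiplied by \<open>2 ^ lac j\<close>, the number exceeds an integer by a positive amount that tends to \<open>0\<close>.\<close>

lemma liouville_irrational: "liouville \<notin> \<rat>"
proof
  assume "liouville \<in> \<rat>"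
  then obtain m b :: nat where "b \<noteq> 0" "\<bar>liouville\<bar> = real m / real b" by (rule Rats_abs_nat_div_natE)
  moreover have "liouville \<ge> 0" unfolding liouville_def by (intro suminf_nonneg summable_liouville) simp
  moreover define a where "a = int m"
  ultimately have b: "b \<noteq> 0" "liouville = of_int a / real b" by auto
  define j where "j = 2 * b"
  define x where "x = real b * 2 ^ lac j * liouville_tail j"
  have "x = of_int (a * 2 ^ lac j - int b * int (liouville_numerator j))"
  proof -
    have tail: "liouville_tail j = of_int a / real b - real (liouville_numerator j) / 2 ^ lac j"
      using liouville_eq[of j] b(2) by linarith
    show ?thesis unfolding x_def tail using b(1) by (simp add: field_simps)
  qed
  moreover have "x > 0" unfolding x_def using b liouville_tail_pos by simp
  moreover have "x < 1"
  proof -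
    have "x \<le> real b * 2 ^ lac j * (2 / 2 ^ lac (Suc j))"
      unfolding x_def by (intro mult_left_mono liouville_tail_le) auto
    also have "\<dots> \<le> real b * 2 ^ lac j * (2 / 2 ^ (lac j + (j + 1)))"
      by (intro mult_left_mono divide_left_mono power_increasing) (use lac_growth[of j] in auto)
    also have "\<dots> = real b / 2 ^ j" by (simp add: power_add)
    also have "\<dots> < 1"
    proof -
      have "b < 2 ^ j" unfolding j_def using less_exp[of "2 * b"] by linarith
      then show ?thesis using of_nat_less_iff[of b "2 ^ j", where 'a = real] by simp
    qed
    finally show ?thesis .
  qed
  ultimately have "0 < (a * 2 ^ lac j - int b * int (liouville_numerator j))" "(a * 2 ^ lac j - int b * int (liouville_numerator j)) < 1"
    by (metis of_int_0_less_iff, metis of_int_less_1_iff)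
  then show False by simp
qed


text \<open>Up to the factor \<open>(2\<pi>) ^ r\<close>, this is the derivative of order \<open>r\<close> of
  \<open>sin (2\<pi>x) + sin (4\<pi>x) + \<beta> cos (4\<pi>x)\<close>. That function is odd for \<open>\<beta> = 0\<close>, and for \<open>\<beta> = 1\<close> its graph
  has neither a vertical axis nor a centre of symmetry.\<close>

definition osc :: "nat \<Rightarrow> real \<Rightarrow> real \<Rightarrow> real" where
  "osc r \<beta> x = sin (2 * pi * x + real r * (pi / 2)) + 2 ^ r * sin (4 * pi * x + real r * (pi / 2))
     + \<beta> * (2 ^ r * cos (4 * pi * x + real r * (pi / 2)))"

lemma osc_bound:
  assumes "0 \<le> \<beta>" "\<beta> \<le> 1" shows "\<bar>osc r \<beta> x\<bar> \<le> 3 * 2 ^ r"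
proof -
  have "\<bar>sin (2 * pi * x + real r * (pi / 2))\<bar> \<le> 1 * 2 ^ r"
    using abs_sin_le_one[of "2 * pi * x + real r * (pi / 2)"] one_le_power[of "2::real" r] by linarith
  moreover have "\<bar>2 ^ r * sin (4 * pi * x + real r * (pi / 2))\<bar> \<le> 2 ^ r * 1"
    unfolding abs_mult by (intro mult_mono) auto
  moreover have "\<bar>\<beta> * (2 ^ r * cos (4 * pi * x + real r * (pi / 2)))\<bar> \<le> 1 * (2 ^ r * 1)"
    unfolding abs_mult using assms by (intro mult_mono) auto
  ultimately show ?thesis unfolding osc_def by linarith
qed

lemma osc_deriv: "((\<lambda>x. osc r \<beta> x) has_real_derivative 2 * pi * osc (Suc r) \<beta> x) (at x within S)"
proof -
  have a: "y + real (Suc r) * (pi / 2) = (y + real r * (pi / 2)) + pi / 2" for y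
    by (simp add: algebra_simps add_divide_distrib)
  show ?thesis
    unfolding osc_def a sin_add cos_add
    by (auto intro!: derivative_eq_intros simp: algebra_simps)
qed

lemma osc_add_int: "osc r \<beta> (x + of_int k) = osc r \<beta> x"
proof -
  have s: "sin (y + 2 * pi * of_int l) = sin y" and c: "cos (y + 2 * pi * of_int l) = cos y" for y and l :: int
    using sin_int_2pin cos_int_2pin by (simp_all add: sin_add cos_add sin.plus_of_int cos.plus_of_int algebra_simps)
  have "2 * pi * (x + of_int k) + z = (2 * pi * x + z) + 2 * pi * of_int k"
    "4 * pi * (x + of_int k) + z = (4 * pi * x + z) + 2 * pi * of_int (2 * k)" for z
    by (simp_all add: algebra_simps)
  then show ?thesis unfolding osc_def by (simp only: s c)
qed

text \<open>The summand \<open>j\<close> of the derivative of order \<open>r\<close>. The amplitude \<open>2 ^ (- j lac j)\<close> is smaller than any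
  fixed power of the reciprocal of the frequency \<open>2 ^ lac j\<close> when \<open>j\<close> is large, so the series is smooth.\<close>

definition cocycle_term :: "(nat \<Rightarrow> real) \<Rightarrow> nat \<Rightarrow> nat \<Rightarrow> real \<Rightarrow> real" where
  "cocycle_term b r j x = (2 * pi * 2 ^ lac j) ^ r / 2 ^ (j * lac j) * osc r (b j) (2 ^ lac j * x)"

definition cocycle :: "(nat \<Rightarrow> real) \<Rightarrow> nat \<Rightarrow> real \<Rightarrow> real" where
  "cocycle b r x = (\<Sum>j. cocycle_term b r j x)"

definition term_bound :: "nat \<Rightarrow> nat \<Rightarrow> real" where
  "term_bound r j = 3 * 16 ^ r * (2 ^ (r * lac j) / 2 ^ (j * lac j))"

text \<open>A bound for the derivative of order \<open>r\<close> that is primitive recursive in \<open>r\<close>: each of the first \<open>r + 1\<close>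
  summands is at most the summand \<open>term_bound r r\<close> without its denominator, and so is the remainder.\<close>

definition cocycle_bound :: "nat \<Rightarrow> nat" where
  "cocycle_bound r = 3 * 16 ^ r * ((r + 2) * 2 ^ (r * lac r))"

lemma cocycle_term_bound:
  assumes "\<And>j. 0 \<le> b j" "\<And>j. b j \<le> 1"
  shows "\<bar>cocycle_term b r j x\<bar> \<le> term_bound r j"
proof -
  have "\<bar>cocycle_term b r j x\<bar> = (2 * pi * 2 ^ lac j) ^ r / 2 ^ (j * lac j) * \<bar>osc r (b j) (2 ^ lac j * x)\<bar>"
    by (simp add: cocycle_term_def abs_mult)
  also have "\<dots> \<le> (2 * 4 * 2 ^ lac j) ^ r / 2 ^ (j * lac j) * (3 * 2 ^ r)"
    using pi_less_4 by (intro mult_mono divide_right_mono power_mono osc_bound assms) auto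
  also have "\<dots> = term_bound r j"
    by (simp add: term_bound_def power_mult_distrib power_mult[symmetric] mult.commute[of r] flip: power_mult_distrib)
  finally show ?thesis .
qed

lemma term_bound_le:
  assumes "r < j" shows "term_bound r j \<le> 3 * 16 ^ r * (1 / 2 ^ lac j)"
proof -
  have "r * lac j + lac j \<le> j * lac j" using assms by (metis Suc_leI add.commute mult_Suc mult_le_mono1)
  then have "(2::real) ^ (r * lac j) * 2 ^ lac j \<le> 2 ^ (j * lac j)"
    unfolding power_add[symmetric] by (intro power_increasing) auto
  then show ?thesis unfolding term_bound_def by (intro mult_left_mono) (auto simp: field_simps)
qed

lemma term_bound_tail:
  assumes "r < k"
  shows "summable (\<lambda>i. term_bound r (i + k))" "(\<Sum>i. term_bound r (i + k)) \<le> 3 * 16 ^ r * (2 / 2 ^ lac k)"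
proof -
  have le: "norm (term_bound r (i + k)) \<le> 3 * 16 ^ r * (1 / 2 ^ lac (i + k))" for i
    using term_bound_le[of r "i + k"] assms by (simp add: term_bound_def)
  have s1: "summable (\<lambda>i. 1 / 2 ^ lac (i + k) :: real)" and s2: "(\<Sum>i. 1 / 2 ^ lac (i + k) :: real) \<le> 2 / 2 ^ lac k"
    by (rule summable_half_powers; rule lac_shift)+
  show sm: "summable (\<lambda>i. term_bound r (i + k))"
    by (rule summable_comparison_test'[OF summable_mult[OF s1]]) (rule le)
  have "(\<Sum>i. term_bound r (i + k)) \<le> (\<Sum>i. 3 * 16 ^ r * (1 / 2 ^ lac (i + k)))"
    by (rule suminf_le[OF abs_le_D1[OF le[unfolded real_norm_def]] sm summable_mult[OF s1]])
  also have "\<dots> = 3 * 16 ^ r * (\<Sum>i. 1 / 2 ^ lac (i + k))" by (rule suminf_mult[OF s1])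
  also have "\<dots> \<le> 3 * 16 ^ r * (2 / 2 ^ lac k)" by (intro mult_left_mono s2) auto
  finally show "(\<Sum>i. term_bound r (i + k)) \<le> 3 * 16 ^ r * (2 / 2 ^ lac k)" .
qed

lemma summable_term_bound: "summable (term_bound r)"
  using term_bound_tail(1)[of r "Suc r"] summable_iff_shift[of "term_bound r" "Suc r"] by simp

context
  fixes b :: "nat \<Rightarrow> real"
  assumes b0: "\<And>j. 0 \<le> b j" and b1: "\<And>j. b j \<le> 1"
begin

lemma summable_cocycle: "summable (\<lambda>j. cocycle_term b r j x)"
  by (rule summable_comparison_test'[OF summable_term_bound]) (use cocycle_term_bound[of b, OF b0 b1] in simp)

lemma cocycle_partial_sum:
  assumes "r < k" shows "\<bar>cocycle b r x - (\<Sum>j<k. cocycle_term b r j x)\<bar> \<le> 3 * 16 ^ r * (2 / 2 ^ lac k)"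
proof -
  have "cocycle b r x - (\<Sum>j<k. cocycle_term b r j x) = (\<Sum>i. cocycle_term b r (i + k) x)"
    unfolding cocycle_def using suminf_split_initial_segment[OF summable_cocycle, of r x k] by simp
  also have "\<bar>\<dots>\<bar> \<le> (\<Sum>i. term_bound r (i + k))"
    using norm_suminf_le[of "\<lambda>i. cocycle_term b r (i + k) x" "\<lambda>i. term_bound r (i + k)"]
      cocycle_term_bound[of b, OF b0 b1] term_bound_tail(1)[OF assms] by simp
  also have "\<dots> \<le> 3 * 16 ^ r * (2 / 2 ^ lac k)" by (rule term_bound_tail(2)[OF assms])
  finally show ?thesis .
qed

lemma cocycle_abs_le: "\<bar>cocycle b r x\<bar> \<le> real (cocycle_bound r)"
proof -
  have "\<bar>\<Sum>j<Suc r. cocycle_term b r j x\<bar> \<le> (\<Sum>j<Suc r. 3 * 16 ^ r * 2 ^ (r * lac r))"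
  proof (rule order_trans[OF sum_abs], rule sum_mono)
    fix j assume j: "j \<in> {..<Suc r}"
    have "(2::real) ^ (r * lac j) / 2 ^ (j * lac j) \<le> 2 ^ (r * lac r) / 1"
      using j lac_mono[of j r] by (intro frac_le power_increasing) auto
    then have "term_bound r j \<le> 3 * 16 ^ r * 2 ^ (r * lac r)"
      unfolding term_bound_def by (intro mult_left_mono) auto
    then show "\<bar>cocycle_term b r j x\<bar> \<le> 3 * 16 ^ r * 2 ^ (r * lac r)"
      using cocycle_term_bound[of b, OF b0 b1, where r = r and j = j and x = x] by linarith
  qed
  moreover have "(2::real) / 2 ^ lac (Suc r) \<le> 2 ^ (r * lac r)"
  proof -
    have "(2::real) ^ 1 \<le> 2 ^ lac (Suc r)" using lac_ge[of "Suc r"] by (intro power_increasing) auto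
    then have "(2::real) / 2 ^ lac (Suc r) \<le> 1" by simp
    also have "\<dots> \<le> 2 ^ (r * lac r)" by simp
    finally show ?thesis .
  qed
  then have "3 * 16 ^ r * ((2::real) / 2 ^ lac (Suc r)) \<le> 3 * 16 ^ r * 2 ^ (r * lac r)" by (intro mult_left_mono) auto
  ultimately have "\<bar>cocycle b r x\<bar> \<le> (\<Sum>j<Suc r. 3 * 16 ^ r * 2 ^ (r * lac r)) + 3 * 16 ^ r * 2 ^ (r * lac r)"
    using cocycle_partial_sum[of r "Suc r" x] by linarith
  also have "\<dots> = real (cocycle_bound r)" by (simp add: cocycle_bound_def algebra_simps)
  finally show ?thesis .
qed

lemma cocycle_deriv: "((\<lambda>x. cocycle b r x) has_real_derivative cocycle b (Suc r) x) (at x)"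
proof -
  have d: "(cocycle_term b r j has_real_derivative cocycle_term b (Suc r) j x) (at x within UNIV)" for j x
  proof -
    have "((\<lambda>x. osc r (b j) (2 ^ lac j * x)) has_real_derivative (2 * pi * osc (Suc r) (b j) (2 ^ lac j * x)) * 2 ^ lac j) (at x)"
      by (rule DERIV_chain'[OF _ osc_deriv]) (auto intro!: derivative_eq_intros)
    from DERIV_cmult[OF this, of "(2 * pi * 2 ^ lac j) ^ r / 2 ^ (j * lac j)"]
    show ?thesis by (simp add: cocycle_term_def[abs_def] algebra_simps)
  qed
  have u: "uniform_limit UNIV (\<lambda>n x. \<Sum>i<n. cocycle_term b (Suc r) i x) (\<lambda>x. cocycle b (Suc r) x) sequentially"
    unfolding cocycle_def by (rule Weierstrass_m_test[OF _ summable_term_bound])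
      (use cocycle_term_bound[of b, OF b0 b1] in simp)
  obtain g where g: "\<And>x. (\<lambda>n. cocycle_term b r n x) sums g x" "\<And>x. (g has_real_derivative cocycle b (Suc r) x) (at x)"
    using has_field_derivative_series[OF convex_UNIV d u, of 0] summable_cocycle by auto
  have "g = cocycle b r" using g(1) by (auto simp: cocycle_def fun_eq_iff sums_iff)
  then show ?thesis using g(2) by simp
qed

lemma cocycle_continuous: "continuous_on S (cocycle b r)"
  by (intro continuous_at_imp_continuous_on ballI DERIV_isCont[OF cocycle_deriv])

lemma cocycle_Lipschitz: "\<bar>cocycle b r x - cocycle b r y\<bar> \<le> real (cocycle_bound (Suc r)) * \<bar>x - y\<bar>"
  using field_differentiable_bound[of UNIV "cocycle b r" "cocycle b (Suc r)" "real (cocycle_bound (Suc r))" x y]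
    cocycle_deriv cocycle_abs_le by simp

lemma cocycle_add_int: "cocycle b r (x + of_int k) = cocycle b r x"
proof -
  have "(2::real) ^ lac j * (x + of_int k) = 2 ^ lac j * x + of_int (2 ^ lac j * k)" for j
    by (simp add: algebra_simps)
  then show ?thesis unfolding cocycle_def cocycle_term_def by (simp only: osc_add_int)
qed

end

lemma geometric_sum_cis2pi:
  assumes "cis2pi \<theta> \<noteq> 1" "cis2pi (real m * \<theta>) = 1"
  shows "(\<Sum>n<m. cis2pi (a + real n * \<theta>)) = 0"
proof -
  have p: "cis2pi (real n * \<theta>) = cis2pi \<theta> ^ n" for n
    by (induction n) (auto simp: algebra_simps cis2pi_add)
  have "(\<Sum>n<m. cis2pi (a + real n * \<theta>)) = cis2pi a * (\<Sum>n<m. cis2pi \<theta> ^ n)"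
    by (simp add: cis2pi_add p sum_distrib_left)
  also have "(\<Sum>n<m. cis2pi \<theta> ^ n) = 0" using assms p[of m] by (simp add: geometric_sum)
  finally show ?thesis by simp
qed

lemma osc_0_eq: "osc 0 \<beta> x = Im (cis2pi x) + Im (cis2pi (2 * x)) + \<beta> * Re (cis2pi (2 * x))"
  by (simp add: osc_def cis2pi_def mult.assoc[symmetric])

text \<open>The reciprocal of the amplitude of the summand \<open>j\<close>: after so many steps, the nearly constant values of this
  summand along the orbit add up to a quantity of order one.\<close>

definition return_time :: "nat \<Rightarrow> nat" where
  "return_time j = 2 ^ (j * lac j)"

text \<open>The dyadic rational that is added tells different \<open>N\<close> apart by their groups of eigenvalues.\<close>

definition angle :: "nat \<Rightarrow> real" where
  "angle N = liouville + 1 / 2 ^ (N + 1)"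

lemma angle_irrational: "angle N \<notin> \<rat>"
proof
  assume "angle N \<in> \<rat>"
  then have "angle N - 1 / 2 ^ (N + 1) \<in> \<rat>" by (intro Rats_diff Rats_divide Rats_power) auto
  then show False using liouville_irrational by (simp add: angle_def)
qed

lemma angle_eq:
  assumes "N + 1 < lac j"
  obtains p :: int where "odd p" "angle N = of_int p / 2 ^ lac j + liouville_tail j"
proof -
  define p where "p = int (liouville_numerator j) + 2 ^ (lac j - (N + 1))"
  have "even ((2::int) ^ (lac j - (N + 1)))" using assms by simp
  then have "odd p" unfolding p_def using odd_liouville_numerator by simp
  moreover have "angle N = of_int p / 2 ^ lac j + liouville_tail j"
  proof -
    have "(2::real) ^ (lac j - (N + 1)) = 2 ^ lac j / 2 ^ (N + 1)" using assms by (intro power_diff) auto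
    then have "real_of_int p / 2 ^ lac j = real (liouville_numerator j) / 2 ^ lac j + 1 / 2 ^ (N + 1)"
      by (simp add: p_def add_divide_distrib del: power_Suc)
    then show ?thesis using liouville_eq[of j] by (simp add: angle_def)
  qed
  ultimately show ?thesis using that by blast
qed

text \<open>Along the orbit of a rational rotation with denominator \<open>2 ^ lac j\<close>, the harmonics of lower frequency run
  through roots of unity and cancel, while those of frequency at least \<open>2 ^ lac j\<close> are constant. The numerator
  is odd and the exponents differ by at least two, so this also holds for the second harmonic.\<close>

lemma osc_orbit_sum:
  assumes p: "odd (p::int)" and j: "j \<ge> 1" and \<sigma>: "\<bar>\<sigma>\<bar> = (1::int)"
  shows "(\<Sum>n<return_time j. osc 0 \<beta> (2 ^ lac i * (x + real n * (of_int \<sigma> * (of_int p / 2 ^ lac j)))))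
    = (if i < j then 0 else real (return_time j) * osc 0 \<beta> (2 ^ lac i * x))"
proof (cases "i < j")
  case True
  define \<theta> :: real where "\<theta> = 2 ^ lac i * (of_int \<sigma> * (of_int p / 2 ^ lac j))"
  define d where "d = lac j - lac i"
  have d: "d \<ge> 2" "lac j = lac i + d" using lac_less[OF True] by (auto simp: d_def)
  have \<theta>: "\<theta> = of_int (\<sigma> * p) / 2 ^ d" by (simp add: \<theta>_def d(2) power_add)
  have op: "odd (\<sigma> * p)" using p \<sigma> by (auto simp: abs_if split: if_splits)
  have nonint: "real l * \<theta> \<notin> \<int>" if "l = 1 \<or> l = 2" for l :: nat
  proof
    assume "real l * \<theta> \<in> \<int>"
    then obtain k :: int where "real l * \<theta> = of_int k" by (auto elim: Ints_cases)
    then have "real_of_int (int l * (\<sigma> * p)) = real_of_int (k * 2 ^ d)" by (simp add: \<theta> field_simps)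
    then have "int l * (\<sigma> * p) = k * 2 ^ d" by (simp only: of_int_eq_iff)
    also obtain e where "d = 2 + e" using d(1) le_iff_add by blast
    then have "(2::int) ^ d = 4 * 2 ^ e" by (simp add: power_add)
    finally have "4 dvd int l * (\<sigma> * p)" by (simp add: mult.left_commute)
    moreover have "\<not> 4 dvd int l * m" if "odd m" for m :: int
      using that \<open>l = 1 \<or> l = 2\<close> by (elim disjE; simp; presburger)
    ultimately show False using op by blast
  qed
  have int: "real (return_time j) * (real l * \<theta>) \<in> \<int>" for l :: nat
  proof -
    have "d \<le> j * lac j" using d j by (metis diff_le_self d_def le_trans mult_le_mono1 mult_1)
    then have "(2::real) ^ (j * lac j) = 2 ^ (j * lac j - d) * 2 ^ d" by (simp flip: power_add)
    then have "real (return_time j) * (real l * \<theta>) = of_int (2 ^ (j * lac j - d) * int l * (\<sigma> * p))"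
      by (simp add: return_time_def \<theta>)
    then show ?thesis by (simp only: Ints_of_int)
  qed
  have z: "(\<Sum>n<return_time j. cis2pi (real l * (2 ^ lac i * x) + real n * (real l * \<theta>))) = 0" if "l = 1 \<or> l = 2" for l :: nat
    by (rule geometric_sum_cis2pi) (use nonint[OF that] int[of l] in \<open>auto simp: cis2pi_eq_1_iff\<close>)
  have "osc 0 \<beta> (2 ^ lac i * (x + real n * (of_int \<sigma> * (of_int p / 2 ^ lac j))))
     = Im (cis2pi (real 1 * (2 ^ lac i * x) + real n * (real 1 * \<theta>))) + Im (cis2pi (real 2 * (2 ^ lac i * x) + real n * (real 2 * \<theta>)))
       + \<beta> * Re (cis2pi (real 2 * (2 ^ lac i * x) + real n * (real 2 * \<theta>)))" for n
    unfolding osc_0_eq \<theta>_def by (simp add: algebra_simps)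
  then have "(\<Sum>n<return_time j. osc 0 \<beta> (2 ^ lac i * (x + real n * (of_int \<sigma> * (of_int p / 2 ^ lac j)))))
    = Im (\<Sum>n<return_time j. cis2pi (real 1 * (2 ^ lac i * x) + real n * (real 1 * \<theta>)))
      + Im (\<Sum>n<return_time j. cis2pi (real 2 * (2 ^ lac i * x) + real n * (real 2 * \<theta>)))
      + \<beta> * Re (\<Sum>n<return_time j. cis2pi (real 2 * (2 ^ lac i * x) + real n * (real 2 * \<theta>)))"
    by (simp only: sum.distrib sum_distrib_left Im_sum Re_sum)
  also have "\<dots> = 0" unfolding z[OF disjI1[OF refl]] z[OF disjI2[OF refl]] by simp
  finally show ?thesis using True by simp
next
  case False
  then have "lac j \<le> lac i" by (intro lac_mono) simp
  then have "(2::real) ^ lac i = 2 ^ (lac i - lac j) * 2 ^ lac j" by (simp flip: power_add)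
  then have "2 ^ lac i * (x + real n * (of_int \<sigma> * (of_int p / 2 ^ lac j))) = 2 ^ lac i * x + of_int (2 ^ (lac i - lac j) * int n * \<sigma> * p)" for n
    by (simp add: distrib_left)
  then show ?thesis using False by (simp only: osc_add_int) simp
qed

lemma return_time_tail: "(real (return_time j))\<^sup>2 * liouville_tail j \<le> 2 / 2 ^ j"
proof -
  have "(real (return_time j))\<^sup>2 * liouville_tail j \<le> (real (return_time j))\<^sup>2 * (2 / 2 ^ lac (Suc j))"
    by (intro mult_left_mono liouville_tail_le) auto
  also have "\<dots> \<le> (real (return_time j))\<^sup>2 * (2 / 2 ^ (2 * (j * lac j) + j))"
    by (intro mult_left_mono divide_left_mono power_increasing) (use lac_growth[of j] in auto)
  also have "\<dots> = 2 / 2 ^ j" by (simp add: return_time_def power_add power_mult[symmetric] mult.commute)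
  finally show ?thesis .
qed

lemma return_time_weights:
  "summable (\<lambda>i. 1 / 2 ^ ((i + Suc j) * lac (i + Suc j)) :: real)"
  "real (return_time j) * (\<Sum>i. 1 / 2 ^ ((i + Suc j) * lac (i + Suc j))) \<le> 2 / 2 ^ j"
proof -
  have ge: "(i + Suc j) * lac (i + Suc j) \<ge> i + lac (Suc j)" for i
    using lac_shift[of i "Suc j"] by (metis add_Suc_right le_trans mult_le_mono1 nat_mult_1 One_nat_def Suc_le_mono zero_le)
  from summable_half_powers[OF ge]
  show "summable (\<lambda>i. 1 / 2 ^ ((i + Suc j) * lac (i + Suc j)) :: real)"
    and "real (return_time j) * (\<Sum>i. 1 / 2 ^ ((i + Suc j) * lac (i + Suc j))) \<le> 2 / 2 ^ j"
  proof -
    assume le: "(\<Sum>i. 1 / 2 ^ ((i + Suc j) * lac (i + Suc j)) :: real) \<le> 2 / 2 ^ lac (Suc j)"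
    have "real (return_time j) * (\<Sum>i. 1 / 2 ^ ((i + Suc j) * lac (i + Suc j))) \<le> real (return_time j) * (2 / 2 ^ lac (Suc j))"
      by (intro mult_left_mono le) auto
    also have "\<dots> \<le> real (return_time j) * (2 / 2 ^ (j * lac j + j))"
      by (intro mult_left_mono divide_left_mono power_increasing) (use lac_growth[of j] in auto)
    also have "\<dots> = 2 / 2 ^ j" by (simp add: return_time_def power_add)
    finally show "real (return_time j) * (\<Sum>i. 1 / 2 ^ ((i + Suc j) * lac (i + Suc j))) \<le> 2 / 2 ^ j" .
  qed
qed

text \<open>Replacing the angle by its truncation to denominator \<open>2 ^ lac j\<close> changes each of the \<open>t\<close> summands by at most a
  constant times \<open>t\<close> times the tail of the angle. For the truncated angle, the harmonics below \<open>j\<close> cancel, the one with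
  index \<open>j\<close> is multiplied by \<open>t\<close>, and those above \<open>j\<close> are negligible even after multiplication by \<open>t\<close>. The
  sign \<open>\<sigma>\<close> also covers the inverse rotation.\<close>

lemma birkhoff_sum_approx:
  assumes b: "\<And>j. 0 \<le> b j" "\<And>j. b j \<le> 1" and j: "j \<ge> 1" "N + 1 < lac j" and \<sigma>: "\<bar>\<sigma>\<bar> = (1::int)"
  shows "\<bar>(\<Sum>n<return_time j. cocycle b 0 (x + real n * (of_int \<sigma> * angle N))) - osc 0 (b j) (2 ^ lac j * x)\<bar>
    \<le> (2 * real (cocycle_bound 1) + 6) / 2 ^ j"
proof -
  let ?t = "return_time j" and ?L = "real (cocycle_bound 1)"
  obtain p :: int where p: "odd p" "angle N = of_int p / 2 ^ lac j + liouville_tail j"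
    using angle_eq[OF j(2)] by blast
  let ?y = "\<lambda>n. x + real n * (of_int \<sigma> * (of_int p / 2 ^ lac j))"
  have "\<bar>(\<Sum>n<?t. cocycle b 0 (x + real n * (of_int \<sigma> * angle N))) - (\<Sum>n<?t. cocycle b 0 (?y n))\<bar>
     \<le> (\<Sum>n<?t. ?L * (real ?t * liouville_tail j))"
    unfolding sum_subtractf[symmetric]
  proof (rule order_trans[OF sum_abs], rule sum_mono)
    fix n assume n: "n \<in> {..<?t}"
    have "\<bar>cocycle b 0 (x + real n * (of_int \<sigma> * angle N)) - cocycle b 0 (?y n)\<bar>
      \<le> ?L * \<bar>x + real n * (of_int \<sigma> * angle N) - ?y n\<bar>"
      unfolding One_nat_def by (rule cocycle_Lipschitz[of b, OF b])
    also have "x + real n * (of_int \<sigma> * angle N) - ?y n = real n * of_int \<sigma> * liouville_tail j"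
      unfolding p(2) by (simp add: algebra_simps)
    also have "\<bar>\<dots>\<bar> = real n * liouville_tail j"
      using liouville_tail_pos[of j] \<sigma> by (simp add: abs_mult flip: of_int_abs)
    also have "?L * (real n * liouville_tail j) \<le> ?L * (real ?t * liouville_tail j)"
      using n liouville_tail_pos[of j] by (intro mult_left_mono mult_right_mono) auto
    finally show "\<bar>cocycle b 0 (x + real n * (of_int \<sigma> * angle N)) - cocycle b 0 (?y n)\<bar> \<le> ?L * (real ?t * liouville_tail j)" .
  qed
  also have "(\<Sum>n<?t. ?L * (real ?t * liouville_tail j)) = ?L * ((real ?t)\<^sup>2 * liouville_tail j)"
    by (simp add: power2_eq_square)
  also have "\<dots> \<le> ?L * (2 / 2 ^ j)" by (intro mult_left_mono return_time_tail) auto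
  finally have A: "\<bar>(\<Sum>n<?t. cocycle b 0 (x + real n * (of_int \<sigma> * angle N))) - (\<Sum>n<?t. cocycle b 0 (?y n))\<bar> \<le> ?L * (2 / 2 ^ j)" .
  define c where "c i = (\<Sum>n<?t. cocycle_term b 0 i (?y n))" for i
  have c_eq: "c i = (if i < j then 0 else real ?t / 2 ^ (i * lac i) * osc 0 (b i) (2 ^ lac i * x))" for i
  proof -
    have "c i = 1 / 2 ^ (i * lac i) * (\<Sum>n<?t. osc 0 (b i) (2 ^ lac i * ?y n))"
      by (simp add: c_def cocycle_term_def sum_distrib_left)
    then show ?thesis unfolding osc_orbit_sum[OF p(1) j(1) \<sigma>] by simp
  qed
  have "(\<Sum>n<?t. cocycle b 0 (?y n)) = (\<Sum>i. c i)"
    unfolding cocycle_def c_def by (rule suminf_sum[symmetric]) (rule summable_cocycle[of b, OF b])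
  also have "\<dots> = (\<Sum>i. c (i + Suc j)) + (\<Sum>i<Suc j. c i)"
    unfolding c_def by (rule suminf_split_initial_segment) (rule summable_sum, rule summable_cocycle[of b, OF b])
  also have "(\<Sum>i<Suc j. c i) = osc 0 (b j) (2 ^ lac j * x)"
    by (simp add: c_eq return_time_def)
  finally have B: "(\<Sum>n<?t. cocycle b 0 (?y n)) - osc 0 (b j) (2 ^ lac j * x) = (\<Sum>i. c (i + Suc j))" by simp
  have cb: "norm (c (i + Suc j)) \<le> 3 * real ?t * (1 / 2 ^ ((i + Suc j) * lac (i + Suc j)))" for i
  proof -
    have "\<bar>osc 0 (b (i + Suc j)) (2 ^ lac (i + Suc j) * x)\<bar> \<le> 3" using osc_bound[OF b, where r = 0] by simp
    then have "real ?t / 2 ^ ((i + Suc j) * lac (i + Suc j)) * \<bar>osc 0 (b (i + Suc j)) (2 ^ lac (i + Suc j) * x)\<bar>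
       \<le> real ?t / 2 ^ ((i + Suc j) * lac (i + Suc j)) * 3" by (intro mult_left_mono) auto
    then show ?thesis by (simp add: c_eq abs_mult mult.commute)
  qed
  have "\<bar>\<Sum>i. c (i + Suc j)\<bar> \<le> (\<Sum>i. 3 * real ?t * (1 / 2 ^ ((i + Suc j) * lac (i + Suc j))))"
    using norm_suminf_le[OF cb summable_mult[OF return_time_weights(1)]] by simp
  also have "\<dots> = 3 * (real ?t * (\<Sum>i. 1 / 2 ^ ((i + Suc j) * lac (i + Suc j))))"
    by (subst suminf_mult[OF return_time_weights(1)]) simp
  also have "\<dots> \<le> 3 * (2 / 2 ^ j)" by (intro mult_left_mono return_time_weights(2)) auto
  finally have C: "\<bar>\<Sum>i. c (i + Suc j)\<bar> \<le> 3 * (2 / 2 ^ j)" .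
  have "(2 * ?L + 6) / 2 ^ j = ?L * (2 / 2 ^ j) + 3 * (2 / 2 ^ j)" by (simp add: field_simps)
  then show ?thesis using A B C by linarith
qed


section \<open>Lacunary cocycles are not coboundaries\<close>

lemma cis2pi_Lipschitz: "norm (cis2pi a - cis2pi b) \<le> 2 * pi * \<bar>a - b\<bar>"
proof -
  have "cis2pi a - cis2pi b = cis2pi b * (cis2pi (a - b) - 1)"
    using cis2pi_add[of b "a - b"] by (simp add: algebra_simps)
  then have "norm (cis2pi a - cis2pi b) = norm (cis2pi (a - b) - 1)" by (simp add: norm_mult)
  also have "\<dots> = 2 * \<bar>sin (2 * pi * (a - b) / 2)\<bar>"
    unfolding cis2pi_def cis_conv_exp by (rule dist_exp_i_1)
  also have "\<dots> \<le> 2 * \<bar>2 * pi * (a - b) / 2\<bar>" by (intro mult_left_mono abs_sin_x_le_abs_x) auto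
  also have "\<dots> = 2 * pi * \<bar>a - b\<bar>" by (simp add: abs_mult)
  finally show ?thesis .
qed

lemma osc_1_eq: "osc (Suc 0) \<beta> s = cos (2 * pi * s) + 2 * cos (4 * pi * s) - 2 * \<beta> * sin (4 * pi * s)"
  by (simp add: osc_def sin_add cos_add)

lemma osc_continuous [continuous_intros]:
  fixes f :: "'a::t2_space \<Rightarrow> real"
  shows "continuous_on S f \<Longrightarrow> continuous_on S (\<lambda>x. osc r \<beta> (f x))"
  unfolding osc_def by (intro continuous_intros)

lemma osc_frac: "osc r \<beta> (frac x) = osc r \<beta> x"
  using osc_add_int[of r \<beta> x "- \<lfloor>x\<rfloor>"] by (simp add: frac_def)

text \<open>A smooth function with integer values has derivative zero, which gives a linear relation between the
  harmonics. For \<open>\<eta> = 0\<close>, the coefficient of \<open>cos (2\<pi>s)\<close> in it is \<open>m\<close>. For \<open>\<eta> = 1\<close>, the coefficient of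
  \<open>sin (2\<pi>s)\<close> gives \<open>sin (2\<pi>\<gamma>) = 0\<close>, and then the coefficients of \<open>cos (4\<pi>s)\<close> and \<open>sin (4\<pi>s)\<close>
  give \<open>m = 1\<close> and \<open>m = - 1\<close>.\<close>

lemma osc_combination_nonconstant:
  assumes cases: "(\<eta> = 0 \<and> m \<noteq> 0) \<or> (\<eta> = 1 \<and> \<beta> = (1::real))"
    and const: "\<And>s. s \<in> {0<..<1} \<Longrightarrow> cis2pi (\<theta> - m * osc 0 \<beta> s - \<eta> * osc 0 \<beta> (\<gamma> - s)) = 1"
  shows False
proof -
  define h where "h s = \<theta> - m * osc 0 \<beta> s - \<eta> * osc 0 \<beta> (\<gamma> - s)" for s
  define h' where "h' s = - m * (2 * pi * osc (Suc 0) \<beta> s) + \<eta> * (2 * pi * osc (Suc 0) \<beta> (\<gamma> - s))" for s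
  have dh: "(h has_real_derivative h' s) (at s)" for s
  proof -
    have "((\<lambda>s. osc 0 \<beta> (\<gamma> - s)) has_real_derivative (2 * pi * osc (Suc 0) \<beta> (\<gamma> - s)) * (- 1)) (at s)"
      by (rule DERIV_chain'[OF _ osc_deriv]) (auto intro!: derivative_eq_intros)
    then show ?thesis unfolding h_def[abs_def] h'_def
      by (auto intro!: derivative_eq_intros osc_deriv)
  qed
  have h'0: "h' s = 0" if s: "s \<in> {0<..<1}" for s
  proof -
    have c1: "cos (2 * pi * h u) = 1" "sin (2 * pi * h u) = 0" if "u \<in> {0<..<1}" for u
      using const[OF that] unfolding h_def[symmetric] cis2pi_def by (auto simp: complex_eq_iff)
    have "((\<lambda>u. sin (2 * pi * h u)) has_real_derivative cos (2 * pi * h s) * (2 * pi * h' s)) (at s)"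
      by (auto intro!: derivative_eq_intros dh)
    moreover have "((\<lambda>u. sin (2 * pi * h u)) has_real_derivative 0) (at s)"
      by (rule has_field_derivative_transform_within_open[OF DERIV_const[of 0] _ s]) (auto simp: c1)
    ultimately have "cos (2 * pi * h s) * (2 * pi * h' s) = 0" by (rule DERIV_unique)
    then show ?thesis using c1[OF s] by simp
  qed
  define C S C2 S2 where "C = cos (2 * pi * \<gamma>)" and "S = sin (2 * pi * \<gamma>)"
    and "C2 = cos (4 * pi * \<gamma>)" and "S2 = sin (4 * pi * \<gamma>)"
  \<comment> \<open>The coefficients of the linear relation; the evaluations below show that they vanish.\<close>
  define A B D E where "A = m - \<eta> * C" and "B = - \<eta> * S"
    and "D = 2 * m - 2 * \<eta> * C2 + 2 * \<eta> * \<beta> * S2" and "E = - 2 * \<beta> * m - 2 * \<eta> * S2 - 2 * \<eta> * \<beta> * C2"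
  have lin: "A * cos (2 * pi * s) + B * sin (2 * pi * s) + D * cos (4 * pi * s) + E * sin (4 * pi * s) = 0"
    if s: "s \<in> {0<..<1}" for s
  proof -
    have "2 * pi * (m * osc (Suc 0) \<beta> s - \<eta> * osc (Suc 0) \<beta> (\<gamma> - s)) = 0"
      using h'0[OF s] by (simp add: h'_def algebra_simps)
    then have e: "m * osc (Suc 0) \<beta> s - \<eta> * osc (Suc 0) \<beta> (\<gamma> - s) = 0" by simp
    have a: "2 * pi * (\<gamma> - s) = 2 * pi * \<gamma> - 2 * pi * s" "4 * pi * (\<gamma> - s) = 4 * pi * \<gamma> - 4 * pi * s"
      by (simp_all add: algebra_simps)
    have f1: "osc (Suc 0) \<beta> (\<gamma> - s) = (C * cos (2 * pi * s) + S * sin (2 * pi * s))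
        + 2 * (C2 * cos (4 * pi * s) + S2 * sin (4 * pi * s)) - 2 * \<beta> * (S2 * cos (4 * pi * s) - C2 * sin (4 * pi * s))"
      unfolding osc_1_eq a cos_diff sin_diff C_def S_def C2_def S2_def by simp
    show ?thesis using e unfolding f1 unfolding osc_1_eq A_def B_def D_def E_def by (simp add: algebra_simps)
  qed
  have "cos (3 * pi) = -1" "sin (3 * pi) = 0"
    using cos_periodic[of pi] sin_periodic[of pi] by (simp_all add: algebra_simps)
  then have "B - D = 0" "- B - D = 0" "- A + D = 0"
    using lin[of "1/4"] lin[of "3/4"] lin[of "1/2"] cos_3over2_pi sin_3over2_pi by (simp_all add: mult.commute)
  then have z: "A = 0" "B = 0" "D = 0" by linarith+
  then have "E = 0" using lin[of "1/8"] by (simp add: mult.commute)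
  show False
  proof (cases "\<eta> = 0")
    case True
    then show False using cases z by (simp add: A_def)
  next
    case False
    then have [simp]: "\<eta> = 1" "\<beta> = 1" using cases by auto
    have "S = 0" using z by (simp add: B_def)
    have "S2 = 2 * S * C" "C2 = 1 - 2 * S\<^sup>2"
      using sin_double[of "2 * pi * \<gamma>"] cos_double_sin[of "2 * pi * \<gamma>"]
      by (simp_all add: S_def C_def S2_def C2_def mult.assoc[symmetric])
    then have "S2 = 0" "C2 = 1" using \<open>S = 0\<close> by simp_all
    then show False using z \<open>E = 0\<close> by (simp add: D_def E_def)
  qed
qed

text \<open>A nonempty open set is not negligible.\<close>

lemma continuous_circle_integral_zero:
  fixes F :: "real \<Rightarrow> real"
  assumes cont: "continuous_on UNIV F" and nn: "\<And>s. 0 \<le> F s" and int: "integrable circle_measure F"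
    and zero: "(LINT s|circle_measure. F s) = 0" and s: "s \<in> {0<..<1}"
  shows "F s = 0"
proof -
  define V where "V = {0<..<1} \<inter> F -` (- {0})"
  have oV: "open V" unfolding V_def by (intro open_Int open_vimage cont) auto
  have "AE x in circle_measure. F x = 0" using integral_nonneg_eq_0_iff_AE[OF int] nn zero by simp
  then have "AE x in lborel. x \<in> {0..<1} \<longrightarrow> F x = 0" by (simp add: AE_circle_iff)
  then have "AE x in lborel. x \<notin> V" by eventually_elim (auto simp: V_def)
  then have "V \<in> null_sets lborel" using oV by (subst AE_iff_null_sets) auto
  then have "negligible V" by (simp add: negligible_iff_null_sets null_sets_completionI)
  then have "V = {}" using open_not_negligible[OF oV] by blast
  then show ?thesis using s by (auto simp: V_def)
qed

lemma return_time_angle: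
  assumes "j \<ge> 1" "N + 1 < lac j"
  shows "\<exists>z. real (return_time j) * angle N = of_int z + real (return_time j) * liouville_tail j"
proof -
  obtain p :: int where p: "angle N = of_int p / 2 ^ lac j + liouville_tail j"
    using angle_eq[OF assms(2)] by blast
  have "lac j \<le> j * lac j" using assms(1) by simp
  then have "(2::real) ^ (j * lac j) = 2 ^ (j * lac j - lac j) * 2 ^ lac j" by (simp flip: power_add)
  then have "real (return_time j) * angle N = of_int (2 ^ (j * lac j - lac j) * p) + real (return_time j) * liouville_tail j"
    by (simp add: p return_time_def distrib_left)
  then show ?thesis by blast
qed

text \<open>A nonzero solution would force the exponentials of the Birkhoff sums along the return times to tend to \<open>1\<close>
  in mean. These sums are approximately functions of \<open>2 ^ lac j x\<close>, and multiplication by an integer preserves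
  the measure, so the means are those of \<open>\<Psi> (P j)\<close>, where the parameters \<open>P j\<close> lie in the unit square. A limit
  point \<open>l\<close> of the parameters gives a combination of oscillations that is constant modulo 1.\<close>

theorem lacunary_noncoboundary:
  fixes m :: int and \<eta> \<theta> c \<beta> :: real
  assumes b: "\<And>j. 0 \<le> b j" "\<And>j. b j \<le> 1" and ev: "\<And>j. J \<le> j \<Longrightarrow> b j = \<beta>"
    and cases: "(\<eta> = 0 \<and> m \<noteq> 0) \<or> (\<eta> = 1 \<and> \<beta> = 1)"
    and w: "bounded_borel w"
    and eq: "AE x in circle_measure. w (frac (x + angle N)) =
       cis2pi (\<theta> - of_int m * cocycle b 0 x - \<eta> * cocycle b 0 (c - x)) * w x"
  shows "AE x in circle_measure. w x = 0"
proof (rule ccontr)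
  assume nz: "\<not> (AE x in circle_measure. w x = 0)"
  define j0 where "j0 = max J (N + 2)"
  define k where "k j = j + j0" for j
  have k: "J \<le> k j" "k j \<ge> 1" "N + 1 < lac (k j)" "j \<le> k j" for j
    using lac_ge[of "k j"] by (auto simp: k_def j0_def)
  define t where "t j = return_time (k j)" for j
  define \<Phi> where "\<Phi> x = \<theta> - of_int m * cocycle b 0 x - \<eta> * cocycle b 0 (c - x)" for x
  have \<Phi>c: "continuous_on UNIV \<Phi>"
    unfolding \<Phi>_def by (intro continuous_intros cocycle_continuous[of b, OF b]
      continuous_on_compose2[OF cocycle_continuous[of b, OF b]]) auto
  then have \<Phi>m [measurable]: "\<Phi> \<in> borel_measurable borel" by (rule borel_measurable_continuous_onI)
  have \<Phi>per: "\<Phi> (frac x) = \<Phi> x" for x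
  proof -
    have "frac x = x + of_int (- \<lfloor>x\<rfloor>)" "c - frac x = (c - x) + of_int \<lfloor>x\<rfloor>" by (simp_all add: frac_def)
    then show ?thesis unfolding \<Phi>_def by (simp only: cocycle_add_int[of b, OF b])
  qed
  obtain z where z: "\<And>j. real (t j) * angle N = of_int (z j) + real (t j) * liouville_tail (k j)"
    using return_time_angle[OF k(2,3)] unfolding t_def by metis
  have half: "(\<lambda>j. K / 2 ^ k j) \<longlonglongrightarrow> 0" for K :: real
  proof -
    have "(\<lambda>j. K / 2 ^ j0 * (1 / 2) ^ j) \<longlonglongrightarrow> K / 2 ^ j0 * 0"
      by (intro tendsto_intros LIMSEQ_power_zero) simp
    then show ?thesis by (simp add: k_def power_add power_divide mult.commute)
  qed
  have \<delta>: "(\<lambda>j. real (t j) * liouville_tail (k j)) \<longlonglongrightarrow> 0"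
  proof (rule Lim_null_comparison[OF _ half[of 2]], rule always_eventually, rule allI)
    fix j
    have "1 \<le> real (t j)" by (simp add: t_def return_time_def)
    then have "real (t j) * liouville_tail (k j) \<le> (real (t j))\<^sup>2 * liouville_tail (k j)"
      using liouville_tail_pos[of "k j"] by (intro mult_right_mono) (auto simp: power2_eq_square)
    also have "\<dots> \<le> 2 / 2 ^ k j" unfolding t_def by (rule return_time_tail)
    finally show "norm (real (t j) * liouville_tail (k j)) \<le> 2 / 2 ^ k j"
      using liouville_tail_pos[of "k j"] by simp
  qed
  have lim: "(\<lambda>j. LINT x|circle_measure. norm (cis2pi (\<Sum>i<t j. \<Phi> (x + real i * angle N)) - 1)) \<longlonglongrightarrow> 0"
    by (rule cocycle_rigidity[OF angle_irrational w \<Phi>m _ _ z \<delta> nz]) (simp only: \<Phi>per, use eq in \<open>simp only: \<Phi>_def\<close>)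
  \<comment> \<open>The approximate value of the Birkhoff sum of \<open>\<Phi>\<close> at the return time.\<close>
  define H where "H j x = real (t j) * \<theta> - of_int m * osc 0 \<beta> (2 ^ lac (k j) * x) - \<eta> * osc 0 \<beta> (2 ^ lac (k j) * (c - x))" for j x
  have Hc: "continuous_on UNIV (H j)" for j unfolding H_def by (intro continuous_intros)
  define K where "K = 2 * pi * ((\<bar>of_int m\<bar> + \<bar>\<eta>\<bar>) * (2 * real (cocycle_bound 1) + 6))"
  have near: "norm (cis2pi (H j x) - cis2pi (\<Sum>i<t j. \<Phi> (x + real i * angle N))) \<le> K / 2 ^ k j" for j x
  proof -
    let ?E = "(2 * real (cocycle_bound 1) + 6) / 2 ^ k j"
    let ?X = "\<Sum>i<t j. cocycle b 0 (x + real i * angle N)" and ?Y = "\<Sum>i<t j. cocycle b 0 (c - x + real i * (- angle N))"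
    have X: "\<bar>?X - osc 0 \<beta> (2 ^ lac (k j) * x)\<bar> \<le> ?E"
      using birkhoff_sum_approx[of b, OF b k(2,3), of 1 x j] ev[OF k(1)] by (simp add: t_def)
    \<comment> \<open>The reflected term runs through its orbit backwards.\<close>
    have Y: "\<bar>?Y - osc 0 \<beta> (2 ^ lac (k j) * (c - x))\<bar> \<le> ?E"
      using birkhoff_sum_approx[of b, OF b k(2,3), of "- 1" "c - x" j] ev[OF k(1)] by (simp add: t_def)
    have "c - (x + real i * angle N) = c - x + real i * (- angle N)" for i by simp
    then have sum: "(\<Sum>i<t j. \<Phi> (x + real i * angle N)) = real (t j) * \<theta> - of_int m * ?X - \<eta> * ?Y"
      unfolding \<Phi>_def by (simp only: sum_subtractf sum_constant card_lessThan sum_distrib_left)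
    have "H j x - (\<Sum>i<t j. \<Phi> (x + real i * angle N))
       = of_int m * (?X - osc 0 \<beta> (2 ^ lac (k j) * x)) + \<eta> * (?Y - osc 0 \<beta> (2 ^ lac (k j) * (c - x)))"
      unfolding sum H_def by (simp only: algebra_simps)
    also have "\<bar>\<dots>\<bar> \<le> \<bar>of_int m\<bar> * ?E + \<bar>\<eta>\<bar> * ?E"
      by (rule order_trans[OF abs_triangle_ineq]) (unfold abs_mult, intro add_mono mult_left_mono X Y, auto)
    finally have "2 * pi * \<bar>H j x - (\<Sum>i<t j. \<Phi> (x + real i * angle N))\<bar> \<le> 2 * pi * (\<bar>of_int m\<bar> * ?E + \<bar>\<eta>\<bar> * ?E)"
      by (intro mult_left_mono) auto
    also have "\<dots> = K / 2 ^ k j" by (simp add: K_def field_simps)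
    finally show ?thesis using cis2pi_Lipschitz order_trans by blast
  qed
  define \<Psi> where "\<Psi> p s = norm (cis2pi (fst p - of_int m * osc 0 \<beta> s - \<eta> * osc 0 \<beta> (snd p - s)) - 1)" for p s
  have \<Psi>c: "continuous_on UNIV (\<Psi> p)" for p unfolding \<Psi>_def by (intro continuous_intros)
  have \<Psi>m [measurable]: "\<Psi> p \<in> borel_measurable borel" for p by (rule borel_measurable_continuous_onI[OF \<Psi>c])
  have norm2: "norm (cis2pi a - 1) \<le> 2" for a using norm_triangle_ineq4[of "cis2pi a" 1] by simp
  have \<Psi>b: "norm (\<Psi> p s) \<le> 2" for p s unfolding \<Psi>_def using norm2 by simp
  define P where "P j = (frac (real (t j) * \<theta>), frac (2 ^ lac (k j) * c))" for j
  have fold: "norm (cis2pi (H j x) - 1) = \<Psi> (P j) (frac (real (2 ^ lac (k j)) * x))" for j x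
  proof -
    have "osc 0 \<beta> (frac (2 ^ lac (k j) * c) - frac (2 ^ lac (k j) * x)) = osc 0 \<beta> (2 ^ lac (k j) * (c - x))"
      using osc_add_int[of 0 \<beta> "2 ^ lac (k j) * (c - x)" "\<lfloor>2 ^ lac (k j) * x\<rfloor> - \<lfloor>2 ^ lac (k j) * c\<rfloor>"]
      by (simp add: frac_def algebra_simps)
    moreover have "cis2pi (frac a - r - s) = cis2pi (a - r - s)" for a r s
      using cis2pi_add_int[of "a - r - s" "- \<lfloor>a\<rfloor>"] by (simp add: frac_def algebra_simps)
    ultimately show ?thesis by (simp add: \<Psi>_def P_def H_def osc_frac)
  qed
  have int: "(LINT x|circle_measure. norm (cis2pi (H j x) - 1)) = (LINT s|circle_measure. \<Psi> (P j) s)" for j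
    unfolding fold by (rule integral_measure_preserving[OF measure_preserving_multiple]) auto
  have "(\<lambda>j. LINT s|circle_measure. \<Psi> (P j) s) \<longlonglongrightarrow> 0"
  proof (rule Lim_null_comparison[OF always_eventually], rule allI)
    fix j
    have m1 [measurable]: "(\<lambda>x. cis2pi (H j x)) \<in> borel_measurable borel"
      by (intro borel_measurable_continuous_onI continuous_intros Hc)
    have i1: "integrable circle_measure (\<lambda>x. norm (cis2pi (\<Sum>i<t j. \<Phi> (x + real i * angle N)) - 1))"
      by (rule circle.integrable_const_bound[where B = 2]) (use norm2 in auto)
    have i2: "integrable circle_measure (\<lambda>x. norm (cis2pi (H j x) - 1))"
      by (rule circle.integrable_const_bound[where B = 2]) (use norm2 in auto)
    have "(LINT x|circle_measure. norm (cis2pi (H j x) - 1))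
      \<le> (LINT x|circle_measure. norm (cis2pi (\<Sum>i<t j. \<Phi> (x + real i * angle N)) - 1) + K / 2 ^ k j)"
    proof (rule integral_mono)
      fix x
      show "norm (cis2pi (H j x) - 1) \<le> norm (cis2pi (\<Sum>i<t j. \<Phi> (x + real i * angle N)) - 1) + K / 2 ^ k j"
        using near[of j x] norm_triangle_ineq[of "cis2pi (H j x) - cis2pi (\<Sum>i<t j. \<Phi> (x + real i * angle N))"
            "cis2pi (\<Sum>i<t j. \<Phi> (x + real i * angle N)) - 1"] by simp
    qed (use i1 i2 in auto)
    also have "\<dots> = (LINT x|circle_measure. norm (cis2pi (\<Sum>i<t j. \<Phi> (x + real i * angle N)) - 1)) + K / 2 ^ k j"
      using i1 by simp
    finally show "norm (LINT s|circle_measure. \<Psi> (P j) s) \<le>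
       (LINT x|circle_measure. norm (cis2pi (\<Sum>i<t j. \<Phi> (x + real i * angle N)) - 1)) + K / 2 ^ k j"
    proof -
      have "0 \<le> (LINT s|circle_measure. \<Psi> (P j) s)" by (rule Bochner_Integration.integral_nonneg) (simp add: \<Psi>_def)
      moreover assume "(LINT x|circle_measure. norm (cis2pi (H j x) - 1))
        \<le> (LINT x|circle_measure. norm (cis2pi (\<Sum>i<t j. \<Phi> (x + real i * angle N)) - 1)) + K / 2 ^ k j"
      ultimately show ?thesis unfolding int by simp
    qed
  next
    show "(\<lambda>j. (LINT x|circle_measure. norm (cis2pi (\<Sum>i<t j. \<Phi> (x + real i * angle N)) - 1)) + K / 2 ^ k j) \<longlonglongrightarrow> 0"
      using tendsto_add[OF lim half[of K]] by simp
  qed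
  note L = this
  have "seq_compact ({0..1} \<times> {0..1} :: (real \<times> real) set)"
    by (intro compact_imp_seq_compact compact_Times) auto
  moreover have "P j \<in> {0..1} \<times> {0..1}" for j by (auto simp: P_def less_imp_le[OF frac_lt_1])
  ultimately obtain l r where r: "strict_mono r" "(P \<circ> r) \<longlonglongrightarrow> l" unfolding seq_compact_def by metis
  have "(\<lambda>j. LINT s|circle_measure. \<Psi> (P (r j)) s) \<longlonglongrightarrow> (LINT s|circle_measure. \<Psi> l s)"
  proof (rule integral_dominated_convergence[where w = "\<lambda>_. 2"])
    show "AE s in circle_measure. (\<lambda>j. \<Psi> (P (r j)) s) \<longlonglongrightarrow> \<Psi> l s"
    proof (rule AE_I2)
      fix s
      have "continuous_on UNIV (\<lambda>p. \<Psi> p s)" unfolding \<Psi>_def by (intro continuous_intros)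
      then have "\<forall>q\<in>UNIV. isCont (\<lambda>p. \<Psi> p s) q" by (simp only: continuous_on_eq_continuous_at[OF open_UNIV])
      then have "isCont (\<lambda>p. \<Psi> p s) l" by (rule bspec) simp
      from isCont_tendsto_compose[OF this r(2)] show "(\<lambda>j. \<Psi> (P (r j)) s) \<longlonglongrightarrow> \<Psi> l s" by (simp add: o_def)
    qed
  qed (use \<Psi>b in auto)
  moreover have "(\<lambda>j. LINT s|circle_measure. \<Psi> (P (r j)) s) \<longlonglongrightarrow> 0"
    using LIMSEQ_subseq_LIMSEQ[OF L r(1)] by (simp add: o_def)
  ultimately have zero: "(LINT s|circle_measure. \<Psi> l s) = 0" by (rule LIMSEQ_unique)
  have int_l: "integrable circle_measure (\<Psi> l)"
    by (rule circle.integrable_const_bound[where B = 2]) (use \<Psi>b in auto)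
  have "0 \<le> \<Psi> l s" for s by (simp add: \<Psi>_def)
  then have "\<Psi> l s = 0" if "s \<in> {0<..<1}" for s
    using continuous_circle_integral_zero[OF \<Psi>c _ int_l zero that] by blast
  then show False
    using osc_combination_nonconstant[of \<eta> "of_int m" \<beta> "fst l" "snd l"] cases by (auto simp: \<Psi>_def)
qed


section \<open>Skew products on the torus\<close>

lemma to_torus_rep [simp]: "to_torus (rep_torus P) = P"
  by (rule Quotient3_abs_rep[OF Quotient3_torus])

lemma to_torus_eq_iff: "to_torus p = to_torus q \<longleftrightarrow> fst p - fst q \<in> \<int> \<and> snd p - snd q \<in> \<int>"
  by (simp add: torus.abs_eq_iff torus_rel_def)

lemma to_torus_eqI: "fst p = fst q + of_int k \<Longrightarrow> snd p = snd q + of_int l \<Longrightarrow> to_torus p = to_torus q"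
  by (simp add: to_torus_eq_iff)

lemma torus_cases: obtains x y where "P = to_torus (x, y)"
  by (metis to_torus_rep surj_pair)

definition torus_map :: "(real \<times> real \<Rightarrow> real \<times> real) \<Rightarrow> torus \<Rightarrow> torus" where
  "torus_map G P = to_torus (G (rep_torus P))"

lemma torus_map_to_torus:
  assumes "\<And>p q. to_torus p = to_torus q \<Longrightarrow> to_torus (G p) = to_torus (G q)"
  shows "torus_map G (to_torus p) = to_torus (G p)"
  unfolding torus_map_def by (rule assms) simp

definition periodic :: "(real \<Rightarrow> 'a) \<Rightarrow> bool" where
  "periodic \<phi> \<longleftrightarrow> (\<forall>x (k::int). \<phi> (x + of_int k) = \<phi> x)"

lemma periodic_eq: "periodic \<phi> \<Longrightarrow> x - y \<in> \<int> \<Longrightarrow> \<phi> x = \<phi> y"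
  unfolding periodic_def by (metis Ints_cases add.commute diff_add_cancel)

definition skew_lift :: "real \<Rightarrow> (real \<Rightarrow> real) \<Rightarrow> real \<times> real \<Rightarrow> real \<times> real" where
  "skew_lift \<alpha> \<phi> p = (fst p + \<alpha>, snd p + \<phi> (fst p))"

definition skew :: "real \<Rightarrow> (real \<Rightarrow> real) \<Rightarrow> torus \<Rightarrow> torus" where
  "skew \<alpha> \<phi> = torus_map (skew_lift \<alpha> \<phi>)"

lemma skew_to_torus:
  assumes "periodic \<phi>" shows "skew \<alpha> \<phi> (to_torus p) = to_torus (skew_lift \<alpha> \<phi> p)"
  unfolding skew_def
proof (rule torus_map_to_torus)
  fix p q assume "to_torus p = to_torus q"
  then have i: "fst p - fst q \<in> \<int>" "snd p - snd q \<in> \<int>" by (auto simp: to_torus_eq_iff)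
  then have "\<phi> (fst p) = \<phi> (fst q)" using periodic_eq[OF assms] by blast
  then show "to_torus (skew_lift \<alpha> \<phi> p) = to_torus (skew_lift \<alpha> \<phi> q)"
    using i by (simp add: skew_lift_def to_torus_eq_iff)
qed

lemma periodic_inverse: "periodic \<phi> \<Longrightarrow> periodic (\<lambda>x. - \<phi> (x - \<alpha>))"
  unfolding periodic_def by (metis add_diff_eq diff_add_eq)

lemma skew_inverse:
  assumes "periodic \<phi>"
  shows "skew (- \<alpha>) (\<lambda>x. - \<phi> (x - \<alpha>)) (skew \<alpha> \<phi> P) = P"
    and "skew \<alpha> \<phi> (skew (- \<alpha>) (\<lambda>x. - \<phi> (x - \<alpha>)) P) = P"
proof -
  obtain x y where P: "P = to_torus (x, y)" by (rule torus_cases)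
  show "skew (- \<alpha>) (\<lambda>x. - \<phi> (x - \<alpha>)) (skew \<alpha> \<phi> P) = P"
    "skew \<alpha> \<phi> (skew (- \<alpha>) (\<lambda>x. - \<phi> (x - \<alpha>)) P) = P"
    unfolding P skew_to_torus[OF assms] skew_to_torus[OF periodic_inverse[OF assms]]
    by (simp_all add: skew_lift_def)
qed

lemma bij_skew: "periodic \<phi> \<Longrightarrow> bij (skew \<alpha> \<phi>)"
  by (rule o_bij[of "skew (- \<alpha>) (\<lambda>x. - \<phi> (x - \<alpha>))"]) (auto simp: skew_inverse fun_eq_iff)

lemma inv_skew: "periodic \<phi> \<Longrightarrow> inv (skew \<alpha> \<phi>) = skew (- \<alpha>) (\<lambda>x. - \<phi> (x - \<alpha>))"
  by (rule inv_unique_comp) (auto simp: skew_inverse fun_eq_iff)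

lemma measure_preserving_skew_torus:
  assumes "periodic \<phi>" "\<phi> \<in> borel_measurable borel"
  shows "measure_preserving torus_lebesgue torus_lebesgue (skew \<alpha> \<phi>)"
proof (rule measure_preserving_torusI)
  show "measure_preserving square_measure square_measure (\<lambda>p. (frac (fst p + \<alpha>), frac (snd p + \<phi> (fst p))))"
    by (rule measure_preserving_skew[OF measure_preserving_shift assms(2)])
  fix p
  show "to_torus (frac (fst p + \<alpha>), frac (snd p + \<phi> (fst p))) = skew \<alpha> \<phi> (to_torus p)"
    unfolding skew_to_torus[OF assms(1)]
    by (rule to_torus_eqI[of _ _ "- \<lfloor>fst p + \<alpha>\<rfloor>" "- \<lfloor>snd p + \<phi> (fst p)\<rfloor>"]) (simp_all add: skew_lift_def frac_def)
qed

text \<open>The characters of the torus that generate its dual group.\<close>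

definition char_x :: "torus \<Rightarrow> complex" where "char_x P = cis2pi (fst (rep_torus P))"
definition char_y :: "torus \<Rightarrow> complex" where "char_y P = cis2pi (snd (rep_torus P))"

lemma cis2pi_cong: "x - y \<in> \<int> \<Longrightarrow> cis2pi x = cis2pi y"
  using cis2pi_add[of y "x - y"] cis2pi_eq_1_iff[of "x - y"] by simp

lemma char_to_torus: "char_x (to_torus p) = cis2pi (fst p)" "char_y (to_torus p) = cis2pi (snd p)"
proof -
  have "to_torus (rep_torus (to_torus p)) = to_torus p" by simp
  then show "char_x (to_torus p) = cis2pi (fst p)" "char_y (to_torus p) = cis2pi (snd p)"
    unfolding to_torus_eq_iff char_x_def char_y_def by (auto intro: cis2pi_cong)
qed

lemma norm_char [simp]: "norm (char_x P) = 1" "norm (char_y P) = 1"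
  by (simp_all add: char_x_def char_y_def)

lemma skew_char_x: "periodic \<phi> \<Longrightarrow> char_x (skew \<alpha> \<phi> P) = cis2pi \<alpha> * char_x P"
  by (rule torus_cases[of P]) (simp add: skew_to_torus skew_lift_def char_to_torus cis2pi_add mult.commute)

lemma measurable_torusI:
  assumes "F \<in> borel_measurable borel" "\<And>p. f (to_torus p) = F p"
  shows "f \<in> borel_measurable torus_lebesgue"
proof (rule measurableI)
  fix A :: "'a set" assume A: "A \<in> sets borel"
  have "to_torus -` (f -` A) = F -` A" using assms(2) by auto
  also have "\<dots> \<in> sets (completion square_measure)" using measurable_sets_borel[OF assms(1) A] by simp
  finally show "f -` A \<inter> space torus_lebesgue \<in> sets torus_lebesgue" by (simp add: sets_torus_iff)
qed simp

lemma measurable_char: "char_x \<in> borel_measurable torus_lebesgue" "char_y \<in> borel_measurable torus_lebesgue"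
proof -
  have "(\<lambda>p::real \<times> real. cis2pi (fst p)) \<in> borel_measurable borel" "(\<lambda>p::real \<times> real. cis2pi (snd p)) \<in> borel_measurable borel"
    by (intro borel_measurable_continuous_onI continuous_intros)+
  then show "char_x \<in> borel_measurable torus_lebesgue" "char_y \<in> borel_measurable torus_lebesgue"
    by (auto intro: measurable_torusI simp: char_to_torus)
qed

lemma torus_not_AE_False: "\<not> (AE P in torus_lebesgue. False)"
proof
  assume "AE P in torus_lebesgue. False"
  then have "UNIV \<in> null_sets torus_lebesgue" using AE_iff_null[of torus_lebesgue "\<lambda>x. False"]
    by (metis (no_types, lifting) Collect_cong UNIV_def not_False_eq_True sets.top space_torus_lebesgue top_set_def UNIV_I)
  then show False using emeasure_torus_lebesgue_UNIV by (simp add: null_sets_def)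
qed

lemma AE_square_fst: "(AE x in circle_measure. P x) \<Longrightarrow> (AE p in square_measure. P (fst p))"
proof -
  assume "AE x in circle_measure. P x"
  then obtain N where "\<And>x. x \<in> space circle_measure - N \<Longrightarrow> P x" and N': "N \<in> null_sets circle_measure"
    by (rule AE_E3) blast
  then have N: "\<And>x. x \<notin> N \<Longrightarrow> P x" "N \<in> null_sets circle_measure" by auto
  have "AE p in circle_measure \<Otimes>\<^sub>M circle_measure. fst p \<notin> N"
  proof (rule square.AE_pair_measure)
    show "{x \<in> space (circle_measure \<Otimes>\<^sub>M circle_measure). fst x \<notin> N} \<in> sets (circle_measure \<Otimes>\<^sub>M circle_measure)"
    proof -
      have [measurable]: "N \<in> sets borel" using null_setsD2[OF N(2)] by simp
      show ?thesis by measurable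
    qed
    show "AE x in circle_measure. AE y in circle_measure. fst (x, y) \<notin> N"
      using AE_not_in[OF N(2)] by eventually_elim simp
  qed
  then show "AE p in square_measure. P (fst p)" unfolding square_measure_def
    by eventually_elim (rule N(1))
qed

text \<open>The Fourier coefficients of \<open>v\<close> in the fibre direction. The skew product translates the fibre over \<open>x\<close> by
  \<open>\<phi> x\<close>, which multiplies the coefficient with index \<open>m\<close> by \<open>e (m \<phi> x)\<close>. By completeness, \<open>v\<close> depends
  only on \<open>x\<close> if just the coefficient with index \<open>0\<close> is present.\<close>

lemma fibre_coefficients:
  assumes per: "periodic \<phi>" and [measurable]: "\<phi> \<in> borel_measurable borel"
    and v: "v \<in> borel_measurable torus_lebesgue" "\<And>P. norm (v P) \<le> 1"
    and eq: "AE p in square_measure. v (skew \<alpha> \<phi> (to_torus p)) = k (fst p) * v (to_torus p)"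
  obtains w :: "int \<Rightarrow> real \<Rightarrow> complex" where "\<And>m. bounded_borel (w m)"
    and "\<And>m. AE x in circle_measure. w m (frac (x + \<alpha>)) = cis2pi (of_int m * \<phi> x) * k x * w m x"
    and "(\<And>m. m \<noteq> 0 \<Longrightarrow> AE x in circle_measure. w m x = 0) \<Longrightarrow> AE p in square_measure. v (to_torus p) = w 0 (fst p)"
proof -
  obtain V where Vm: "V \<in> borel_measurable borel" and V1: "\<And>p. norm (V p) \<le> 1"
    and V: "AE p in square_measure. V p = v (to_torus p)"
    by (rule torus_function_borel_representative[OF v]) blast
  have [measurable]: "V \<in> borel_measurable (borel \<Otimes>\<^sub>M borel)" using Vm by (simp only: borel_prod)
  have Vx: "bounded_borel (\<lambda>y. V (x, y))" for x
    unfolding bounded_borel_def using V1 by (auto intro!: exI[of _ 1])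
  let ?\<sigma> = "\<lambda>p. (frac (fst p + \<alpha>), frac (snd p + \<phi> (fst p)))"
  have \<sigma>: "measure_preserving square_measure square_measure ?\<sigma>"
    by (rule measure_preserving_skew[OF measure_preserving_shift]) simp
  have "AE p in square_measure. V (?\<sigma> p) = v (to_torus (?\<sigma> p))" by (rule AE_measure_preserving[OF \<sigma> V])
  then have "AE p in square_measure. V (?\<sigma> p) = k (fst p) * V p"
    using V eq
  proof eventually_elim
    case (elim p)
    have "to_torus (?\<sigma> p) = skew \<alpha> \<phi> (to_torus p)"
      unfolding skew_to_torus[OF per]
      by (rule to_torus_eqI[of _ _ "- \<lfloor>fst p + \<alpha>\<rfloor>" "- \<lfloor>snd p + \<phi> (fst p)\<rfloor>"]) (simp_all add: skew_lift_def frac_def)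
    then show ?case using elim by simp
  qed
  then have Veq: "AE x in circle_measure. AE y in circle_measure. V (frac (x + \<alpha>), frac (y + \<phi> x)) = k x * V (x, y)"
    unfolding square_measure_def using square.AE_pair by force
  define w where "w m x = (LINT y|circle_measure. V (x, y) * cis2pi (of_int m * y))" for m :: int and x
  have wf: "w m x = fourier_coeff (\<lambda>y. V (x, y)) m" for m x by (simp add: w_def fourier_coeff_def)
  have wb: "bounded_borel (w m)" for m
    unfolding bounded_borel_def
  proof (intro conjI exI allI)
    show "w m \<in> borel_measurable borel" unfolding w_def[abs_def]
      by (rule circle.borel_measurable_lebesgue_integral) measurable
    fix x
    have "norm (w m x) \<le> (LINT y|circle_measure. norm (V (x, y) * cis2pi (of_int m * y)))"
      unfolding w_def by (rule integral_norm_bound)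
    also have "\<dots> \<le> (LINT y|circle_measure. 1)"
      by (rule integral_mono) (use integrable_norm[OF bounded_borel_integrable[OF Vx]] V1 in \<open>auto simp: norm_mult\<close>)
    finally show "norm (w m x) \<le> 1" by simp
  qed
  have weq: "AE x in circle_measure. w m (frac (x + \<alpha>)) = cis2pi (of_int m * \<phi> x) * k x * w m x" for m
    using Veq
  proof eventually_elim
    case (elim x)
    have "w m (frac (x + \<alpha>)) = (LINT y|circle_measure. V (frac (x + \<alpha>), frac (y + \<phi> x)) * cis2pi (of_int m * frac (y + \<phi> x)))"
      unfolding w_def by (rule integral_measure_preserving[OF measure_preserving_shift, symmetric]) measurable
    also have "\<dots> = (LINT y|circle_measure. cis2pi (of_int m * \<phi> x) * k x * (V (x, y) * cis2pi (of_int m * y)))"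
    proof (rule integral_cong_AE)
      show "AE y in circle_measure. V (frac (x + \<alpha>), frac (y + \<phi> x)) * cis2pi (of_int m * frac (y + \<phi> x))
        = cis2pi (of_int m * \<phi> x) * k x * (V (x, y) * cis2pi (of_int m * y))"
        using elim by eventually_elim (simp add: cis2pi_int_mult_frac distrib_left cis2pi_add)
    qed measurable
    also have "\<dots> = cis2pi (of_int m * \<phi> x) * k x * w m x" unfolding w_def by simp
    finally show ?case .
  qed
  have last: "AE p in square_measure. v (to_torus p) = w 0 (fst p)"
    if z: "\<And>m. m \<noteq> 0 \<Longrightarrow> AE x in circle_measure. w m x = 0"
  proof -
    have "AE x in circle_measure. \<forall>m. m \<noteq> 0 \<longrightarrow> w m x = 0"
      using z by (subst AE_all_countable) auto
    then have "AE x in circle_measure. AE y in circle_measure. V (x, y) = w 0 x"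
    proof eventually_elim
      case (elim x)
      let ?u = "\<lambda>y. V (x, y) + (- w 0 x)"
      have "AE y in circle_measure. ?u y = 0"
      proof (rule zero_coeffs_AE)
        show "bounded_borel ?u" by (intro bounded_borel_add Vx bounded_borel_const)
        fix m
        have "fourier_coeff ?u m = w m x - w 0 x * fourier_coeff (\<lambda>_. 1) m"
          unfolding wf fourier_coeff_def
          using fourier_integrable[OF Vx, of x m] fourier_integrable[OF bounded_borel_const[of 1], of m]
          by (simp add: algebra_simps Bochner_Integration.integral_diff)
        moreover have "fourier_coeff (\<lambda>_. 1) m = (if m = 0 then 1 else 0)"
        proof (cases "m = 0")
          case False
          \<comment> \<open>The constant function is invariant under the rotation by \<open>1 / (2m)\<close>.\<close>
          have "cis2pi (of_int m * (1 / (2 * of_int m))) = -1" using False by (simp add: cis2pi_def)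
          then show ?thesis
            using rotation_fourier_coeff[OF bounded_borel_const[of 1], where \<alpha> = "1 / (2 * of_int m)" and \<mu> = 1 and k = m] False by simp
        qed (simp add: fourier_coeff_def)
        ultimately show "fourier_coeff ?u m = 0" using elim by simp
      qed
      then show ?case by eventually_elim simp
    qed
    then have "AE p in square_measure. V p = w 0 (fst p)"
      unfolding square_measure_def
    proof (intro square.AE_pair_measure)
      have [measurable]: "w 0 \<in> borel_measurable borel" by (rule bounded_borel_measurable[OF wb])
      show "{p \<in> space (circle_measure \<Otimes>\<^sub>M circle_measure). V p = w 0 (fst p)} \<in> sets (circle_measure \<Otimes>\<^sub>M circle_measure)"
        by measurable
    qed simp
    with V show ?thesis by eventually_elim simp
  qed
  show ?thesis by (rule that[OF wb weq last])
qed

definition anzai :: "nat \<Rightarrow> (nat \<Rightarrow> real) \<Rightarrow> torus \<Rightarrow> torus" where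
  "anzai N b = skew (angle N) (cocycle b 0)"

context
  fixes b :: "nat \<Rightarrow> real"
  assumes b0: "\<And>j. 0 \<le> b j" and b1: "\<And>j. b j \<le> 1"
begin

lemma periodic_cocycle: "periodic (cocycle b r)"
  unfolding periodic_def using cocycle_add_int[of b, OF b0 b1] by blast

lemma measurable_cocycle [measurable]: "cocycle b r \<in> borel_measurable borel"
  by (rule borel_measurable_continuous_onI[OF cocycle_continuous[of b, OF b0 b1]])

lemma measure_preserving_anzai: "measure_preserving torus_lebesgue torus_lebesgue (anzai N b)"
  unfolding anzai_def by (rule measure_preserving_skew_torus[OF periodic_cocycle measurable_cocycle])

end

context
  fixes b :: "nat \<Rightarrow> real" and J :: nat and \<beta> :: real
  assumes b0: "\<And>j. 0 \<le> b j" and b1: "\<And>j. b j \<le> 1" and bJ: "\<And>j. J \<le> j \<Longrightarrow> b j = \<beta>"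
begin

text \<open>The coefficients with \<open>m \<noteq> 0\<close> vanish, because \<open>m f\<close> plus a constant is not a coboundary.\<close>

lemma anzai_eigenfunction:
  assumes v: "v \<in> borel_measurable torus_lebesgue" "\<And>P. norm (v P) \<le> 1"
    and eq: "AE P in torus_lebesgue. v (anzai N b P) = cis2pi \<theta> * v P"
  obtains w where "bounded_borel w" "AE x in circle_measure. w (frac (x + angle N)) = cis2pi \<theta> * w x"
    "AE p in square_measure. v (to_torus p) = w (fst p)"
proof -
  have eq': "AE p in square_measure. v (skew (angle N) (cocycle b 0) (to_torus p)) = cis2pi \<theta> * v (to_torus p)"
    using eq unfolding AE_torus_iff anzai_def .
  obtain w where w: "\<And>m. bounded_borel (w m)"
    "\<And>m. AE x in circle_measure. w m (frac (x + angle N)) = cis2pi (of_int m * cocycle b 0 x) * cis2pi \<theta> * w m x"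
    "(\<And>m. m \<noteq> 0 \<Longrightarrow> AE x in circle_measure. w m x = 0) \<Longrightarrow> AE p in square_measure. v (to_torus p) = w 0 (fst p)"
    by (rule fibre_coefficients[OF periodic_cocycle[of b, OF b0 b1] measurable_cocycle[of b, OF b0 b1] v eq']) blast
  have "AE x in circle_measure. w m x = 0" if "m \<noteq> 0" for m
  proof (rule lacunary_noncoboundary[of b, OF b0 b1 bJ _ w(1)])
    show "AE x in circle_measure. w m (frac (x + angle N)) =
       cis2pi (\<theta> - of_int (- m) * cocycle b 0 x - 0 * cocycle b 0 (0 - x)) * w m x"
      using w(2)[of m] by (simp add: cis2pi_add mult.commute)
  qed (use that in auto)
  then show ?thesis using that[OF w(1)[of 0] _ w(3)] w(2)[of 0] by simp
qed

lemma ergodic_anzai: "ergodic torus_lebesgue (anzai N b)"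
  unfolding ergodic_def
proof (intro conjI ballI impI measure_preserving_anzai[of b, OF b0 b1])
  fix A assume A: "A \<in> sets torus_lebesgue" and inv: "anzai N b -` A \<inter> space torus_lebesgue = A"
  let ?v = "indicator A :: torus \<Rightarrow> complex"
  have "?v (anzai N b P) = cis2pi 0 * ?v P" for P using inv by (auto simp: indicator_def)
  then obtain w where w: "bounded_borel w" "AE x in circle_measure. w (frac (x + angle N)) = cis2pi 0 * w x"
    "AE p in square_measure. ?v (to_torus p) = w (fst p)"
    by (rule_tac anzai_eigenfunction[of ?v N 0]) (use A in \<open>auto simp: indicator_def\<close>)
  have "AE x in circle_measure. w x = fourier_coeff w 0"
    using w(2) by (intro rotation_ergodic[OF angle_irrational w(1)]) simp
  then have "AE p in square_measure. w (fst p) = fourier_coeff w 0" by (rule AE_square_fst)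
  with w(3) have "AE p in square_measure. ?v (to_torus p) = fourier_coeff w 0" by eventually_elim simp
  then have c: "AE P in torus_lebesgue. ?v P = fourier_coeff w 0" by (simp add: AE_torus_iff)
  have null: "emeasure torus_lebesgue B = 0" if "B \<in> sets torus_lebesgue" "AE P in torus_lebesgue. P \<notin> B" for B
    using that AE_iff_null_sets[OF that(1)] by (auto simp: null_sets_def)
  show "emeasure torus_lebesgue A = 0 \<or> emeasure torus_lebesgue (space torus_lebesgue - A) = 0"
  proof (cases "fourier_coeff w 0 = 0")
    case True
    have "AE P in torus_lebesgue. P \<notin> A" using c by eventually_elim (auto simp: True indicator_def split: if_splits)
    then show ?thesis using null[OF A] by simp
  next
    case False
    have "AE P in torus_lebesgue. P \<notin> space torus_lebesgue - A" using c
    proof eventually_elim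
      case (elim P)
      then show ?case using False by (cases "P \<in> A") auto
    qed
    then show ?thesis using null[OF sets.compl_sets[OF A]] by blast
  qed
qed

lemma anzai_eigenvalues:
  assumes v: "v \<in> borel_measurable torus_lebesgue" "\<And>P. norm (v P) = 1"
    and eq: "AE P in torus_lebesgue. v (anzai N b P) = cis2pi \<theta> * v P"
  shows "\<exists>k::int. \<theta> + of_int k * angle N \<in> \<int>"
proof (rule ccontr)
  assume "\<not> ?thesis"
  then have ne: "cis2pi \<theta> * cis2pi (of_int k * angle N) \<noteq> 1" for k :: int
    by (simp add: cis2pi_eq_1_iff flip: cis2pi_add)
  obtain w where w: "bounded_borel w" "AE x in circle_measure. w (frac (x + angle N)) = cis2pi \<theta> * w x"
    "AE p in square_measure. v (to_torus p) = w (fst p)"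
    by (rule anzai_eigenfunction[OF v(1) _ eq]) (simp add: v(2))
  have "AE x in circle_measure. w x = 0" by (rule rotation_not_eigenvalue[OF w(1,2) ne])
  then have "AE p in square_measure. w (fst p) = 0" by (rule AE_square_fst)
  with w(3) have "AE p in square_measure. v (to_torus p) = 0" by eventually_elim simp
  then have "AE P in torus_lebesgue. v P = 0" by (simp add: AE_torus_iff)
  then have "AE P in torus_lebesgue. False" by eventually_elim (use v(2) in \<open>metis norm_zero zero_neq_one\<close>)
  then show False using torus_not_AE_False by blast
qed

text \<open>The conjugacy \<open>h\<close> maps the eigenfunction \<open>e x\<close> of the inverse to a multiple of \<open>e (- x)\<close>, so its first
  coordinate is \<open>c - x\<close>. The fibre coefficients \<open>w'\<close> of \<open>e y \<circ> h\<close> then solve a coboundary equation for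
  \<open>m f x - f (c - \<alpha> - x)\<close>; so all of them vanish, although \<open>e y \<circ> h\<close> has modulus one.\<close>

lemma anzai_not_reversible:
  assumes \<beta>: "\<beta> = 1"
  shows "\<not> measure_isomorphic torus_lebesgue (anzai N b) torus_lebesgue (inv (anzai N b))"
proof
  let ?\<alpha> = "angle N" and ?f = "cocycle b 0"
  assume "measure_isomorphic torus_lebesgue (anzai N b) torus_lebesgue (inv (anzai N b))"
  then obtain h where h: "measure_preserving torus_lebesgue torus_lebesgue h"
    and conj: "AE P in torus_lebesgue. h (anzai N b P) = inv (anzai N b) (h P)"
    unfolding measure_isomorphic_def by blast
  have hm: "h \<in> measurable torus_lebesgue torus_lebesgue" using h by (simp add: measure_preserving_def)
  have inv: "inv (anzai N b) = skew (- ?\<alpha>) (\<lambda>x. - ?f (x - ?\<alpha>))"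
    unfolding anzai_def by (rule inv_skew[OF periodic_cocycle[of b, OF b0 b1]])
  note per' = periodic_inverse[OF periodic_cocycle[of b, OF b0 b1, of 0], of "?\<alpha>"]
  have v1: "(\<lambda>P. char_x (h P)) \<in> borel_measurable torus_lebesgue" and v2: "(\<lambda>P. char_y (h P)) \<in> borel_measurable torus_lebesgue"
    by (rule measurable_compose[OF hm measurable_char(1)], rule measurable_compose[OF hm measurable_char(2)])
  have e1: "AE P in torus_lebesgue. char_x (h (anzai N b P)) = cis2pi (- ?\<alpha>) * char_x (h P)"
    using conj by eventually_elim (simp add: inv skew_char_x[OF per'])
  obtain w where w: "bounded_borel w" "AE x in circle_measure. w (frac (x + ?\<alpha>)) = cis2pi (- ?\<alpha>) * w x"
    "AE p in square_measure. char_x (h (to_torus p)) = w (fst p)"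
    by (rule anzai_eigenfunction[OF v1 _ e1]) auto
  define u where "u x = w x * cis2pi x" for x
  have u: "bounded_borel u" unfolding u_def[abs_def] by (intro bounded_borel_mult w bounded_borel_cis2pi) auto
  have "AE x in circle_measure. u (frac (x + ?\<alpha>)) = u x"
    using w(2) by eventually_elim (simp add: u_def cis2pi_add, metis cis2pi_minus(1) mult.assoc mult.commute mult_1)
  then have "AE x in circle_measure. u x = fourier_coeff u 0" by (rule rotation_ergodic[OF angle_irrational u])
  then have "AE p in square_measure. u (fst p) = fourier_coeff u 0" by (rule AE_square_fst)
  with w(3) have cu: "AE p in square_measure. char_x (h (to_torus p)) * cis2pi (fst p) = fourier_coeff u 0"
    by eventually_elim (simp add: u_def)
  have "norm (fourier_coeff u 0) = 1"
  proof (rule ccontr)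
    assume ne: "norm (fourier_coeff u 0) \<noteq> 1"
    have "AE p in square_measure. False"
      using cu by eventually_elim (use ne in \<open>metis norm_mult norm_char(1) norm_cis2pi mult_1\<close>)
    then show False using torus_not_AE_False AE_torus_iff[of "\<lambda>_. False"] by simp
  qed
  then obtain c where c: "fourier_coeff u 0 = cis2pi c"
  proof -
    assume n1: "norm (fourier_coeff u 0) = 1" and *: "\<And>c. fourier_coeff u 0 = cis2pi c \<Longrightarrow> thesis"
    have "fourier_coeff u 0 = rcis 1 (Arg (fourier_coeff u 0))" using rcis_cmod_Arg[of "fourier_coeff u 0"] n1 by simp
    then have "fourier_coeff u 0 = cis2pi (Arg (fourier_coeff u 0) / (2 * pi))" by (simp add: cis2pi_def rcis_def)
    then show thesis by (rule *)
  qed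
  have e2: "AE p in square_measure. char_y (h (skew ?\<alpha> ?f (to_torus p))) = cis2pi (- ?f (c - ?\<alpha> - fst p)) * char_y (h (to_torus p))"
    using cu conj[unfolded AE_torus_iff]
  proof eventually_elim
    case (elim p)
    obtain x' y' where h': "h (to_torus p) = to_torus (x', y')" by (rule torus_cases)
    have "cis2pi x' * cis2pi (fst p) = cis2pi c" using elim(1) by (simp add: h' char_to_torus c)
    then have "cis2pi (x' + fst p) = cis2pi c" by (simp add: cis2pi_add)
    then have "x' + fst p - c \<in> \<int>" by (rule cis2pi_eqD)
    then have "(x' - ?\<alpha>) - (c - ?\<alpha> - fst p) \<in> \<int>" by (simp add: algebra_simps)
    then have "?f (x' - ?\<alpha>) = ?f (c - ?\<alpha> - fst p)" by (rule periodic_eq[OF periodic_cocycle[of b, OF b0 b1]])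
    then have "char_y (inv (anzai N b) (h (to_torus p))) = cis2pi (- ?f (c - ?\<alpha> - fst p)) * char_y (h (to_torus p))"
      unfolding inv h' skew_to_torus[OF per'] by (simp add: skew_lift_def char_to_torus cis2pi_add[symmetric])
    then show ?case using elim(2) by (simp add: anzai_def)
  qed
  obtain w' where w': "\<And>m. bounded_borel (w' m)"
    "\<And>m. AE x in circle_measure. w' m (frac (x + ?\<alpha>)) = cis2pi (of_int m * ?f x) * cis2pi (- ?f (c - ?\<alpha> - x)) * w' m x"
    "(\<And>m. m \<noteq> 0 \<Longrightarrow> AE x in circle_measure. w' m x = 0) \<Longrightarrow> AE p in square_measure. char_y (h (to_torus p)) = w' 0 (fst p)"
    by (rule fibre_coefficients[OF periodic_cocycle[of b, OF b0 b1] measurable_cocycle[of b, OF b0 b1] v2 _ e2]) auto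
  have z: "AE x in circle_measure. w' m x = 0" for m
  proof (rule lacunary_noncoboundary[of b, OF b0 b1 bJ _ w'(1)])
    show "AE x in circle_measure. w' m (frac (x + ?\<alpha>)) =
       cis2pi (0 - of_int (- m) * ?f x - 1 * ?f ((c - ?\<alpha>) - x)) * w' m x"
      using w'(2)[of m] by (simp flip: cis2pi_add)
  qed (use \<beta> in auto)
  have "AE p in square_measure. w' 0 (fst p) = 0" by (rule AE_square_fst[OF z])
  with w'(3)[OF z] have "AE p in square_measure. char_y (h (to_torus p)) = 0" by eventually_elim simp
  then have "AE p in square_measure. False" by eventually_elim (metis norm_char(2) norm_zero zero_neq_one)
  then show False using torus_not_AE_False AE_torus_iff[of "\<lambda>_. False"] by simp
qed

end

text \<open>An isomorphism would make \<open>e (angle N)\<close> an eigenvalue of the first map, so that \<open>angle N\<close> is an integral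
  multiple of \<open>angle M\<close> modulo 1. The irrational parts force the multiplier to be \<open>1\<close>, and then the dyadic
  parts agree.\<close>

lemma anzai_not_isomorphic:
  assumes b: "\<And>j. 0 \<le> b j" "\<And>j. b j \<le> 1" "\<And>j. J \<le> j \<Longrightarrow> b j = \<beta>"
    and b': "\<And>j. 0 \<le> b' j" "\<And>j. b' j \<le> 1" and ne: "M \<noteq> N"
  shows "\<not> measure_isomorphic torus_lebesgue (anzai M b) torus_lebesgue (anzai N b')"
proof
  assume "measure_isomorphic torus_lebesgue (anzai M b) torus_lebesgue (anzai N b')"
  then obtain h where h: "measure_preserving torus_lebesgue torus_lebesgue h"
    and conj: "AE P in torus_lebesgue. h (anzai M b P) = anzai N b' (h P)"
    unfolding measure_isomorphic_def by blast
  have hm: "h \<in> measurable torus_lebesgue torus_lebesgue" using h by (simp add: measure_preserving_def)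
  have per': "periodic (cocycle b' 0)" unfolding periodic_def using cocycle_add_int[of b', OF b'] by blast
  have v: "(\<lambda>P. char_x (h P)) \<in> borel_measurable torus_lebesgue" by (rule measurable_compose[OF hm measurable_char(1)])
  have e: "AE P in torus_lebesgue. char_x (h (anzai M b P)) = cis2pi (angle N) * char_x (h P)"
    using conj by eventually_elim (simp add: anzai_def skew_char_x[OF per'])
  obtain k :: int where k: "angle N + of_int k * angle M \<in> \<int>"
    using anzai_eigenvalues[of b J \<beta>, OF b v _ e] by auto
  then obtain n :: int where n: "angle N + of_int k * angle M = of_int n" by (auto elim: Ints_cases)
  show False
  proof (cases "k = -1")
    case False
    define q r :: real where "q = 1 / 2 ^ (N + 1)" and "r = 1 / 2 ^ (M + 1)"
    have "liouville * of_int (1 + k) = of_int n - q - of_int k * r"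
      using n by (simp add: angle_def q_def r_def algebra_simps del: power_Suc)
    moreover have "real_of_int (1 + k) \<noteq> 0" using False by linarith
    ultimately have "liouville = (of_int n - q - of_int k * r) / of_int (1 + k)" by (metis eq_divide_imp)
    also have "\<dots> \<in> \<rat>" unfolding q_def r_def by (intro Rats_divide Rats_diff Rats_mult Rats_power Rats_of_int) auto
    finally show False using liouville_irrational by simp
  next
    case True
    have lt: "0 < (1::real) / 2 ^ (K + 1)" "(1::real) / 2 ^ (K + 1) < 1" for K
      using one_less_power[of "2::real" "K + 1"] by (simp_all del: power_Suc)
    have d: "1 / 2 ^ (N + 1) - 1 / 2 ^ (M + 1) = real_of_int n" using n True by (simp add: angle_def)
    then have "\<bar>real_of_int n\<bar> < 1" using lt[of N] lt[of M] by linarith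
    then have "n = 0" by linarith
    then have "(2::real) ^ (N + 1) = 2 ^ (M + 1)" using d by (simp add: field_simps del: power_Suc)
    then have "N + 1 = M + 1" by (simp del: power_Suc)
    then show False using ne by simp
  qed
qed

text \<open>The cocycle is odd, hence \<open>(x, y) \<mapsto> (\<alpha> - x, y)\<close> is a conjugacy.\<close>

lemma anzai_reversible:
  assumes b: "\<And>j. b j = 0"
  shows "measure_isomorphic torus_lebesgue (anzai N b) torus_lebesgue (inv (anzai N b))"
proof -
  let ?\<alpha> = "angle N" and ?f = "cocycle b 0"
  have b01: "0 \<le> b j" "b j \<le> 1" for j by (simp_all add: b)
  have per: "periodic ?f" unfolding periodic_def using cocycle_add_int[of b, OF b01] by blast
  note per' = periodic_inverse[OF per, of "?\<alpha>"]
  have odd: "?f (- x) = - ?f x" for x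
  proof -
    have "cocycle_term b 0 j (- x) = - cocycle_term b 0 j x" for j
      by (simp add: cocycle_term_def osc_def b minus_divide_left)
    then show ?thesis unfolding cocycle_def by (simp add: suminf_minus[OF summable_cocycle[of b, OF b01]])
  qed
  let ?G = "\<lambda>p. (?\<alpha> - fst p, snd p)"
  define h where "h = torus_map ?G"
  have h: "h (to_torus p) = to_torus (?G p)" for p
    unfolding h_def by (rule torus_map_to_torus) (auto simp: to_torus_eq_iff intro: minus_in_Ints_iff[THEN iffD1])
  have mp: "measure_preserving torus_lebesgue torus_lebesgue h"
  proof (rule measure_preserving_torusI)
    show "measure_preserving square_measure square_measure (\<lambda>p. (frac (?\<alpha> - fst p), frac (snd p + (\<lambda>_. 0) (fst p))))"
      by (rule measure_preserving_skew[OF measure_preserving_reflect]) simp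
    show "to_torus (frac (?\<alpha> - fst p), frac (snd p + (\<lambda>_. 0) (fst p))) = h (to_torus p)" for p
      unfolding h by (rule to_torus_eqI[of _ _ "- \<lfloor>?\<alpha> - fst p\<rfloor>" "- \<lfloor>snd p\<rfloor>"]) (simp_all add: frac_def)
  qed
  have hh: "h (h P) = P" for P by (rule torus_cases[of P]) (simp add: h)
  have "h (anzai N b P) = inv (anzai N b) (h P)" for P
  proof (rule torus_cases[of P])
    fix x y assume P: "P = to_torus (x, y)"
    show ?thesis
      unfolding P anzai_def inv_skew[OF per] skew_to_torus[OF per] h skew_to_torus[OF per']
      using odd[of x] by (simp add: skew_lift_def)
  qed
  then show ?thesis unfolding measure_isomorphic_def using mp hh by (intro exI[of _ h]) auto
qed


section \<open>Smoothness\<close>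

text \<open>A family of functions that contains the coordinates of the lift of a skew product and is closed under partial
  derivatives, when \<open>D\<close> lists the successive derivatives of \<open>D 0\<close>.\<close>

definition jet_form :: "(nat \<Rightarrow> real \<Rightarrow> real) \<Rightarrow> real \<Rightarrow> real \<Rightarrow> real \<Rightarrow> real \<Rightarrow> nat \<Rightarrow> real \<times> real \<Rightarrow> real" where
  "jet_form D c\<^sub>0 c\<^sub>1 c\<^sub>2 c\<^sub>3 r p = c\<^sub>0 + c\<^sub>1 * fst p + c\<^sub>2 * snd p + c\<^sub>3 * D r (fst p)"

context
  fixes D :: "nat \<Rightarrow> real \<Rightarrow> real"
  assumes D: "\<And>r x. (D r has_real_derivative D (Suc r) x) (at x)"
begin

lemma jet_form_deriv_x:
  "((\<lambda>t. jet_form D c\<^sub>0 c\<^sub>1 c\<^sub>2 c\<^sub>3 r (t, y)) has_real_derivative jet_form D c\<^sub>1 0 0 c\<^sub>3 (Suc r) (x, y)) (at x)"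
  unfolding jet_form_def by (auto intro!: derivative_eq_intros D)

lemma jet_form_deriv_y:
  "((\<lambda>t. jet_form D c\<^sub>0 c\<^sub>1 c\<^sub>2 c\<^sub>3 r (x, t)) has_real_derivative jet_form D c\<^sub>2 0 0 0 r (x, y)) (at y)"
  unfolding jet_form_def by (auto intro!: derivative_eq_intros)

lemma partial_jet_form:
  "partial_x (jet_form D c\<^sub>0 c\<^sub>1 c\<^sub>2 c\<^sub>3 r) = jet_form D c\<^sub>1 0 0 c\<^sub>3 (Suc r)"
  "partial_y (jet_form D c\<^sub>0 c\<^sub>1 c\<^sub>2 c\<^sub>3 r) = jet_form D c\<^sub>2 0 0 0 r"
  unfolding partial_x_def partial_y_def
  by (auto simp: fun_eq_iff DERIV_imp_deriv[OF jet_form_deriv_x] DERIV_imp_deriv[OF jet_form_deriv_y])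

lemma jet_form_continuous: "continuous_on UNIV (jet_form D c\<^sub>0 c\<^sub>1 c\<^sub>2 c\<^sub>3 r)"
proof -
  have "continuous_on UNIV (D r)"
    by (intro continuous_at_imp_continuous_on ballI DERIV_isCont[OF D])
  then have "continuous_on UNIV (\<lambda>p :: real \<times> real. D r (fst p))"
    by (rule continuous_on_compose2) (auto intro!: continuous_intros)
  then show ?thesis unfolding jet_form_def[abs_def] by (intro continuous_intros)
qed

lemma C_k_jet_form: "C_k k (jet_form D c\<^sub>0 c\<^sub>1 c\<^sub>2 c\<^sub>3 r)"
proof (induction k arbitrary: c\<^sub>0 c\<^sub>1 c\<^sub>2 c\<^sub>3 r)
  case (Suc k)
  have "(\<lambda>t. jet_form D c\<^sub>0 c\<^sub>1 c\<^sub>2 c\<^sub>3 r (t, y)) differentiable at x" "(\<lambda>t. jet_form D c\<^sub>0 c\<^sub>1 c\<^sub>2 c\<^sub>3 r (x, t)) differentiable at y" for x y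
    unfolding real_differentiable_def using jet_form_deriv_x jet_form_deriv_y by blast+
  then show ?case using Suc by (simp add: jet_form_continuous partial_jet_form)
qed (simp add: jet_form_continuous)

lemma skew_lift_jet_form:
  "(\<lambda>p. fst (skew_lift \<alpha> (D 0) p)) = jet_form D \<alpha> 1 0 0 0"
  "(\<lambda>p. snd (skew_lift \<alpha> (D 0) p)) = jet_form D 0 0 1 1 0"
  by (auto simp: skew_lift_def jet_form_def fun_eq_iff)

lemma smooth_lift_skew:
  assumes "periodic (D 0)" shows "smooth_lift (skew_lift \<alpha> (D 0)) (skew \<alpha> (D 0))"
  unfolding smooth_lift_def C_infinity_def skew_lift_jet_form
  by (simp add: C_k_jet_form skew_to_torus[OF assms])

lemma iterated_partial_jet_form:
  "(partial_y ^^ j) (jet_form D c\<^sub>0 c\<^sub>1 c\<^sub>2 c\<^sub>3 r) =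
     (if j = 0 then jet_form D c\<^sub>0 c\<^sub>1 c\<^sub>2 c\<^sub>3 r else if j = 1 then jet_form D c\<^sub>2 0 0 0 r else jet_form D 0 0 0 0 r)"
  "(partial_x ^^ i) (jet_form D c\<^sub>0 c\<^sub>1 c\<^sub>2 c\<^sub>3 r) =
     (if i = 0 then jet_form D c\<^sub>0 c\<^sub>1 c\<^sub>2 c\<^sub>3 r else if i = 1 then jet_form D c\<^sub>1 0 0 c\<^sub>3 (Suc r) else jet_form D 0 0 0 c\<^sub>3 (i + r))"
proof -
  show "(partial_y ^^ j) (jet_form D c\<^sub>0 c\<^sub>1 c\<^sub>2 c\<^sub>3 r) =
     (if j = 0 then jet_form D c\<^sub>0 c\<^sub>1 c\<^sub>2 c\<^sub>3 r else if j = 1 then jet_form D c\<^sub>2 0 0 0 r else jet_form D 0 0 0 0 r)"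
    by (induction j) (auto simp: partial_jet_form)
  show "(partial_x ^^ i) (jet_form D c\<^sub>0 c\<^sub>1 c\<^sub>2 c\<^sub>3 r) =
     (if i = 0 then jet_form D c\<^sub>0 c\<^sub>1 c\<^sub>2 c\<^sub>3 r else if i = 1 then jet_form D c\<^sub>1 0 0 c\<^sub>3 (Suc r) else jet_form D 0 0 0 c\<^sub>3 (i + r))"
    by (induction i) (auto simp: partial_jet_form)
qed

lemma mixed_partial_skew_lift:
  assumes "i + j \<ge> 1"
  shows "mixed_partial i j (skew_lift \<alpha> (D 0)) p =
    (if j = 0 then (if i = 1 then 1 else 0, D i (fst p)) else if i = 0 \<and> j = 1 then (0, 1) else (0, 0))"
  unfolding mixed_partial_def skew_lift_jet_form iterated_partial_jet_form(1)
  using assms by (auto simp: iterated_partial_jet_form partial_jet_form jet_form_def)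

end

lemma torus_diffeomorphism_skew:
  assumes D: "\<And>r x. (D r has_real_derivative D (Suc r) x) (at x)" and per: "periodic (D 0)"
  shows "torus_diffeomorphism (skew \<alpha> (D 0))"
proof -
  have D': "((\<lambda>x. - D r (x - \<alpha>)) has_real_derivative - D (Suc r) (x - \<alpha>)) (at x)" for r x
  proof -
    have "((\<lambda>x. D r (x - \<alpha>)) has_real_derivative D (Suc r) (x - \<alpha>) * 1) (at x)"
      by (rule DERIV_chain'[OF _ D]) (auto intro!: derivative_eq_intros)
    then show ?thesis by (auto intro!: derivative_eq_intros)
  qed
  have "smooth_lift (skew_lift (- \<alpha>) (\<lambda>x. - D 0 (x - \<alpha>))) (inv (skew \<alpha> (D 0)))"
    unfolding inv_skew[OF per] using smooth_lift_skew[of "\<lambda>r x. - D r (x - \<alpha>)", OF D' periodic_inverse[OF per]] .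
  then show ?thesis
    unfolding torus_diffeomorphism_def using bij_skew[OF per] smooth_lift_skew[of D, OF D per] by blast
qed


section \<open>The skew products are uniformly computable\<close>

definition weight :: "nat \<Rightarrow> nat \<Rightarrow> real" where
  "weight N j = of_bool (refuted N j)"

lemma weight_bounds: "0 \<le> weight N j" "weight N j \<le> 1"
  by (simp_all add: weight_def)

lemma PR_lac [PR_intros]: "PR f \<Longrightarrow> PR (\<lambda>x. lac (f x))"
  unfolding lac_def by (intro PR_intros)

lemma CR_divide_power2 [CR_intros]:
  assumes "CR r" "PR h" shows "CR (\<lambda>x. r x / 2 ^ h x)"
proof -
  have "CR (\<lambda>x. r x / real (2 ^ h x))" by (rule CR_divide_nat[OF assms(1)]) (auto intro!: PR_intros assms)
  then show ?thesis by simp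
qed

lemma CR_liouville [CR_intros]: "CR (\<lambda>x. liouville)"
proof (rule CR_lim[where R = "\<lambda>x n. \<Sum>i<Suc n. 1 / 2 ^ lac i"])
  show "CR (\<lambda>z. \<Sum>i<Suc (snd z). 1 / 2 ^ lac i)" by (intro CR_intros PR_intros)
  fix n
  have "(2::real) ^ (n + 1) \<le> 2 ^ lac (Suc n)" using lac_ge[of "Suc n"] by (intro power_increasing) auto
  then have "(2::real) / 2 ^ lac (Suc n) \<le> 2 / 2 ^ (n + 1)" by (intro frac_le) auto
  then have "liouville_tail n \<le> 2 / 2 ^ (n + 1)" using liouville_tail_le[of n] by linarith
  then show "\<bar>(\<Sum>i<Suc n. 1 / 2 ^ lac i) - liouville\<bar> \<le> 1 / 2 ^ n"
    using liouville_split[of "Suc n"] liouville_tail_pos[of n] by (simp add: liouville_tail_def)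
qed

lemma CR_angle [CR_intros]: "PR f \<Longrightarrow> CR (\<lambda>x. angle (f x))"
  unfolding angle_def by (intro CR_intros PR_intros)

lemma CR_osc: "PR r \<Longrightarrow> CR \<beta> \<Longrightarrow> CR y \<Longrightarrow> CR (\<lambda>z. osc (r z) (\<beta> z) (y z))"
  unfolding osc_def by (intro CR_intros PR_intros)

lemma CR_cocycle [CR_intros]:
  assumes N: "PR N" and r: "PR r" and y: "CR y"
  shows "CR (\<lambda>z. cocycle (weight (N z)) (r z) (y z))"
proof (rule CR_lim[where R = "\<lambda>z n. \<Sum>j<n + 5 * r z + 3. cocycle_term (weight (N z)) (r z) j (y z)"])
  show "CR (\<lambda>z. \<Sum>j<snd z + 5 * r (fst z) + 3. cocycle_term (weight (N (fst z))) (r (fst z)) j (y (fst z)))"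
    unfolding cocycle_term_def weight_def
    by (intro CR_intros CR_osc PR_intros PR_comp[OF N] PR_comp[OF r] CR_comp[OF y])
  fix z n
  define k where "k = n + 5 * r z + 3"
  have "\<bar>cocycle (weight (N z)) (r z) (y z) - (\<Sum>j<k. cocycle_term (weight (N z)) (r z) j (y z))\<bar> \<le> 3 * 16 ^ r z * (2 / 2 ^ lac k)"
    by (rule cocycle_partial_sum[of "weight (N z)", OF weight_bounds]) (simp add: k_def)
  also have "\<dots> \<le> 4 * 16 ^ r z * (2 / 2 ^ (n + 4 * r z + 3))"
    by (intro mult_mono divide_left_mono power_increasing) (use lac_ge[of k] in \<open>auto simp: k_def\<close>)
  also have "\<dots> = 1 / 2 ^ n" by (simp add: power_add power_mult)
  finally show "\<bar>(\<Sum>j<n + 5 * r z + 3. cocycle_term (weight (N z)) (r z) j (y z)) - cocycle (weight (N z)) (r z) (y z)\<bar> \<le> 1 / 2 ^ n"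
    by (simp add: k_def abs_minus_commute)
qed

text \<open>The number of additional binary digits of the argument that are needed for the derivatives of order \<open>k\<close>.
  The precision \<open>n\<close> can be recovered from the length \<open>n + offset k\<close> of the input.\<close>

definition offset :: "nat \<Rightarrow> nat" where
  "offset k = cocycle_bound (Suc k) + 3"

lemma PR_offset [PR_intros]: "PR f \<Longrightarrow> PR (\<lambda>x. offset (f x))"
  unfolding offset_def cocycle_bound_def by (intro PR_intros)

lemma offset_scale: "(1 + real (cocycle_bound (Suc k))) * (1 / 2 ^ (n + offset k)) \<le> (1 / 8) / 2 ^ n"
proof -
  have "cocycle_bound (Suc k) + 1 \<le> 2 ^ cocycle_bound (Suc k)"
    unfolding Suc_eq_plus1[symmetric] by (rule Suc_leI[OF less_exp])
  then have "real (cocycle_bound (Suc k) + 1) \<le> 2 ^ cocycle_bound (Suc k)"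
    by (simp only: of_nat_le_numeral_power_cancel_iff)
  then have "(1 + real (cocycle_bound (Suc k))) * (1 / 2 ^ (n + offset k)) \<le> 2 ^ cocycle_bound (Suc k) * (1 / 2 ^ (n + offset k))"
    by (intro mult_right_mono) auto
  also have "\<dots> = (1 / 8) / 2 ^ n" by (simp add: offset_def power_add)
  finally show ?thesis .
qed

definition digit_list :: "digits \<Rightarrow> nat list" where
  "digit_list s = map (\<lambda>(a, b). 2 * of_bool a + of_bool b) s"

lemma encode_digit_list: "encode (digit_list s) = digits_code s"
  by (simp add: digit_list_def digits_code_def encode_list_def encode_nat_def[abs_def] o_def)

lemma length_digit_list [simp]: "length (digit_list s) = length s"
  by (simp add: digit_list_def)

definition numer_x :: "nat list \<Rightarrow> nat" where
  "numer_x xs = (\<Sum>i<length xs. (hd (drop i xs) div 2) * 2 ^ (length xs - Suc i))"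
definition numer_y :: "nat list \<Rightarrow> nat" where
  "numer_y xs = (\<Sum>i<length xs. (hd (drop i xs) mod 2) * 2 ^ (length xs - Suc i))"

lemma PR_numer [PR_intros]:
  assumes "PR f" shows "PR (\<lambda>x. numer_x (f x))" "PR (\<lambda>x. numer_y (f x))"
  unfolding numer_x_def numer_y_def by (intro PR_intros PR_fst_arg[of f] assms)+

lemma binary_value_numer: "binary_value bs = real (\<Sum>i<length bs. of_bool (bs ! i) * 2 ^ (length bs - Suc i)) / 2 ^ length bs"
  unfolding binary_value_def of_nat_sum sum_divide_distrib
proof (rule sum.cong)
  fix i assume "i \<in> {..<length bs}"
  then have "length bs = (length bs - Suc i) + Suc i" by simp
  then have "(2::real) ^ length bs = 2 ^ (length bs - Suc i) * 2 ^ Suc i" by (metis power_add)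
  then show "of_bool (bs ! i) / 2 ^ Suc i = real (of_bool (bs ! i) * 2 ^ (length bs - Suc i)) / 2 ^ length bs"
    by simp
qed simp

lemma digits_point_eq:
  "digits_point s = (real (numer_x (digit_list s)) / 2 ^ length s, real (numer_y (digit_list s)) / 2 ^ length s)"
proof -
  have "(\<Sum>i<length s. of_bool (map fst s ! i) * 2 ^ (length s - Suc i)) = numer_x (digit_list s)"
    "(\<Sum>i<length s. of_bool (map snd s ! i) * 2 ^ (length s - Suc i)) = numer_y (digit_list s)"
    unfolding numer_x_def numer_y_def length_digit_list
    by (rule sum.cong; auto simp: digit_list_def hd_drop_conv_nth split: prod.split)+
  then show ?thesis unfolding digits_point_def binary_value_numer by simp
qed

definition bits :: "nat \<Rightarrow> nat \<Rightarrow> bool list" where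
  "bits n u = map (\<lambda>i. odd (u div 2 ^ (n - Suc i))) [0..<n]"

lemma sum_bits: "(\<Sum>i<n. of_bool (odd (u div 2 ^ i)) * 2 ^ i) = (u mod 2 ^ n :: nat)"
proof (induction n)
  case (Suc n)
  have "u mod 2 ^ Suc n = 2 ^ n * (u div 2 ^ n mod 2) + u mod 2 ^ n"
    using mod_mult2_eq[of u "2 ^ n" 2] by (simp add: mult.commute)
  then show ?case using Suc by (simp add: odd_iff_mod_2_eq_one of_bool_def)
qed simp

lemma binary_value_bits: "u < 2 ^ n \<Longrightarrow> binary_value (bits n u) = real u / 2 ^ n"
proof -
  assume u: "u < 2 ^ n"
  have l: "length (bits n u) = n" by (simp add: bits_def)
  have "(\<Sum>i<n. of_bool (bits n u ! i) * 2 ^ (n - Suc i)) = (\<Sum>i<n. of_bool (odd (u div 2 ^ (n - Suc i))) * 2 ^ (n - Suc i) :: nat)"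
    by (rule sum.cong) (auto simp: bits_def)
  also have "\<dots> = (\<Sum>i<n. of_bool (odd (u div 2 ^ i)) * 2 ^ i)"
    by (rule sum.nat_diff_reindex[of "\<lambda>i. of_bool (odd (u div 2 ^ i)) * 2 ^ i"])
  also have "\<dots> = u" using u by (simp add: sum_bits)
  finally show ?thesis unfolding binary_value_numer l by simp
qed

lemma torus_dist_to_torus:
  "torus_dist (to_torus p) (to_torus q) = max (circle_norm (fst p - fst q)) (circle_norm (snd p - snd q))"
  by (simp add: torus_dist.abs_eq)

lemma digits_cell_dist:
  assumes "p \<in> digits_cell s"
  shows "\<bar>fst p - fst (digits_point s)\<bar> \<le> 1 / 2 ^ length s" "\<bar>snd p - snd (digits_point s)\<bar> \<le> 1 / 2 ^ length s"
  using assms by (auto simp: digits_cell_def Let_def split: prod.splits)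

context
  fixes N :: nat
begin

abbreviation (input) "f\<^sub>N \<equiv> cocycle (weight N)"

lemma skew_lift_Lipschitz:
  assumes "\<bar>x - x'\<bar> \<le> 1 / 2 ^ (n + offset 0)" "\<bar>y - y'\<bar> \<le> 1 / 2 ^ (n + offset 0)"
  shows "\<bar>(y + f\<^sub>N 0 x) - (y' + f\<^sub>N 0 x')\<bar> \<le> (1 / 8) / 2 ^ n"
proof -
  have "\<bar>f\<^sub>N 0 x - f\<^sub>N 0 x'\<bar> \<le> real (cocycle_bound (Suc 0)) * \<bar>x - x'\<bar>" by (rule cocycle_Lipschitz[of "weight N", OF weight_bounds])
  also have "\<dots> \<le> real (cocycle_bound (Suc 0)) * (1 / 2 ^ (n + offset 0))" by (intro mult_left_mono assms) auto
  finally have "\<bar>(y + f\<^sub>N 0 x) - (y' + f\<^sub>N 0 x')\<bar>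
      \<le> 1 / 2 ^ (n + offset 0) + real (cocycle_bound (Suc 0)) * (1 / 2 ^ (n + offset 0))"
    using assms(2) by linarith
  also have "\<dots> = (1 + real (cocycle_bound (Suc 0))) * (1 / 2 ^ (n + offset 0))"
    by (simp only: distrib_right mult_1_left)
  also have "\<dots> \<le> (1 / 8) / 2 ^ n" by (rule offset_scale)
  finally show ?thesis .
qed

lemma small_offset: "(1::real) / 2 ^ (n + offset k) \<le> (1 / 8) / 2 ^ n"
proof -
  have "1 * (1 / 2 ^ (n + offset k)) \<le> (1 + real (cocycle_bound (Suc k))) * (1 / 2 ^ (n + offset k))"
    by (intro mult_right_mono) auto
  then show ?thesis using offset_scale[of k n] by linarith
qed

lemma anzai_to_torus: "anzai N (weight N) (to_torus p) = to_torus (skew_lift (angle N) (f\<^sub>N 0) p)"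
  unfolding anzai_def by (rule skew_to_torus[OF periodic_cocycle[of "weight N", OF weight_bounds]])

lemma anzai_modulus:
  assumes "torus_dist P Q \<le> 1 / 2 ^ (n + offset 0)"
  shows "torus_dist (anzai N (weight N) P) (anzai N (weight N) Q) \<le> 1 / 2 ^ n"
proof -
  obtain x y where P: "P = to_torus (x, y)" by (rule torus_cases)
  obtain x' y' where Q: "Q = to_torus (x', y')" by (rule torus_cases)
  obtain k :: int where k: "circle_norm (x - x') = \<bar>x - x' - of_int k\<bar>" using circle_norm_attained by blast
  obtain l :: int where l: "circle_norm (y - y') = \<bar>y - y' - of_int l\<bar>" using circle_norm_attained by blast
  have d: "circle_norm (x - x') \<le> 1 / 2 ^ (n + offset 0)" "circle_norm (y - y') \<le> 1 / 2 ^ (n + offset 0)"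
    using assms by (simp_all add: P Q torus_dist_to_torus)
  have "\<bar>(y + f\<^sub>N 0 x) - ((y' + of_int l) + f\<^sub>N 0 (x' + of_int k))\<bar> \<le> (1 / 8) / 2 ^ n"
    by (rule skew_lift_Lipschitz) (use d k l in \<open>simp_all add: algebra_simps\<close>)
  then have "\<bar>(y + f\<^sub>N 0 x) - (y' + f\<^sub>N 0 x') - of_int l\<bar> \<le> (1 / 8) / 2 ^ n"
    by (simp add: cocycle_add_int[of "weight N", OF weight_bounds] algebra_simps)
  then have "circle_norm ((y + f\<^sub>N 0 x) - (y' + f\<^sub>N 0 x')) \<le> (1 / 8) / 2 ^ n"
    using circle_norm_le_dist order_trans by blast
  moreover have "(1::real) / 8 / 2 ^ n \<le> 1 / 2 ^ n" by (intro divide_right_mono) auto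
  ultimately show ?thesis
    using d(1) small_offset[of n 0] by (simp add: P Q anzai_to_torus skew_lift_def torus_dist_to_torus)
qed

lemma cocycle_cell:
  assumes "length s = n + offset k" "p \<in> digits_cell s"
  shows "\<bar>f\<^sub>N k (fst (digits_point s)) - f\<^sub>N k (fst p)\<bar> \<le> (1 / 8) / 2 ^ n"
proof -
  have "\<bar>f\<^sub>N k (fst (digits_point s)) - f\<^sub>N k (fst p)\<bar> \<le> real (cocycle_bound (Suc k)) * \<bar>fst (digits_point s) - fst p\<bar>"
    by (rule cocycle_Lipschitz[of "weight N", OF weight_bounds])
  also have "\<dots> \<le> (1 + real (cocycle_bound (Suc k))) * (1 / 2 ^ (n + offset k))"
    using digits_cell_dist(1)[OF assms(2)] by (intro mult_mono) (auto simp: assms(1) abs_minus_commute)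
  also have "\<dots> \<le> (1 / 8) / 2 ^ n" by (rule offset_scale)
  finally show ?thesis .
qed

end

lemma nat_mod_power2:
  fixes z :: int
  shows "nat (z mod 2 ^ n) < 2 ^ n" "\<exists>q::int. real (nat (z mod 2 ^ n)) / 2 ^ n = of_int z / 2 ^ n - of_int q"
proof -
  have b: "0 \<le> z mod 2 ^ n" "z mod 2 ^ n < 2 ^ n" by simp_all
  then have "int (nat (z mod 2 ^ n)) < int (2 ^ n)" by simp
  then show "nat (z mod 2 ^ n) < 2 ^ n" by (simp only: of_nat_less_iff)
  have "z mod 2 ^ n = z - 2 ^ n * (z div 2 ^ n)" by (simp add: minus_mult_div_eq_mod)
  then have "real_of_int (z mod 2 ^ n) = of_int z - 2 ^ n * of_int (z div 2 ^ n)" by simp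
  then have "real (nat (z mod 2 ^ n)) / 2 ^ n = of_int z / 2 ^ n - of_int (z div 2 ^ n)"
    using b(1) by (simp add: diff_divide_distrib)
  then show "\<exists>q::int. real (nat (z mod 2 ^ n)) / 2 ^ n = of_int z / 2 ^ n - of_int q" by blast
qed

lemma PR_decode: "PR f \<Longrightarrow> PR (\<lambda>x. decode (f x))"
  by (rule PR_from_encode) simp

text \<open>The values at the lower left corner of a cell are computed to the nearest multiple of \<open>2 ^ (- n)\<close>, with error
  at most three quarters of this unit; the variation over the cell contributes at most one eighth. For the map
  itself, the numerators are reduced modulo \<open>2 ^ n\<close> and written in binary.\<close>

theorem anzai_programs:
  "\<exists>P. (\<forall>N. computes_smooth_data (P N) (anzai N (weight N))) \<and> primitive_recursive (\<lambda>N. prog_code (P N))"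
proof -
  have "CR (\<lambda>z::nat \<times> nat list. real (numer_x (snd z)) / 2 ^ length (snd z) + angle (fst z))"
    by (intro CR_intros PR_intros)
  then obtain gx where gx: "PR gx" "\<And>z n. \<bar>real_of_int (gx (z, n)) / 2 ^ n
      - (real (numer_x (snd z)) / 2 ^ length (snd z) + angle (fst z))\<bar> \<le> (3 / 4) / 2 ^ n"
    by (rule CR_round) blast
  have "CR (\<lambda>z::nat \<times> nat list. real (numer_y (snd z)) / 2 ^ length (snd z)
      + cocycle (weight (fst z)) 0 (real (numer_x (snd z)) / 2 ^ length (snd z)))"
    by (intro CR_intros PR_intros)
  then obtain gy where gy: "PR gy" "\<And>z n. \<bar>real_of_int (gy (z, n)) / 2 ^ n - (real (numer_y (snd z)) / 2 ^ length (snd z)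
      + cocycle (weight (fst z)) 0 (real (numer_x (snd z)) / 2 ^ length (snd z)))\<bar> \<le> (3 / 4) / 2 ^ n"
    by (rule CR_round) blast
  have "CR (\<lambda>z::nat \<times> nat \<times> nat list. cocycle (weight (fst z)) (fst (snd z)) (real (numer_x (snd (snd z))) / 2 ^ length (snd (snd z))))"
    by (intro CR_intros PR_intros)
  then obtain gd where gd: "PR gd" "\<And>z n. \<bar>real_of_int (gd (z, n)) / 2 ^ n
      - cocycle (weight (fst z)) (fst (snd z)) (real (numer_x (snd (snd z))) / 2 ^ length (snd (snd z)))\<bar> \<le> (3 / 4) / 2 ^ n"
    by (rule CR_round) blast

  \<comment> \<open>Numerators of the coordinates of the image point, modulo \<open>1\<close>.\<close>
  define u where "u = (\<lambda>(N::nat) xs. nat (gx ((N, xs), length xs - offset 0) mod int (2 ^ (length xs - offset 0))))"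
  define v where "v = (\<lambda>(N::nat) xs. nat (gy ((N, xs), length xs - offset 0) mod int (2 ^ (length xs - offset 0))))"
  define point_code where "point_code N xs = map (\<lambda>i. 2 * (u N xs div 2 ^ (length xs - offset 0 - Suc i) mod 2)
      + v N xs div 2 ^ (length xs - offset 0 - Suc i) mod 2) [0..<length xs - offset 0]" for N xs
  define partials where "partials N k xs = map (\<lambda>i. if i = k then (if k = 1 then 2 ^ (length xs - offset k) :: int else 0, gd ((N, k, xs), length xs - offset k))
      else if k = 1 then (0, 2 ^ (length xs - offset k)) else (0, 0)) [0..<Suc k]" for N k xs
  define \<Phi> :: "nat \<times> nat \<times> nat \<times> nat \<Rightarrow> nat" where
    "\<Phi> z = (if fst (snd z) = 0 then snd (snd (snd z)) + offset (fst (snd (snd z)))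
       else if fst (snd (snd z)) = 0 then encode (point_code (fst z) (decode (snd (snd (snd z)))))
       else encode (partials (fst z) (fst (snd (snd z))) (decode (snd (snd (snd z))))))" for z
  have PRu: "PR (\<lambda>x. u (F x) (G x))" and PRv: "PR (\<lambda>x. v (F x) (G x))" if "PR F" "PR G" for F :: "'c::encodable \<Rightarrow> nat" and G
    unfolding u_def v_def by (intro PR_intros PR_comp[OF gx(1)] PR_comp[OF gy(1)] that)+
  have "PR \<Phi>"
    unfolding \<Phi>_def[abs_def] point_code_def partials_def
    by (intro PR_intros PR_encode PR_decode PRu PRv PR_comp[OF gd(1)])
  then obtain P where P: "\<And>N. has_arity 3 (P N)" "\<And>N a k c. run (P N) [a, k, c] = \<Phi> (N, a, k, c)"
    "primitive_recursive (\<lambda>N. prog_code (P N))"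
    using parametrized_programs by blast

  have "computes_smooth_data (P N) (anzai N (weight N))" for N
  proof -
    define d where "d k n = n + offset k" for k n
    define f0 where "f0 s = (let n = length s - offset 0; xs = digit_list s in zip (bits n (u N xs)) (bits n (v N xs)))" for s
    define f where "f k s = partials N k (digit_list s)" for k s
    have "run (P N) [0, k, n] = d k n" for k n by (simp add: P(2) \<Phi>_def d_def)
    moreover have "run (P N) [1, 0, digits_code s] = digits_code (f0 s)" for s
    proof -
      have "digit_list (f0 s) = point_code N (digit_list s)"
        unfolding digit_list_def[of "f0 s"]
        by (rule nth_equalityI) (auto simp: f0_def point_code_def bits_def Let_def of_bool_odd_eq_mod_2)
      then show ?thesis by (simp add: P(2) \<Phi>_def flip: encode_digit_list)
    qed
    moreover have "run (P N) [1, k, digits_code s] = int_pairs_code (f k s)" if "k \<ge> 1" for k s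
    proof -
      have "int_pairs_code zs = encode zs" for zs
        by (simp add: int_pairs_code_def encode_list_def encode_prod_def encode_int_def)
      then show ?thesis using that by (simp add: P(2) \<Phi>_def f_def flip: encode_digit_list)
    qed
    moreover have "effectively_uniformly_continuous (d 0) f0 (anzai N (weight N))"
      unfolding effectively_uniformly_continuous_def d_def
    proof (intro allI conjI impI ballI)
      fix n P Q assume "torus_dist P Q \<le> 1 / 2 ^ (n + offset 0)"
      then show "torus_dist (anzai N (weight N) P) (anzai N (weight N) Q) \<le> 1 / 2 ^ n" by (rule anzai_modulus)
    next
      fix n and s :: digits assume l: "length s = n + offset 0"
      then show "length (f0 s) = n" by (simp add: f0_def Let_def bits_def)
      fix p assume p: "p \<in> digits_cell s"
      let ?xs = "digit_list s" and ?q = "digits_point s"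
      have un: "u N ?xs < 2 ^ n" "v N ?xs < 2 ^ n" unfolding u_def v_def using nat_mod_power2(1) by (simp_all add: l)
      have "length (bits n (u N ?xs)) = length (bits n (v N ?xs))" by (simp add: bits_def)
      then have pt: "digits_point (f0 s) = (real (u N ?xs) / 2 ^ n, real (v N ?xs) / 2 ^ n)"
        using un by (simp add: digits_point_def f0_def Let_def l binary_value_bits)
      have eps: "(3 / 4) / 2 ^ n + (1 / 8) / 2 ^ n \<le> (1::real) / 2 ^ n" by (simp add: field_simps)
      obtain a :: int where a: "real (u N ?xs) / 2 ^ n = of_int (gx ((N, ?xs), n)) / 2 ^ n - of_int a"
        using nat_mod_power2(2)[of "gx ((N, ?xs), n)" n] by (auto simp: u_def l)
      obtain c :: int where c: "real (v N ?xs) / 2 ^ n = of_int (gy ((N, ?xs), n)) / 2 ^ n - of_int c"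
        using nat_mod_power2(2)[of "gy ((N, ?xs), n)" n] by (auto simp: v_def l)
      have "\<bar>of_int (gx ((N, ?xs), n)) / 2 ^ n - (fst ?q + angle N)\<bar> \<le> (3 / 4) / 2 ^ n"
        using gx(2)[of "(N, ?xs)" n] by (simp add: digits_point_eq)
      moreover have "\<bar>fst ?q - fst p\<bar> \<le> (1 / 8) / 2 ^ n"
        using digits_cell_dist(1)[OF p] small_offset[of n 0] by (simp add: l)
      ultimately have "\<bar>real (u N ?xs) / 2 ^ n - (fst p + angle N) - of_int (- a)\<bar> \<le> 1 / 2 ^ n"
        unfolding a of_int_minus using eps by linarith
      then have X: "circle_norm (real (u N ?xs) / 2 ^ n - (fst p + angle N)) \<le> 1 / 2 ^ n"
        using circle_norm_le_dist order_trans by blast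
      have "\<bar>of_int (gy ((N, ?xs), n)) / 2 ^ n - (snd ?q + cocycle (weight N) 0 (fst ?q))\<bar> \<le> (3 / 4) / 2 ^ n"
        using gy(2)[of "(N, ?xs)" n] by (simp add: digits_point_eq)
      moreover have "\<bar>(snd ?q + cocycle (weight N) 0 (fst ?q)) - (snd p + cocycle (weight N) 0 (fst p))\<bar> \<le> (1 / 8) / 2 ^ n"
        by (rule skew_lift_Lipschitz) (use digits_cell_dist[OF p] in \<open>simp_all add: l abs_minus_commute\<close>)
      ultimately have "\<bar>real (v N ?xs) / 2 ^ n - (snd p + cocycle (weight N) 0 (fst p)) - of_int (- c)\<bar> \<le> 1 / 2 ^ n"
        unfolding c of_int_minus using eps by linarith
      then have Y: "circle_norm (real (v N ?xs) / 2 ^ n - (snd p + cocycle (weight N) 0 (fst p))) \<le> 1 / 2 ^ n"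
        using circle_norm_le_dist order_trans by blast
      show "torus_dist (to_torus (digits_point (f0 s))) (anzai N (weight N) (to_torus p)) \<le> 1 / 2 ^ n"
        unfolding anzai_to_torus torus_dist_to_torus pt using X Y by (simp add: skew_lift_def)
    qed
    moreover have "smooth_lift (skew_lift (angle N) (cocycle (weight N) 0)) (anzai N (weight N))"
      unfolding anzai_def
      by (rule smooth_lift_skew[of "cocycle (weight N)", OF cocycle_deriv[of "weight N", OF weight_bounds] periodic_cocycle[of "weight N", OF weight_bounds]])
    moreover have "length (f k s) = Suc k" for k s by (simp add: f_def partials_def)
    moreover have "effectively_uniformly_continuous_plane (d k) (\<lambda>s. f k s ! i)
        (mixed_partial i (k - i) (skew_lift (angle N) (cocycle (weight N) 0)))" if k: "k \<ge> 1" and i: "i \<le> k" for k i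
    proof -
      define H where "H = mixed_partial i (k - i) (skew_lift (angle N) (cocycle (weight N) 0))"
      have H: "H p = (if k = i then (if i = 1 then 1 else 0, cocycle (weight N) k (fst p)) else if i = 0 \<and> k = 1 then (0, 1) else (0, 0))" for p
        unfolding H_def using k i
        by (subst mixed_partial_skew_lift[of "cocycle (weight N)", OF cocycle_deriv[of "weight N", OF weight_bounds]]) auto
      have "plane_dist (H p) (H q) \<le> 1 / 2 ^ n" if pq: "plane_dist p q \<le> 1 / 2 ^ d k n" for p q n
      proof -
        have "\<bar>cocycle (weight N) k (fst p) - cocycle (weight N) k (fst q)\<bar> \<le> real (cocycle_bound (Suc k)) * \<bar>fst p - fst q\<bar>"
          by (rule cocycle_Lipschitz[of "weight N", OF weight_bounds])
        also have "\<dots> \<le> (1 + real (cocycle_bound (Suc k))) * (1 / 2 ^ (n + offset k))"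
          using pq by (intro mult_mono) (auto simp: plane_dist_def d_def)
        also have "\<dots> \<le> (1 / 8) / 2 ^ n" by (rule offset_scale)
        also have "\<dots> \<le> 1 / 2 ^ n" by (intro divide_right_mono) auto
        finally show ?thesis by (auto simp: H plane_dist_def)
      qed
      moreover have "plane_dist (of_int (fst (f k s ! i)) / 2 ^ n, of_int (snd (f k s ! i)) / 2 ^ n) (H p) \<le> 1 / 2 ^ n"
        if l: "length s = d k n" and p: "p \<in> digits_cell s" for s p n
      proof -
        have fi: "f k s ! i = (if i = k then (if k = 1 then 2 ^ n else 0, gd ((N, k, digit_list s), n)) else if k = 1 then (0, 2 ^ n) else (0, 0))"
          using i l by (simp add: f_def partials_def d_def del: upt_Suc)
        have "\<bar>of_int (gd ((N, k, digit_list s), n)) / 2 ^ n - cocycle (weight N) k (fst (digits_point s))\<bar> \<le> (3 / 4) / 2 ^ n"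
          using gd(2)[of "(N, k, digit_list s)" n] by (simp add: digits_point_eq)
        moreover have "\<bar>cocycle (weight N) k (fst (digits_point s)) - cocycle (weight N) k (fst p)\<bar> \<le> (1 / 8) / 2 ^ n"
          using cocycle_cell l p by (simp add: d_def)
        moreover have "(3 / 4) / 2 ^ n + (1 / 8) / 2 ^ n \<le> (1::real) / 2 ^ n" by (simp add: field_simps)
        ultimately have "\<bar>of_int (gd ((N, k, digit_list s), n)) / 2 ^ n - cocycle (weight N) k (fst p)\<bar> \<le> 1 / 2 ^ n"
          by linarith
        then show ?thesis using k i by (auto simp: H fi plane_dist_def)
      qed
      ultimately show ?thesis unfolding effectively_uniformly_continuous_plane_def H_def[symmetric] by blast
    qed
    ultimately show ?thesis
      unfolding computes_smooth_data_def effectively_smooth_def using P(1)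
      by (intro conjI exI[of _ d] exI[of _ f0] exI[of _ f] exI[of _ "skew_lift (angle N) (cocycle (weight N) 0)"]) auto
  qed
  then show ?thesis using P(3) by blast
qed

section \<open>Truth and reversibility\<close>

text \<open>The choice of weights turns the truth of a sentence into the oddness of its cocycle.\<close>

theorem theorem1:
  shows "\<exists>(F :: nat \<Rightarrow> nat) (T :: nat \<Rightarrow> torus \<Rightarrow> torus).
    primitive_recursive F
    \<and> (\<forall>N\<in>Pi01_codes. codes_diffeomorphism (F N) (T N))
    \<and> (\<forall>N\<in>Pi01_codes. codes_true_sentence N \<longleftrightarrow>
          measure_isomorphic torus_lebesgue (T N) torus_lebesgue (inv (T N)))
    \<and> (\<forall>M\<in>Pi01_codes. \<forall>N\<in>Pi01_codes. M \<noteq> N \<longrightarrow>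
          \<not> measure_isomorphic torus_lebesgue (T M) torus_lebesgue (T N))
    \<and> (\<forall>N\<in>Pi01_codes. torus_diffeomorphism (T N)
          \<and> measure_preserving torus_lebesgue torus_lebesgue (T N)
          \<and> ergodic torus_lebesgue (T N))"
proof -
  define T where "T N = anzai N (weight N)" for N
  obtain P where P: "\<And>N. computes_smooth_data (P N) (T N)" "primitive_recursive (\<lambda>N. prog_code (P N))"
    using anzai_programs unfolding T_def by blast
  have stable: "\<exists>J \<beta>. \<forall>j\<ge>J. weight N j = \<beta>" for N
  proof (cases "\<exists>J. refuted N J")
    case True
    then obtain J where "refuted N J" by blast
    then have "\<forall>j\<ge>J. weight N j = 1" unfolding weight_def refuted_def using order_trans by (auto 4 4)
    then show ?thesis by blast
  next
    case False
    then have "\<forall>j\<ge>0. weight N j = 0" by (simp add: weight_def)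
    then show ?thesis by blast
  qed
  have diffeo: "torus_diffeomorphism (T N)" for N
    unfolding T_def anzai_def
    by (rule torus_diffeomorphism_skew[of "cocycle (weight N)", OF cocycle_deriv[of "weight N", OF weight_bounds] periodic_cocycle[of "weight N", OF weight_bounds]])
  have mp: "measure_preserving torus_lebesgue torus_lebesgue (T N)" for N
    unfolding T_def by (rule measure_preserving_anzai[of "weight N", OF weight_bounds])
  have erg: "ergodic torus_lebesgue (T N)" for N
  proof -
    obtain J \<beta> where "\<And>j. J \<le> j \<Longrightarrow> weight N j = \<beta>" using stable by blast
    from ergodic_anzai[of "weight N", OF weight_bounds this] show ?thesis unfolding T_def .
  qed
  have iso: "codes_true_sentence N \<longleftrightarrow> measure_isomorphic torus_lebesgue (T N) torus_lebesgue (inv (T N))"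
    if NP: "N \<in> Pi01_codes" for N
  proof (cases "codes_true_sentence N")
    case True
    then have "weight N j = 0" for j using codes_true_iff[OF NP] by (simp add: weight_def)
    then show ?thesis using True anzai_reversible unfolding T_def by blast
  next
    case False
    then obtain J where "refuted N J" using codes_true_iff[OF NP] by blast
    then have "weight N j = 1" if "J \<le> j" for j
      using that unfolding weight_def refuted_def by (auto intro: order_trans)
    from anzai_not_reversible[of "weight N", OF weight_bounds this refl] show ?thesis using False unfolding T_def by blast
  qed
  have noniso: "\<not> measure_isomorphic torus_lebesgue (T M) torus_lebesgue (T N)" if "M \<noteq> N" for M N
  proof -
    obtain J \<beta> where "\<And>j. J \<le> j \<Longrightarrow> weight M j = \<beta>" using stable by blast
    from anzai_not_isomorphic[of "weight M" _ _ "weight N", OF weight_bounds this weight_bounds that] show ?thesis unfolding T_def .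
  qed
  show ?thesis
    by (rule exI[of _ "\<lambda>N. prog_code (P N)"], rule exI[of _ T])
      (use P diffeo mp erg iso noniso in \<open>auto simp: codes_diffeomorphism_def\<close>)
qed

end
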